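(* Let $C(p,r)$ be a closed disk and suppose there are $n'\le n$ candidate obstacles, i.e. pairwise disjoint line segments all contained in $C(p,r)$ (obtained from $n$ obstacles by pruning). Then the circular visibility region $\mathscr R_{cvr}(p,r)$, with its boundary represented as an ordered doubly linked list of vertices and appendix points, can be constructed in $O(n\log n)$ time.
   Context: $C(p,r)$ is the closed disk of center $p$ and radius $r$. Two points are visible to each other if the segment joining them crosses no obstacle. $\mathscr R_{cvr}(p,r)$ is the set of points of $C(p,r)$ visible from $p$. Its boundary consists of straight segments and circular arcs; a circular arc with endpoints $q,q'$ is represented by $q,q'$ together with an additional point on the arc (an appendix point) that disambiguates which of the two arcs is meant. *)

theory Defs
  imports "HOL-Analysis.Analysis" "HOL-Library.Landau_Symbols"
begin

section \<open>Circular visibility regions\<close>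

text \<open>The plane is the type of complex numbers. An obstacle is a line segment, given by its
  two endpoints.\<close>

type_synonym obstacle = "complex \<times> complex"

definition seg :: "obstacle \<Rightarrow> complex set" where
  "seg s = closed_segment (fst s) (snd s)"

definition obstructed :: "obstacle list \<Rightarrow> complex set" where
  "obstructed obs = (\<Union>s\<in>set obs. seg s)"

text \<open>The open segment is used so that a segment which merely ends on an obstacle does not cross
  it: the points of an obstacle facing the viewer are visible. A line of sight that passes through
  an endpoint of an obstacle is blocked there.\<close>

definition visible :: "obstacle list \<Rightarrow> complex \<Rightarrow> complex \<Rightarrow> bool" where
  "visible obs p q \<longleftrightarrow> open_segment p q \<inter> obstructed obs = {}"

definition circ_vis_region :: "obstacle list \<Rightarrow> complex \<Rightarrow> real \<Rightarrow> complex set" where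
  "circ_vis_region obs p r = {q \<in> cball p r. visible obs p q}"

text \<open>The candidates cover exactly the obstructed part of the open disk. Mere contacts of an
  obstacle with the bounding circle may be kept or dropped: they block no line of sight inside
  the disk.\<close>

definition candidate_obstacles ::
    "complex \<Rightarrow> real \<Rightarrow> obstacle list \<Rightarrow> obstacle list \<Rightarrow> bool" where
  "candidate_obstacles p r obs cs \<longleftrightarrow>
     length cs \<le> length obs \<and>
     obstructed obs \<inter> ball p r \<subseteq> obstructed cs \<and> obstructed cs \<subseteq> obstructed obs \<and>
     (\<forall>s\<in>set cs. seg s \<subseteq> cball p r) \<and>
     disjoint_family_on (\<lambda>i. seg (cs ! i)) {..<length cs}"

section \<open>Boundary representation\<close>

text \<open>A boundary is a cyclic list of vertices. A vertex carries \<open>Some w\<close> if the edge to the next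
  vertex is a circular arc with appendix point \<open>w\<close>, and \<open>None\<close> if that edge is straight.\<close>

type_synonym boundary = "(complex \<times> complex option) list"

text \<open>Of the two arcs of the circle with endpoints \<open>u\<close> and \<open>v\<close>, the one through \<open>w\<close>.\<close>

definition circ_arc :: "complex \<Rightarrow> real \<Rightarrow> complex \<Rightarrow> complex \<Rightarrow> complex \<Rightarrow> complex set" where
  "circ_arc p r u w v =
     insert u (insert v (connected_component_set (sphere p r - {u, v}) w))"

definition start :: "boundary \<Rightarrow> nat \<Rightarrow> complex" where
  "start es i = fst (es ! i)"

definition target :: "boundary \<Rightarrow> nat \<Rightarrow> complex" where
  "target es i = fst (es ! (Suc i mod length es))"

definition edge :: "complex \<Rightarrow> real \<Rightarrow> boundary \<Rightarrow> nat \<Rightarrow> complex set" where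
  "edge p r es i =
     (case snd (es ! i) of
        None \<Rightarrow> closed_segment (start es i) (target es i)
      | Some w \<Rightarrow> circ_arc p r (start es i) w (target es i))"

definition proper_edge :: "complex \<Rightarrow> real \<Rightarrow> boundary \<Rightarrow> nat \<Rightarrow> bool" where
  "proper_edge p r es i \<longleftrightarrow>
     start es i \<noteq> target es i \<and>
     (case snd (es ! i) of
        None \<Rightarrow> True
      | Some w \<Rightarrow> start es i \<in> sphere p r \<and> target es i \<in> sphere p r \<and>
                  w \<in> sphere p r - {start es i, target es i})"

text \<open>The entries of the linked list; the flag marks appendix points.\<close>

definition entries :: "boundary \<Rightarrow> (bool \<times> complex) list" where
  "entries es =
     concat (map (\<lambda>(u, a). (False, u) # (case a of None \<Rightarrow> [] | Some w \<Rightarrow> [(True, w)])) es)"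

text \<open>The points are met in this order when turning once counterclockwise around \<open>p\<close>
  (\<open>\<theta>\<close> is a choice of polar angles).\<close>

definition ccw_around :: "complex \<Rightarrow> complex list \<Rightarrow> bool" where
  "ccw_around p zs \<longleftrightarrow>
     (\<exists>\<theta> :: nat \<Rightarrow> real.
        (\<forall>i<length zs. zs ! i = p + of_real (dist p (zs ! i)) * cis (\<theta> i)) \<and>
        (\<forall>i j. i \<le> j \<and> j < length zs \<longrightarrow> \<theta> i \<le> \<theta> j \<and> \<theta> j \<le> \<theta> i + 2 * pi))"

text \<open>A visibility region is star-shaped around \<open>p\<close>, so its boundary is traversed
  counterclockwise around \<open>p\<close>. An obstacle collinear with \<open>p\<close> can produce a slit, which the
  boundary runs along once in each direction; any other retracing of straight edges is excluded
  by the last conjunct.\<close>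

definition represents_boundary ::
    "complex \<Rightarrow> real \<Rightarrow> boundary \<Rightarrow> complex set \<Rightarrow> bool" where
  "represents_boundary p r es R \<longleftrightarrow>
     (\<forall>i<length es. proper_edge p r es i) \<and>
     frontier R = (\<Union>i<length es. edge p r es i) \<and>
     ccw_around p (map snd (entries es)) \<and>
     (\<forall>i<length es. \<forall>j<length es. i \<noteq> j \<and> snd (es ! i) = None \<and> snd (es ! j) = None \<longrightarrow>
        finite (edge p r es i \<inter> edge p r es j) \<or>
        (\<exists>k<0. target es i - start es i = of_real k * (target es j - start es j)))"

section \<open>Real RAM\<close>

text \<open>A random access machine with unit cost operations. There are two kinds of memory cells,
  for exact real numbers and for natural numbers; only the latter can be used as addresses. Both
  memories are divided into banks. A bank is selected by a literal in the program text, so that a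
  program uses finitely many banks, and a register is a cell with a literal address. There is no
  conversion between the two kinds, no rounding, and no multiplication of natural numbers; the
  square root is needed to intersect a ray with a circle. Literals in programs are integers, so no
  information can be hidden in real constants.\<close>

record state =
  nmem :: "nat \<Rightarrow> nat \<Rightarrow> nat"
  rmem :: "nat \<Rightarrow> nat \<Rightarrow> real"

datatype nexp =
    NConst nat
  | NRead nat nexp
  | NAdd nexp nexp
  | NSub nexp nexp

datatype rexp =
    RConst int
  | RRead nat nexp
  | RAdd rexp rexp
  | RSub rexp rexp
  | RMul rexp rexp
  | RDiv rexp rexp
  | RSqrt rexp

datatype bexp =
    NLess nexp nexp
  | RLess rexp rexp
  | BNot bexp
  | BAnd bexp bexp

datatype com =
    Skip
  | NAssign nat nexp nexp
  | RAssign nat nexp rexp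
  | Seq com com
  | If bexp com com
  | While bexp com

fun nval :: "nexp \<Rightarrow> state \<Rightarrow> nat" where
  "nval (NConst n) s = n"
| "nval (NRead b e) s = nmem s b (nval e s)"
| "nval (NAdd e e') s = nval e s + nval e' s"
| "nval (NSub e e') s = nval e s - nval e' s"

fun rval :: "rexp \<Rightarrow> state \<Rightarrow> real" where
  "rval (RConst k) s = of_int k"
| "rval (RRead b e) s = rmem s b (nval e s)"
| "rval (RAdd e e') s = rval e s + rval e' s"
| "rval (RSub e e') s = rval e s - rval e' s"
| "rval (RMul e e') s = rval e s * rval e' s"
| "rval (RDiv e e') s = rval e s / rval e' s"
| "rval (RSqrt e) s = sqrt (rval e s)"

fun bval :: "bexp \<Rightarrow> state \<Rightarrow> bool" where
  "bval (NLess e e') s \<longleftrightarrow> nval e s < nval e' s"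
| "bval (RLess e e') s \<longleftrightarrow> rval e s < rval e' s"
| "bval (BNot b) s \<longleftrightarrow> \<not> bval b s"
| "bval (BAnd b b') s \<longleftrightarrow> bval b s \<and> bval b' s"

fun ncost :: "nexp \<Rightarrow> nat" where
  "ncost (NConst n) = 1"
| "ncost (NRead b e) = 1 + ncost e"
| "ncost (NAdd e e') = 1 + ncost e + ncost e'"
| "ncost (NSub e e') = 1 + ncost e + ncost e'"

fun rcost :: "rexp \<Rightarrow> nat" where
  "rcost (RConst k) = 1"
| "rcost (RRead b e) = 1 + ncost e"
| "rcost (RAdd e e') = 1 + rcost e + rcost e'"
| "rcost (RSub e e') = 1 + rcost e + rcost e'"
| "rcost (RMul e e') = 1 + rcost e + rcost e'"
| "rcost (RDiv e e') = 1 + rcost e + rcost e'"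
| "rcost (RSqrt e) = 1 + rcost e"

fun bcost :: "bexp \<Rightarrow> nat" where
  "bcost (NLess e e') = 1 + ncost e + ncost e'"
| "bcost (RLess e e') = 1 + rcost e + rcost e'"
| "bcost (BNot b) = 1 + bcost b"
| "bcost (BAnd b b') = 1 + bcost b + bcost b'"

definition nwrite :: "nat \<Rightarrow> nat \<Rightarrow> nat \<Rightarrow> state \<Rightarrow> state" where
  "nwrite b i x s = s\<lparr>nmem := (nmem s)(b := (nmem s b)(i := x))\<rparr>"

definition rwrite :: "nat \<Rightarrow> nat \<Rightarrow> real \<Rightarrow> state \<Rightarrow> state" where
  "rwrite b i x s = s\<lparr>rmem := (rmem s)(b := (rmem s b)(i := x))\<rparr>"

text \<open>\<open>exec c s t s'\<close>: started in state \<open>s\<close>, the program \<open>c\<close> halts in state \<open>s'\<close> after \<open>t\<close>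
  steps.\<close>

inductive exec :: "com \<Rightarrow> state \<Rightarrow> nat \<Rightarrow> state \<Rightarrow> bool" where
  Skip: "exec Skip s 1 s"
| NAssign: "exec (NAssign b a e) s (1 + ncost a + ncost e) (nwrite b (nval a s) (nval e s) s)"
| RAssign: "exec (RAssign b a e) s (1 + ncost a + rcost e) (rwrite b (nval a s) (rval e s) s)"
| Seq: "exec c s t s' \<Longrightarrow> exec c' s' t' s'' \<Longrightarrow> exec (Seq c c') s (t + t') s''"
| IfTrue: "bval b s \<Longrightarrow> exec c s t s' \<Longrightarrow> exec (If b c c') s (1 + bcost b + t) s'"
| IfFalse: "\<not> bval b s \<Longrightarrow> exec c' s t s' \<Longrightarrow> exec (If b c c') s (1 + bcost b + t) s'"
| WhileFalse: "\<not> bval b s \<Longrightarrow> exec (While b c) s (1 + bcost b) s"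
| WhileTrue: "bval b s \<Longrightarrow> exec c s t s' \<Longrightarrow> exec (While b c) s' t' s'' \<Longrightarrow>
    exec (While b c) s (1 + bcost b + t + t') s''"

inductive_cases exec_SkipE: "exec Skip s t s'"
inductive_cases exec_NAssignE: "exec (NAssign b a e) s t s'"
inductive_cases exec_RAssignE: "exec (RAssign b a e) s t s'"
inductive_cases exec_SeqE: "exec (Seq c c') s t s'"
inductive_cases exec_IfE: "exec (If b c c') s t s'"
inductive_cases exec_WhileE: "exec (While b c) s t s'"

lemma exec_deterministic:
  "exec c s t s' \<Longrightarrow> exec c s u s'' \<Longrightarrow> t = u \<and> s' = s''"
proof (induction arbitrary: u s'' rule: exec.induct)
  case (Skip s)
  then show ?case by (auto elim: exec_SkipE)
next
  case (NAssign b a e s)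
  then show ?case by (auto elim: exec_NAssignE)
next
  case (RAssign b a e s)
  then show ?case by (auto elim: exec_RAssignE)
next
  case (Seq c s t s' c' t' s3)
  from Seq.prems obtain t1 s1 t2 where "exec c s t1 s1" "exec c' s1 t2 s''" "u = t1 + t2"
    by (rule exec_SeqE)
  with Seq.IH show ?case by metis
next
  case (IfTrue b s c t s' c')
  from IfTrue.prems \<open>bval b s\<close> obtain t1 where "exec c s t1 s''" "u = 1 + bcost b + t1"
    by (auto elim: exec_IfE)
  with IfTrue.IH show ?case by metis
next
  case (IfFalse b s c' t s' c)
  from IfFalse.prems \<open>\<not> bval b s\<close> obtain t1 where "exec c' s t1 s''" "u = 1 + bcost b + t1"
    by (auto elim: exec_IfE)
  with IfFalse.IH show ?case by metis
next
  case (WhileFalse b s c)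
  from WhileFalse.prems \<open>\<not> bval b s\<close> show ?case by (auto elim: exec_WhileE)
next
  case (WhileTrue b s c t s' t' s3)
  from WhileTrue.prems \<open>bval b s\<close> obtain t1 s1 t2
    where "exec c s t1 s1" "exec (While b c) s1 t2 s''" "u = 1 + bcost b + t1 + t2"
    by (auto elim: exec_WhileE)
  with WhileTrue.IH show ?case by metis
qed

section \<open>Input and output conventions\<close>

text \<open>Real bank 0 contains the coordinates of \<open>p\<close>, the radius, and the coordinates of the
  endpoints of the obstacles; the number of obstacles is in cell 0 of natural bank 0. All other
  cells are 0.\<close>

definition input_data :: "complex \<Rightarrow> real \<Rightarrow> obstacle list \<Rightarrow> real list" where
  "input_data p r cs =
     [Re p, Im p, r] @ concat (map (\<lambda>(a, b). [Re a, Im a, Re b, Im b]) cs)"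

definition input_state :: "complex \<Rightarrow> real \<Rightarrow> obstacle list \<Rightarrow> state" where
  "input_state p r cs =
     \<lparr>nmem = (\<lambda>b i. if b = 0 \<and> i = 0 then length cs else 0),
      rmem = (\<lambda>b i. if b = 0 \<and> i < length (input_data p r cs)
                     then input_data p r cs ! i else 0)\<rparr>"

text \<open>A circular doubly linked list whose head is stored in cell 0 of natural bank 1. The node
  with address \<open>a\<close> consists of the cells with address \<open>a\<close> of natural banks 2 (successor),
  3 (predecessor), 4 (tag, 1 for appendix points and 0 for vertices), and of real banks 1 and 2
  (coordinates).\<close>

definition holds_dll :: "state \<Rightarrow> (bool \<times> complex) list \<Rightarrow> bool" where
  "holds_dll s xs \<longleftrightarrow> xs \<noteq> [] \<and>
     (\<exists>adr. length adr = length xs \<and> distinct adr \<and> nmem s 1 0 = hd adr \<and>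
        (\<forall>i<length xs.
           nmem s 2 (adr ! i) = adr ! (Suc i mod length xs) \<and>
           nmem s 3 (adr ! (Suc i mod length xs)) = adr ! i \<and>
           nmem s 4 (adr ! i) = of_bool (fst (xs ! i)) \<and>
           Complex (rmem s 1 (adr ! i)) (rmem s 2 (adr ! i)) = snd (xs ! i)))"

end

theory Submission
  imports Defs "HOL-Real_Asymp.Real_Asymp"
begin

text \<open>
  The directions of the obstacle endpoints cut the disk into sectors around \<open>p\<close>. Inside a sector the
  obstacles that are met by one ray are met by all rays, and always in the same order because they
      are
  disjoint, so that what one sees is a part of a single obstacle or of the circle. The boundary runs
  through these curves and along the finitely many rays that separate the sectors, where it goes
      down
  to the nearest obstacle point on the ray (which may be the tip of an obstacle collinear with \<open>p\<close>)
  and up again.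

  The machine sorts the endpoints by a monotone substitute for the polar angle, extracting them one
  by one from a tournament tree. A second tournament tree contains the obstacles that meet the
      current
  ray, compared by their distance along it. Since this order does not change while the ray rotates,
  inserting or deleting an obstacle only requires the matches on one path to be replayed, which
      costs
  \<open>O(log n)\<close>, and the root is the visible obstacle.
\<close>

section \<open>The boundary of a star-shaped region\<close>

text \<open>The region differs from its closure on the separating rays: a line of sight through an
  endpoint is blocked there even if a neighbouring sector, possibly both, sees further. Each ray
  therefore carries three radii, the limits from its two sides and the true extent. An obstacle
  collinear with \<open>p\<close> blocks on at most two rays; it never enters the tree of obstacles
  and acts through the true extent alone. Half open cones settle the ties: an obstacle covers the
  sector that begins at its first endpoint and not the one that begins at its last. So the root of
  the tree is meaningful as soon as all events of a ray have been processed, in whatever order. Two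
  artificial events, with pseudo-angles 0 and 2, supply the first ray and a second one. Hence no
  sector is a full turn and every arc has distinct end points, even without obstacles, and the first
  event never turns the ray. The instruction set shapes the program: without trigonometric functions
  it needs pseudo-angles, and without division of natural numbers a table of halves for climbing the
  trees.\<close>

definition pol :: "complex \<Rightarrow> real \<Rightarrow> real \<Rightarrow> complex" where
  "pol p s \<theta> = p + of_real s * cis \<theta>"

lemma dist_pol: "dist p (pol p s \<theta>) = \<bar>s\<bar>"
  by (simp add: pol_def dist_norm norm_mult)

lemma pol_0 [simp]: "pol p 0 \<theta> = p"
  by (simp add: pol_def)

lemma pol_2pi [simp]: "pol p s (2 * pi) = pol p s 0"
  by (simp add: pol_def)

lemma cis_eq_cases:
  assumes "cis \<theta> = cis \<phi>" "0 \<le> \<theta>" "\<theta> \<le> 2 * pi" "0 \<le> \<phi>" "\<phi> \<le> 2 * pi"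
  shows "\<theta> = \<phi> \<or> \<theta> = 0 \<and> \<phi> = 2 * pi \<or> \<theta> = 2 * pi \<and> \<phi> = 0"
proof -
  have "cis (\<theta> - \<phi>) = 1"
    using assms(1) by (simp add: cis_divide [symmetric])
  then have "cos (\<theta> - \<phi>) = 1" by (metis cis.sel(1) one_complex.sel(1))
  then obtain n :: int where n: "\<theta> - \<phi> = of_int n * 2 * pi"
    using cos_one_2pi_int by blast
  have "\<bar>\<theta> - \<phi>\<bar> \<le> 2 * pi" using assms by linarith
  then have "\<bar>real_of_int n\<bar> \<le> 1" by (simp add: n abs_mult)
  then have "n = 0 \<or> n = 1 \<or> n = -1" by linarith
  then show ?thesis using n assms pi_gt_zero by (auto; linarith)
qed

lemma pol_eqD:
  assumes "pol p s \<theta> = pol p s' \<theta>'" "0 < s" "0 \<le> s'"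
  shows "s' = s" "cis \<theta> = cis \<theta>'"
proof -
  have "\<bar>s\<bar> = \<bar>s'\<bar>" by (metis assms(1) dist_pol)
  then show "s' = s" using assms by simp
  then show "cis \<theta> = cis \<theta>'" using assms(1,2) by (simp add: pol_def)
qed

text \<open>On each ray three radii meet: \<open>f k (\<Theta> k)\<close> and \<open>fm k\<close>
  are the limits of the visible radius from the sectors after and before the ray, cyclically for ray
  0, and \<open>\<rho> k\<close> is the extent of \<open>R\<close> on the ray itself. It may lie
  below both limits, which is a slit, but never above one.\<close>

locale fan =
  fixes p :: complex and r :: real and M :: nat and \<Theta> :: "nat \<Rightarrow> real"
    and f :: "nat \<Rightarrow> real \<Rightarrow> real" and \<rho> :: "nat \<Rightarrow> real" and R :: "complex set"
    and fm :: "nat \<Rightarrow> real"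
  assumes M2: "2 \<le> M" and Th0: "\<Theta> 0 = 0" and ThM: "\<Theta> M = 2 * pi"
    and Th_mono: "\<And>i j. i < j \<Longrightarrow> j \<le> M \<Longrightarrow> \<Theta> i < \<Theta> j"
    and cont: "\<And>k. k < M \<Longrightarrow> continuous_on {\<Theta> k..\<Theta> (Suc k)} (f k)"
    and f_pos: "\<And>k \<theta>. k < M \<Longrightarrow> \<Theta> k \<le> \<theta> \<Longrightarrow> \<theta> \<le> \<Theta> (Suc k) \<Longrightarrow> 0 < f k \<theta>"
    and f_le: "\<And>k \<theta>. k < M \<Longrightarrow> \<Theta> k \<le> \<theta> \<Longrightarrow> \<theta> \<le> \<Theta> (Suc k) \<Longrightarrow> f k \<theta> \<le> r"
    and fm_Suc: "\<And>k. Suc k < M \<Longrightarrow> fm (Suc k) = f k (\<Theta> (Suc k))"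
    and fm_0: "fm 0 = f (M - 1) (2 * pi)"
    and \<rho>_nonneg: "\<And>k. k < M \<Longrightarrow> 0 \<le> \<rho> k"
    and \<rho>_le: "\<And>k. k < M \<Longrightarrow> \<rho> k \<le> f k (\<Theta> k)"
    and \<rho>_le': "\<And>k. k < M \<Longrightarrow> \<rho> k \<le> fm k"
    and R_in: "\<And>k \<theta> s. k < M \<Longrightarrow> \<Theta> k < \<theta> \<Longrightarrow> \<theta> < \<Theta> (Suc k) \<Longrightarrow> 0 \<le> s \<Longrightarrow>
      pol p s \<theta> \<in> R \<longleftrightarrow> s \<le> f k \<theta>"
    and R_at: "\<And>k s. k < M \<Longrightarrow> 0 \<le> s \<Longrightarrow> pol p s (\<Theta> k) \<in> R \<longleftrightarrow> s \<le> \<rho> k"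
begin

lemma Th_mono_le: "i \<le> j \<Longrightarrow> j \<le> M \<Longrightarrow> \<Theta> i \<le> \<Theta> j"
  using Th_mono [of i j] by (cases "i = j") auto

lemma Th_ge_0: "k \<le> M \<Longrightarrow> 0 \<le> \<Theta> k"
  using Th_mono_le [of 0 k] Th0 by simp

lemma Th_le_2pi: "k \<le> M \<Longrightarrow> \<Theta> k \<le> 2 * pi"
  using Th_mono_le [of k M] ThM by simp

lemma Th_less_2pi: "k < M \<Longrightarrow> \<Theta> k < 2 * pi"
  using Th_mono [of k M] ThM by simp

lemma Th_inj: "i \<le> M \<Longrightarrow> j \<le> M \<Longrightarrow> \<Theta> i = \<Theta> j \<Longrightarrow> i = j"
  using Th_mono by (metis less_irrefl linorder_neqE_nat)

definition graph :: "nat \<Rightarrow> complex set" where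
  "graph k = (\<lambda>\<theta>. pol p (f k \<theta>) \<theta>) ` {\<Theta> k..\<Theta> (Suc k)}"

definition radial :: "nat \<Rightarrow> real \<Rightarrow> complex set" where
  "radial k b = (\<lambda>s. pol p s (\<Theta> k)) ` {\<rho> k..b}"

lemma sector_cases:
  assumes "0 \<le> \<theta>" "\<theta> < 2 * pi"
  obtains k where "k < M" "\<theta> = \<Theta> k" | k where "k < M" "\<Theta> k < \<theta>" "\<theta> < \<Theta> (Suc k)"
proof -
  define k where "k = (GREATEST k. k \<le> M \<and> \<Theta> k \<le> \<theta>)"
  have ex: "0 \<le> M \<and> \<Theta> 0 \<le> \<theta>" using assms Th0 by simp
  have k: "k \<le> M \<and> \<Theta> k \<le> \<theta>"
    unfolding k_def by (rule GreatestI_nat [where P = "\<lambda>k. k \<le> M \<and> \<Theta> k \<le> \<theta>", OF ex]) auto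
  have kM: "k < M" using k ThM assms by (metis le_neq_implies_less not_less)
  have "\<not> (Suc k \<le> M \<and> \<Theta> (Suc k) \<le> \<theta>)"
    using Greatest_le_nat [of "\<lambda>k. k \<le> M \<and> \<Theta> k \<le> \<theta>" "Suc k" M] unfolding k_def by auto
  then show thesis using that k kM by force
qed

lemma polar_cases:
  obtains k s where "k < M" "0 \<le> s" "x = pol p s (\<Theta> k)"
  | k s \<theta> where "k < M" "\<Theta> k < \<theta>" "\<theta> < \<Theta> (Suc k)" "0 \<le> s" "x = pol p s \<theta>"
proof -
  have x: "x = pol p (norm (x - p)) (Arg2pi (x - p))"
    by (simp add: pol_def) (metis Arg2pi_eq add.commute cis_conv_exp diff_add_cancel mult.commute)
  have "0 \<le> Arg2pi (x - p)" "Arg2pi (x - p) < 2 * pi"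
    using Arg2pi_ge_0 Arg2pi_lt_2pi by auto
  then show thesis
    by (rule sector_cases) (metis x norm_ge_zero that)+
qed

text \<open>The largest radius in the closure of \<open>R\<close> is the sector function, whereas \<open>\<rho>\<close> describes
  \<open>R\<close> itself on the finitely many exceptional rays.\<close>

definition wedge :: "nat \<Rightarrow> complex set" where
  "wedge k = (\<lambda>(\<theta>, u). pol p (u * f k \<theta>) \<theta>) ` ({\<Theta> k..\<Theta> (Suc k)} \<times> {0..1})"

text \<open>The points on and beyond the curve, cut off to be compact. The cut is harmless: frontier
  points have distance at most \<open>r\<close>, and since \<open>f k\<close> is positive the radii
  covered here reach beyond \<open>2 * r\<close>.\<close>

definition outer :: "nat \<Rightarrow> complex set" where
  "outer k = (\<lambda>(\<theta>, u). pol p (f k \<theta> + u) \<theta>) ` ({\<Theta> k..\<Theta> (Suc k)} \<times> {0..2 * r})"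

definition outer_ray :: "nat \<Rightarrow> complex set" where
  "outer_ray k = (\<lambda>s. pol p s (\<Theta> k)) ` {\<rho> k..2 * r}"

lemma cont_fst: "k < M \<Longrightarrow> continuous_on ({\<Theta> k..\<Theta> (Suc k)} \<times> S) (\<lambda>x. f k (fst x))"
  by (rule continuous_on_compose2 [OF cont]) (auto intro!: continuous_intros)

lemma compact_wedge: "k < M \<Longrightarrow> compact (wedge k)"
  unfolding wedge_def pol_def case_prod_beta
  by (intro compact_continuous_image continuous_intros cont_fst compact_Times) auto

lemma compact_outer: "k < M \<Longrightarrow> compact (outer k)"
  unfolding outer_def pol_def case_prod_beta
  by (intro compact_continuous_image continuous_intros cont_fst compact_Times) auto

lemma compact_outer_ray: "compact (outer_ray k)"
  unfolding outer_ray_def pol_def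
  by (intro compact_continuous_image continuous_intros) auto

lemma wedgeI:
  assumes "k < M" "\<Theta> k \<le> \<theta>" "\<theta> \<le> \<Theta> (Suc k)" "0 \<le> s" "s \<le> f k \<theta>"
  shows "pol p s \<theta> \<in> wedge k"
proof -
  have "0 < f k \<theta>" using f_pos assms by simp
  then show ?thesis using assms
    unfolding wedge_def by (intro image_eqI [of _ _ "(\<theta>, s / f k \<theta>)"]) auto
qed

lemma wedgeE:
  assumes "x \<in> wedge k" "k < M"
  obtains s \<theta> where "\<Theta> k \<le> \<theta>" "\<theta> \<le> \<Theta> (Suc k)" "0 \<le> s" "s \<le> f k \<theta>" "x = pol p s \<theta>"
proof -
  obtain \<theta> u where *: "\<Theta> k \<le> \<theta>" "\<theta> \<le> \<Theta> (Suc k)" "0 \<le> u" "u \<le> 1" "x = pol p (u * f k \<theta>) \<theta>"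
    using assms(1) by (auto simp: wedge_def)
  have "0 < f k \<theta>" using f_pos * assms by simp
  then show thesis using * by (intro that [of \<theta> "u * f k \<theta>"]) (auto simp: mult_left_le_one_le)
qed

lemma Th_Suc: "k < M \<Longrightarrow> \<Theta> k < \<Theta> (Suc k)"
  using Th_mono by simp

lemma R_subset: "R \<subseteq> (\<Union>k<M. wedge k)"
proof
  fix x assume x: "x \<in> R"
  show "x \<in> (\<Union>k<M. wedge k)"
  proof (cases x rule: polar_cases)
    case (1 k s)
    then have "s \<le> f k (\<Theta> k)" using x R_at \<rho>_le order_trans by blast
    then have "x \<in> wedge k" using 1 Th_Suc [of k] wedgeI [of k "\<Theta> k" s] by simp
    then show ?thesis using 1 by blast
  next
    case (2 k s \<theta>)
    then have "s \<le> f k \<theta>" using x R_in by blast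
    then have "x \<in> wedge k" using 2 wedgeI [of k \<theta> s] by simp
    then show ?thesis using 2 by blast
  qed
qed

text \<open>On the bounding rays membership in \<open>R\<close> is governed by \<open>\<rho>\<close>
  and may fail. For a fixed ratio \<open>u\<close> the curve with radius \<open>u * f k\<close> is
  continuous over the closed sector and lies in \<open>R\<close> over the open one, so its end
  points lie in the closure.\<close>

lemma wedge_subset_closure:
  assumes "k < M"
  shows "wedge k \<subseteq> closure R"
proof
  fix x assume "x \<in> wedge k"
  then obtain \<theta> u where *: "\<theta> \<in> {\<Theta> k..\<Theta> (Suc k)}" "0 \<le> u" "u \<le> 1" "x = pol p (u * f k \<theta>) \<theta>"
    by (auto simp: wedge_def)
  let ?h = "\<lambda>\<theta>. pol p (u * f k \<theta>) \<theta>"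
  have "continuous_on {\<Theta> k..\<Theta> (Suc k)} ?h"
    unfolding pol_def using cont [OF assms] by (intro continuous_intros)
  moreover have "{\<Theta> k..\<Theta> (Suc k)} = closure {\<Theta> k<..<\<Theta> (Suc k)}"
    using Th_Suc [OF assms] by simp
  ultimately have "?h ` closure {\<Theta> k<..<\<Theta> (Suc k)} \<subseteq> closure R"
  proof (intro image_closure_subset)
    show "?h ` {\<Theta> k<..<\<Theta> (Suc k)} \<subseteq> closure R"
    proof safe
      fix \<phi> assume \<phi>: "\<phi> \<in> {\<Theta> k<..<\<Theta> (Suc k)}"
      then have "0 < f k \<phi>" using f_pos assms by simp
      then have "?h \<phi> \<in> R" using R_in [OF assms, of \<phi> "u * f k \<phi>"] \<phi> *
          by (simp add: mult_left_le_one_le)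
      then show "?h \<phi> \<in> closure R" using closure_subset by blast
    qed
  qed auto
  then show "x \<in> closure R" using * \<open>_ = closure {\<Theta> k<..<\<Theta> (Suc k)}\<close> by auto
qed

lemma closure_R: "closure R = (\<Union>k<M. wedge k)"
proof
  have "closed (\<Union>k<M. wedge k)" using compact_wedge compact_imp_closed by (intro closed_UN) auto
  then show "closure R \<subseteq> (\<Union>k<M. wedge k)" using R_subset closure_minimal by blast
  show "(\<Union>k<M. wedge k) \<subseteq> closure R" using wedge_subset_closure by auto
qed

lemma fm_pos: "k < M \<Longrightarrow> 0 < fm k"
  using fm_Suc fm_0 f_pos [of "k - 1" "\<Theta> k"] f_pos [of "M - 1" "2 * pi"] Th_Suc [of "k - 1"]
    Th_le_2pi [of "M - 1"] M2 ThM
  by (cases k) auto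

lemma fm_le: "k < M \<Longrightarrow> fm k \<le> r"
  using fm_Suc fm_0 f_le [of "k - 1" "\<Theta> k"] f_le [of "M - 1" "2 * pi"] Th_Suc [of "k - 1"]
    Th_le_2pi [of "M - 1"] M2 ThM
  by (cases k) auto

lemma r_pos: "0 < r"
  using fm_pos [of 0] fm_le [of 0] M2 by simp

lemma complement_subset:
  assumes "x \<in> cball p (2 * r)" "x \<notin> R"
  shows "x \<in> (\<Union>k<M. outer k \<union> outer_ray k)"
proof (cases x rule: polar_cases)
  case (1 k s)
  then have "\<rho> k < s" "s \<le> 2 * r" using assms R_at by (auto simp: dist_pol)
  then have "x \<in> outer_ray k" using 1 by (auto simp: outer_ray_def)
  then show ?thesis using 1 by auto
next
  case (2 k s \<theta>)
  then have "f k \<theta> < s" "s \<le> 2 * r" using assms R_in by (auto simp: dist_pol)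
  moreover have "0 < f k \<theta>" using 2 f_pos by simp
  ultimately have "x \<in> outer k" using 2
    unfolding outer_def by (intro image_eqI [of _ _ "(\<theta>, s - f k \<theta>)"]) auto
  then show ?thesis using 2 by auto
qed

text \<open>At its upper end a sector touches the next ray, or ray 0 after the full turn. There the
  angles are \<open>2 * pi\<close> and 0, so that only the directions \<open>cis\<close> can be
  equated.\<close>

lemma sector_endpoint_cases:
  assumes "k < M" "\<Theta> k \<le> \<theta>" "\<theta> \<le> \<Theta> (Suc k)"
  obtains "\<Theta> k < \<theta>" "\<theta> < \<Theta> (Suc k)" | "\<theta> = \<Theta> k"
  | j where "j < M" "cis \<theta> = cis (\<Theta> j)" "fm j = f k \<theta>" "\<theta> = \<Theta> (Suc k)"
proof (cases "\<theta> = \<Theta> (Suc k)")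
  case True
  show thesis
  proof (cases "Suc k < M")
    case True
    then show thesis using \<open>\<theta> = _\<close> fm_Suc that(3) [of "Suc k"] by simp
  next
    case False
    then have "Suc k = M" using assms by simp
    then show thesis using \<open>\<theta> = _\<close> fm_0 ThM Th0 that(3) [of 0] by auto
  qed
qed (use assms that in force)

text \<open>A closure point on none of the curves avoids the compact sets \<open>outer\<close> and
  \<open>outer_ray\<close>. Removing them from the ball of radius \<open>2 * r\<close> leaves an
  open subset of \<open>R\<close> around the point, which is therefore interior.\<close>

lemma frontier_subset:
  assumes "x \<in> frontier R"
  shows "\<exists>k<M. x \<in> graph k \<union> radial k (fm k) \<union> radial k (f k (\<Theta> k))"
proof (rule ccontr)
  assume contra: "\<not> ?thesis"
  then have ng: "x \<notin> graph k" "x \<notin> radial k (fm k)" "x \<notin> radial k (f k (\<Theta> k))" if "k < M" for k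
    using that by auto
  have "x \<in> closure R" using assms by (simp add: frontier_def)
  then obtain k where "k < M" "x \<in> wedge k" by (auto simp: closure_R)
  then obtain s \<theta> where s: "k < M" "\<Theta> k \<le> \<theta>" "\<theta> \<le> \<Theta> (Suc k)" "0 \<le> s" "s \<le> f k \<theta>" "x = pol p s \<theta>"
    by (metis wedgeE)
  have sr: "s \<le> r" using f_le s order_trans by blast
  \<comment> \<open>The centre has every angle as a polar angle: if some \<open>\<rho> j\<close>
    were 0, it would lie on the radial edge of ray \<open>j\<close>.\<close>
  have np: "0 < \<rho> j" if "x = p" "j < M" for j
  proof (rule ccontr)
    assume "\<not> 0 < \<rho> j"
    then have "x = pol p (\<rho> j) (\<Theta> j)" "\<rho> j = 0" using \<rho>_nonneg [of j] that by auto
    then have "x \<in> radial j (fm j)" unfolding radial_def using fm_pos [of j] that by force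
    then show False using ng that by blast
  qed
  have notin_outer_ray: "x \<notin> outer_ray j" if j: "j < M" for j
  proof
    assume "x \<in> outer_ray j"
    then obtain s' where s': "\<rho> j \<le> s'" "x = pol p s' (\<Theta> j)" by (auto simp: outer_ray_def)
    have s'0: "0 \<le> s'" using s' \<rho>_nonneg j by (meson order_trans)
    show False
    proof (cases "s = 0")
      case True
      then have "x = p" using s by simp
      then have "s' = 0" using s' s'0 dist_pol [of p s' "\<Theta> j"] by simp
      then show False using np \<open>x = p\<close> s' j by force
    next
      case False
      then have eq: "s' = s" "cis \<theta> = cis (\<Theta> j)"
        using pol_eqD [of p s \<theta> s' "\<Theta> j"] s s' s'0 by auto
      have "0 \<le> \<theta>" "\<theta> \<le> 2 * pi" using s Th_ge_0 [of k] Th_le_2pi [of "Suc k"] by auto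
      from s(1-3) show False
      proof (cases rule: sector_endpoint_cases)
        case 1
        have "\<theta> = \<Theta> j"
          using cis_eq_cases [OF eq(2)] \<open>0 \<le> \<theta>\<close> \<open>\<theta> \<le> 2 * pi\<close> Th_ge_0 [of j] Th_le_2pi [of j] j 1 s
            Th_ge_0 [of k] Th_le_2pi [of "Suc k"] by fastforce
        then show False using 1 s j Th_mono_le [of "Suc k" j] Th_mono_le [of j k]
            by (cases "j \<le> k") auto
      next
        case 2
        have "\<Theta> k = \<Theta> j"
          using cis_eq_cases [OF eq(2)] Th_ge_0 [of j] Th_less_2pi [of j] j 2 s
            Th_ge_0 [of k] Th_less_2pi [of "k"] by fastforce
        then have "x \<in> radial k (f k (\<Theta> k))" unfolding radial_def
          using s 2 s' eq j by (metis Th_inj atLeastAtMost_iff image_eqI less_imp_le)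
        then show False using ng s by blast
      next
        case (3 i)
        have "cis (\<Theta> i) = cis (\<Theta> j)" using 3 eq by simp
        then have "\<Theta> i = \<Theta> j"
          using cis_eq_cases [of "\<Theta> i" "\<Theta> j"] Th_ge_0 [of j] Th_less_2pi [of j] j 3
            Th_ge_0 [of i] Th_less_2pi [of i] by fastforce
        then have "i = j" using 3 j Th_inj by simp
        then have "x \<in> radial j (fm j)" unfolding radial_def
          using s 3 s' eq j by (intro image_eqI [of _ _ s]) auto
        then show False using ng j by blast
      qed
    qed
  qed
  have notin_outer: "x \<notin> outer j" if j: "j < M" for j
  proof
    assume "x \<in> outer j"
    then obtain \<phi> u where \<phi>: "\<Theta> j \<le> \<phi>" "\<phi> \<le> \<Theta> (Suc j)" "0 \<le> u" "x = pol p (f j \<phi> + u) \<phi>"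
      by (auto simp: outer_def)
    have fpos: "0 < f j \<phi> + u" using f_pos \<phi> j by (simp add: add_pos_nonneg)
    have eq: "s = f j \<phi> + u" "cis \<phi> = cis \<theta>"
      using pol_eqD [of p "f j \<phi> + u" \<phi> s \<theta>] s \<phi> fpos by auto
    have b: "0 \<le> \<theta>" "\<theta> \<le> 2 * pi" "0 \<le> \<phi>" "\<phi> \<le> 2 * pi"
      using s Th_ge_0 [of k] Th_le_2pi [of "Suc k"] \<phi> Th_ge_0 [of j] Th_le_2pi [of "Suc j"] j
          by auto
    from j \<phi>(1,2) show False
    proof (cases rule: sector_endpoint_cases)
      case 1
      have "\<theta> = \<phi>" using cis_eq_cases [OF eq(2)] b 1
        Th_ge_0 [of j] Th_le_2pi [of "Suc j"] j by fastforce
      then have "j = k" using 1 s j Th_mono_le [of "Suc k" j] Th_mono_le [of "Suc j" k]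
        by (cases j k rule: linorder_cases) auto
      then have "s = f k \<theta>" using \<open>\<theta> = \<phi>\<close> eq s \<phi> by simp
      then have "x \<in> graph k" using s by (auto simp: graph_def)
      then show False using ng s by blast
    next
      case 2
      have "x = pol p s (\<Theta> j)" using 2 eq \<phi> by simp
      moreover have "\<rho> j \<le> s" using eq \<rho>_le [OF j] 2 \<phi> by simp
      ultimately have "x \<in> outer_ray j" using sr r_pos by (auto simp: outer_ray_def)
      then show False using notin_outer_ray j by blast
    next
      case (3 i)
      have "x = pol p s (\<Theta> i)" using 3 eq \<phi> by (simp add: pol_def)
      moreover have "\<rho> i \<le> s" using eq \<rho>_le' [of i] 3 \<phi> by simp
      ultimately have "x \<in> outer_ray i" using sr r_pos by (auto simp: outer_ray_def)
      then show False using notin_outer_ray 3 by blast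
    qed
  qed
  define U where "U = ball p (2 * r) - (\<Union>k<M. outer k \<union> outer_ray k)"
  have "open U" unfolding U_def
    using compact_outer compact_outer_ray compact_imp_closed
    by (intro open_Diff closed_UN closed_Un) auto
  moreover have "x \<in> U" unfolding U_def
    using notin_outer notin_outer_ray s sr r_pos by (auto simp: dist_pol)
  moreover have "U \<subseteq> R" unfolding U_def using complement_subset by force
  ultimately have "x \<in> interior R" by (meson interiorI)
  then show False using assms by (simp add: frontier_def)
qed

lemma not_interior:
  assumes "x = pol p s \<theta>" "\<And>t. s < t \<Longrightarrow> pol p t \<theta> \<notin> R"
  shows "x \<notin> interior R"
proof
  assume "x \<in> interior R"
  then obtain e where e: "0 < e" "cball x e \<subseteq> R" by (auto simp: mem_interior_cball)
  have "dist x (pol p (s + e) \<theta>) = e"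
    using e assms(1) by (simp add: pol_def dist_norm norm_mult algebra_simps)
  then have "pol p (s + e) \<theta> \<in> cball x e" by simp
  then show False using e assms(2) [of "s + e"] by auto
qed

lemma Th_in_closure:
  assumes "k < M" "0 \<le> s" "s \<le> max (fm k) (f k (\<Theta> k))"
  shows "pol p s (\<Theta> k) \<in> closure R"
proof (cases "s \<le> f k (\<Theta> k)")
  case True
  then show ?thesis using wedgeI [of k "\<Theta> k" s] Th_Suc [of k] assms wedge_subset_closure by auto
next
  case False
  then have s: "s \<le> fm k" using assms by simp
  show ?thesis
  proof (cases k)
    case 0
    then have "pol p s (2 * pi) \<in> wedge (M - 1)"
      using s fm_0 assms M2 ThM Th_le_2pi [of "M - 1"] by (intro wedgeI) auto
    then show ?thesis using 0 Th0 M2 wedge_subset_closure [of "M - 1"] by auto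
  next
    case (Suc j)
    then have "pol p s (\<Theta> k) \<in> wedge j"
      using s fm_Suc assms Th_Suc [of j] by (intro wedgeI) auto
    then show ?thesis using Suc assms wedge_subset_closure [of j] by auto
  qed
qed

lemma radial_frontier:
  assumes "k < M" "b = fm k \<or> b = f k (\<Theta> k)"
  shows "radial k b \<subseteq> frontier R"
proof
  fix x assume "x \<in> radial k b"
  then obtain s where s: "\<rho> k \<le> s" "s \<le> b" "x = pol p s (\<Theta> k)" by (auto simp: radial_def)
  have "x \<notin> interior R"
    using s R_at [OF assms(1)] \<rho>_nonneg [OF assms(1)] by (intro not_interior [of x s]) auto
  moreover have "x \<in> closure R"
    using s \<rho>_nonneg [OF assms(1)] assms Th_in_closure [of k s] by auto
  ultimately show "x \<in> frontier R" by (simp add: frontier_def)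
qed

lemma graph_frontier:
  assumes k: "k < M"
  shows "graph k \<subseteq> frontier R"
proof
  fix x assume "x \<in> graph k"
  then obtain \<theta> where \<theta>: "\<Theta> k \<le> \<theta>" "\<theta> \<le> \<Theta> (Suc k)" "x = pol p (f k \<theta>) \<theta>" by (auto simp: graph_def)
  have pos: "0 < f k \<theta>" using f_pos k \<theta> by simp
  have "x \<in> closure R" using wedgeI [of k \<theta> "f k \<theta>"] k \<theta> pos wedge_subset_closure by auto
  moreover have "x \<notin> interior R"
  proof (rule not_interior [OF \<theta>(3)])
    fix t assume t: "f k \<theta> < t"
    from k \<theta>(1,2) show "pol p t \<theta> \<notin> R"
    proof (cases rule: sector_endpoint_cases)
      case 1
      then show ?thesis using R_in [of k \<theta> t] k t pos by simp
    next
      case 2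
      then show ?thesis using R_at [of k t] k t pos \<rho>_le [OF k] by simp
    next
      case (3 j)
      then have "pol p t \<theta> = pol p t (\<Theta> j)" by (simp add: pol_def)
      then show ?thesis using R_at [of j t] 3 t pos \<rho>_le' [of j] by simp
    qed
  qed
  ultimately show "x \<in> frontier R" by (simp add: frontier_def)
qed

end

section \<open>Circular arcs in polar coordinates\<close>

lemma sphere_pol:
  assumes "x \<in> sphere p r" "0 < r"
  obtains \<phi> where "x = pol p r \<phi>" "\<bar>\<phi> - \<mu>\<bar> \<le> pi"
proof -
  define z where "z = (x - p) * cis (- \<mu>)"
  have "norm z = r" using assms(1) by (simp add: z_def norm_mult dist_norm norm_minus_commute)
  then have "z = of_real r * cis (Arg z)" using assms(2)
    by (metis Arg_eq cis_conv_exp norm_zero less_irrefl)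
  moreover have "x - p = z * cis \<mu>" by (simp add: z_def mult.assoc cis_mult)
  ultimately have "x - p = of_real r * cis (\<mu> + Arg z)"
    by (metis cis_mult mult.assoc mult.commute)
  then have "x = pol p r (\<mu> + Arg z)" by (simp add: pol_def algebra_simps)
  then show thesis using that Arg_bounded [of z] by (force simp: abs_le_iff)
qed

text \<open>With \<open>\<mu>\<close> the middle angle and \<open>\<delta>\<close> half the width,
  the height \<open>h\<close> in direction \<open>cis \<mu>\<close> is
  \<open>r * cos (\<phi> - \<mu>)\<close> on the circle. The open arc is the cap where
  \<open>h\<close> exceeds \<open>r * cos \<delta>\<close>, and on the circle only the two end
  points attain that value, so a connected set avoiding them cannot leave the cap.\<close>

lemma circ_arc_pol:
  assumes "0 < r" "\<alpha> < \<omega>" "\<omega> < \<beta>" "\<beta> - \<alpha> < 2 * pi"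
  shows "circ_arc p r (pol p r \<alpha>) (pol p r \<omega>) (pol p r \<beta>) = pol p r ` {\<alpha>..\<beta>}"
proof -
  define \<mu> where "\<mu> = (\<alpha> + \<beta>) / 2"
  define \<delta> where "\<delta> = (\<beta> - \<alpha>) / 2"
  have ab: "\<alpha> = \<mu> - \<delta>" "\<beta> = \<mu> + \<delta>" by (simp_all add: \<mu>_def \<delta>_def field_simps)
  have \<delta>: "0 < \<delta>" "\<delta> < pi" using assms by (simp_all add: \<delta>_def)
  define A where "A = pol p r ` {\<alpha><..<\<beta>}"
  define S where "S = sphere p r - {pol p r \<alpha>, pol p r \<beta>}"
  define h where "h x = inner (x - p) (cis \<mu>)" for x :: complex
  have h_pol: "h (pol p r \<phi>) = r * cos (\<phi> - \<mu>)" for \<phi>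
    by (simp add: h_def pol_def inner_complex_def cos_diff algebra_simps)
  have cos_less: "r * cos \<delta> < r * cos \<phi> \<longleftrightarrow> \<bar>\<phi>\<bar> < \<delta>" if "\<bar>\<phi>\<bar> \<le> pi" for \<phi>
    using cos_mono_less_eq [of \<delta> "\<bar>\<phi>\<bar>"] that \<delta> assms(1) by (simp add: cos_abs_real)
  have A_eq: "x \<in> A \<longleftrightarrow> r * cos \<delta> < h x" if xs: "x \<in> sphere p r" for x
  proof -
    obtain \<phi> where x: "x = pol p r \<phi>" and b: "\<bar>\<phi> - \<mu>\<bar> \<le> pi"
      using sphere_pol [OF xs assms(1)] by blast
    have "x \<in> A" if "\<bar>\<phi> - \<mu>\<bar> < \<delta>"
      unfolding A_def using x that by (intro image_eqI [of _ _ \<phi>]) (auto simp: ab abs_less_iff)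
    moreover have "r * cos \<delta> < h x" if xA: "x \<in> A"
    proof -
      obtain \<psi> where \<psi>: "x = pol p r \<psi>" "\<alpha> < \<psi>" "\<psi> < \<beta>" using xA by (auto simp: A_def)
      then have "\<bar>\<psi> - \<mu>\<bar> < \<delta>" by (auto simp: ab abs_less_iff)
      then show ?thesis using cos_less [of "\<psi> - \<mu>"] \<psi> \<delta> by (simp add: h_pol)
    qed
    ultimately show ?thesis using cos_less [OF b] x by (auto simp: h_pol)
  qed
  have h_neq: "h x \<noteq> r * cos \<delta>" if xS: "x \<in> S" for x
  proof
    assume eq: "h x = r * cos \<delta>"
    obtain \<phi> where x: "x = pol p r \<phi>" and b: "\<bar>\<phi> - \<mu>\<bar> \<le> pi"
      using sphere_pol [of x p r \<mu>] assms(1) xS by (auto simp: S_def)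
    have "cos \<bar>\<phi> - \<mu>\<bar> = cos \<delta>" using eq x assms(1) by (simp add: h_pol cos_abs_real)
    then have "\<bar>\<phi> - \<mu>\<bar> = \<delta>" using b \<delta> cos_inj_pi [of "\<bar>\<phi> - \<mu>\<bar>" \<delta>] by auto
    then have "\<phi> = \<alpha> \<or> \<phi> = \<beta>" by (auto simp: ab abs_if split: if_splits)
    then have "x = pol p r \<alpha> \<or> x = pol p r \<beta>" using x by blast
    then show False using that by (auto simp: S_def)
  qed
  have AS: "A \<subseteq> S"
  proof
    fix x assume xA: "x \<in> A"
    then have sp: "x \<in> sphere p r" using assms(1) by (auto simp: A_def dist_pol)
    then have "r * cos \<delta> < h x" using A_eq xA by blast
    moreover have "h (pol p r \<alpha>) = r * cos \<delta>" "h (pol p r \<beta>) = r * cos \<delta>"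
      by (simp_all add: h_pol ab)
    ultimately show "x \<in> S" using sp by (auto simp: S_def)
  qed
  have wA: "pol p r \<omega> \<in> A" using assms by (auto simp: A_def)
  have "connected A" unfolding A_def pol_def
    by (intro connected_continuous_image continuous_intros) auto
  then have "A \<subseteq> connected_component_set S (pol p r \<omega>)"
    using AS wA connected_component_maximal by blast
  moreover have "connected_component_set S (pol p r \<omega>) \<subseteq> A"
  proof
    fix x assume "x \<in> connected_component_set S (pol p r \<omega>)"
    then obtain T where T: "connected T" "T \<subseteq> S" "pol p r \<omega> \<in> T" "x \<in> T"
      by (auto simp: connected_component_def)
    have "continuous_on T h" unfolding h_def by (intro continuous_intros)
    then have conn: "connected (h ` T)" using T connected_continuous_image by blast
    have w: "r * cos \<delta> < h (pol p r \<omega>)" using A_eq wA T(2,3) by (auto simp: S_def)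
    have "r * cos \<delta> < h x"
    proof (rule ccontr)
      assume "\<not> r * cos \<delta> < h x"
      then have "r * cos \<delta> \<in> h ` T"
        using connectedD_interval [OF conn, of "h x" "h (pol p r \<omega>)" "r * cos \<delta>"] T w by auto
      then show False using h_neq T(2) by (metis imageE subsetD)
    qed
    then show "x \<in> A" using A_eq T by (auto simp: S_def)
  qed
  ultimately have "connected_component_set S (pol p r \<omega>) = A" by blast
  moreover have "{\<alpha>..\<beta>} = insert \<alpha> (insert \<beta> {\<alpha><..<\<beta>})" using assms by auto
  ultimately show ?thesis by (simp add: circ_arc_def S_def A_def)
qed

section \<open>Closed chains of edges\<close>

fun chain :: "('l \<Rightarrow> 'p) \<Rightarrow> ('l \<Rightarrow> 'p) \<Rightarrow> 'p \<Rightarrow> 'l list \<Rightarrow> 'p \<Rightarrow> bool" where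
  "chain sr tg u [] v \<longleftrightarrow> u = v"
| "chain sr tg u (l # ls) v \<longleftrightarrow> sr l = u \<and> chain sr tg (tg l) ls v"

lemma chain_append: "chain sr tg u xs v \<Longrightarrow> chain sr tg v ys w \<Longrightarrow> chain sr tg u (xs @ ys) w"
  by (induction xs arbitrary: u) auto

lemma chain_nth_Suc:
  "chain sr tg u ls v \<Longrightarrow> Suc i < length ls \<Longrightarrow> sr (ls ! Suc i) = tg (ls ! i)"
proof (induction ls arbitrary: u i)
  case (Cons l ls)
  then show ?case by (cases i; cases ls) auto
qed simp

lemma chain_last: "chain sr tg u ls v \<Longrightarrow> ls \<noteq> [] \<Longrightarrow> tg (last ls) = v"
  by (induction ls arbitrary: u) (auto split: if_splits)

text \<open>A boundary stores only the start of each edge and takes the start of the cyclic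
  successor as target. A closed chain allows the end of each edge to be computed locally instead, as
  \<open>to_pt\<close> does.\<close>

lemma chain_closed:
  assumes "chain sr tg u ls u" "i < length ls"
  shows "sr (ls ! (Suc i mod length ls)) = tg (ls ! i)"
proof (cases "Suc i < length ls")
  case True
  then show ?thesis using chain_nth_Suc [OF assms(1)] by simp
next
  case False
  then have "Suc i = length ls" using assms(2) by simp
  then have "ls \<noteq> []" "i = length ls - 1" by auto
  then have "tg (ls ! i) = u" using chain_last [OF assms(1)] by (simp add: last_conv_nth)
  moreover have "sr (ls ! 0) = u" using assms by (cases ls) auto
  ultimately show ?thesis using \<open>Suc i = length ls\<close> by simp
qed

lemma ccw_aroundI:
  assumes "\<And>z \<phi>. (z, \<phi>) \<in> set ps \<Longrightarrow> z = p + of_real (dist p z) * cis \<phi> \<and> 0 \<le> \<phi> \<and> \<phi> \<le> 2 * pi"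
    and "sorted (map snd ps)"
  shows "ccw_around p (map fst ps)"
proof -
  define \<theta> where "\<theta> i = snd (ps ! i)" for i
  have el: "fst (ps ! i) = p + of_real (dist p (fst (ps ! i))) * cis (\<theta> i) \<and> 0 \<le> \<theta> i \<and> \<theta> i \<le> 2 * pi"
    if "i < length ps" for i
    using assms(1) [of "fst (ps ! i)" "\<theta> i"] that by (simp add: \<theta>_def)
  have "\<theta> i \<le> \<theta> j" if "i \<le> j" "j < length ps" for i j
    using sorted_nth_mono [OF assms(2), of i j] that by (simp add: \<theta>_def)
  moreover have "\<theta> j \<le> \<theta> i + 2 * pi" if "i < length ps" "j < length ps" for i j
    using el [OF that(1)] el [OF that(2)] by linarith
  ultimately show ?thesis unfolding ccw_around_def using el
    by (intro exI [of _ \<theta>]) simp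
qed

section \<open>The boundary list of a fan\<close>

locale fan_boundary = fan +
  fixes arc :: "nat \<Rightarrow> bool" and \<omega> :: "nat \<Rightarrow> real"
  assumes arc: "\<And>k \<theta>. k < M \<Longrightarrow> arc k \<Longrightarrow> f k \<theta> = r"
    and \<omega>: "\<And>k. k < M \<Longrightarrow> \<Theta> k < \<omega> k \<and> \<omega> k < \<Theta> (Suc k)"
    and straight: "\<And>k. k < M \<Longrightarrow> \<not> arc k \<Longrightarrow>
      graph k = closed_segment (pol p (f k (\<Theta> k)) (\<Theta> k)) (pol p (f k (\<Theta> (Suc k))) (\<Theta> (Suc k)))"
begin

text \<open>The edges at the ray of angle \<open>\<Theta> k\<close>: number 0 runs inwards along the ray, number 1
  outwards, and number 2 is the visible curve of the sector that follows. Edges 0 and 1 are omitted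
  when they degenerate to a point.\<close>

definition labels :: "nat \<Rightarrow> (nat \<times> nat) list" where
  "labels k = (if \<rho> k < fm k then [(k, 0)] else []) @
     (if \<rho> k < f k (\<Theta> k) then [(k, 1)] else []) @ [(k, 2)]"

definition from_pt :: "nat \<times> nat \<Rightarrow> complex" where
  "from_pt l = (let k = fst l in
     pol p (if snd l = 0 then fm k else if snd l = 1 then \<rho> k else f k (\<Theta> k)) (\<Theta> k))"

definition to_pt :: "nat \<times> nat \<Rightarrow> complex" where
  "to_pt l = (let k = fst l; k' = Suc k mod M in
     if snd l = 0 then pol p (\<rho> k) (\<Theta> k) else if snd l = 1 then pol p (f k (\<Theta> k)) (\<Theta> k)
     else pol p (fm k') (\<Theta> k'))"

definition appendix :: "nat \<times> nat \<Rightarrow> complex option" where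
  "appendix l = (if snd l = 2 \<and> arc (fst l) then Some (pol p r (\<omega> (fst l))) else None)"

definition fan_edges :: boundary where
  "fan_edges = map (\<lambda>l. (from_pt l, appendix l)) (concat (map labels [0..<M]))"

definition all_labels :: "(nat \<times> nat) list" where
  "all_labels = concat (map labels [0..<M])"

lemma to_pt_2:
  assumes "k < M"
  shows "to_pt (k, 2) = pol p (f k (\<Theta> (Suc k))) (\<Theta> (Suc k))"
proof (cases "Suc k = M")
  case True
  then have "M - 1 = k" "\<Theta> (Suc k) = 2 * pi" using ThM by auto
  then show ?thesis using True by (simp add: to_pt_def fm_0 Th0)
next
  case False
  then show ?thesis using assms by (simp add: to_pt_def fm_Suc)
qed

lemma chain_labels:
  "k < M \<Longrightarrow> chain from_pt to_pt (pol p (fm k) (\<Theta> k)) (labels k) (to_pt (k, 2))"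
  using \<rho>_le [of k] \<rho>_le' [of k] by (auto simp: labels_def from_pt_def to_pt_def)

lemma chain_prefix:
  "m \<le> M \<Longrightarrow> chain from_pt to_pt (pol p (fm 0) (\<Theta> 0)) (concat (map labels [0..<m]))
     (pol p (fm (m mod M)) (\<Theta> (m mod M)))"
proof (induction m)
  case (Suc m)
  then have "chain from_pt to_pt (pol p (fm 0) (\<Theta> 0)) (concat (map labels [0..<m]))
     (pol p (fm m) (\<Theta> m))" by simp
  moreover have "to_pt (m, 2) = pol p (fm (Suc m mod M)) (\<Theta> (Suc m mod M))"
    by (simp add: to_pt_def Let_def)
  ultimately show ?case using chain_labels [of m] Suc.prems by (auto intro: chain_append)
qed simp

lemma chain_all_labels:
  "chain from_pt to_pt (pol p (fm 0) (\<Theta> 0)) all_labels (pol p (fm 0) (\<Theta> 0))"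
  using chain_prefix [of M] by (simp add: all_labels_def)

lemma length_fan_edges: "length fan_edges = length all_labels"
  by (simp add: fan_edges_def all_labels_def)

lemma start_fan_edges: "i < length all_labels \<Longrightarrow> start fan_edges i = from_pt (all_labels ! i)"
  by (simp add: start_def fan_edges_def all_labels_def)

lemma snd_fan_edges: "i < length all_labels \<Longrightarrow> snd (fan_edges ! i) = appendix (all_labels ! i)"
  by (simp add: fan_edges_def all_labels_def)

lemma target_fan_edges:
  assumes "i < length all_labels"
  shows "target fan_edges i = to_pt (all_labels ! i)"
proof -
  have "Suc i mod length all_labels < length all_labels" using assms
      by (intro mod_less_divisor) auto
  then have "target fan_edges i = from_pt (all_labels ! (Suc i mod length all_labels))"
    using length_fan_edges by (simp add: target_def fan_edges_def all_labels_def)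
  then show ?thesis using chain_closed [OF chain_all_labels assms] by simp
qed

definition edge_set :: "nat \<times> nat \<Rightarrow> complex set" where
  "edge_set l = (case appendix l of None \<Rightarrow> closed_segment (from_pt l) (to_pt l)
     | Some w \<Rightarrow> circ_arc p r (from_pt l) w (to_pt l))"

lemma edge_fan_edges: "i < length all_labels \<Longrightarrow> edge p r fan_edges i = edge_set (all_labels ! i)"
  by (simp add: edge_def edge_set_def start_fan_edges target_fan_edges snd_fan_edges cong:
      option.case_cong)

lemma mem_all_labels:
  "l \<in> set all_labels \<longleftrightarrow> fst l < M \<and>
     (snd l = 0 \<and> \<rho> (fst l) < fm (fst l) \<or> snd l = 1 \<and> \<rho> (fst l) < f (fst l) (\<Theta> (fst l)) \<or>
         snd l = 2)"
  by (cases l) (auto simp: all_labels_def labels_def)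

lemma distinct_all_labels: "distinct all_labels"
  unfolding all_labels_def
proof (rule distinct_concat)
  show "distinct (map labels [0..<M])"
    by (auto simp: distinct_map labels_def inj_on_def split: if_splits)
  show "distinct ys" if "ys \<in> set (map labels [0..<M])" for ys
    using that by (auto simp: labels_def split: if_splits)
  show "set ys \<inter> set zs = {}"
    if "ys \<in> set (map labels [0..<M])" "zs \<in> set (map labels [0..<M])" "ys \<noteq> zs" for ys zs
    using that by (auto simp: labels_def split: if_splits)
qed

lemma closed_segment_pol:
  assumes "a \<le> b"
  shows "closed_segment (pol p a \<theta>) (pol p b \<theta>) = (\<lambda>s. pol p s \<theta>) ` {a..b}"
proof -
  have "(1 - u) *\<^sub>R pol p a \<theta> + u *\<^sub>R pol p b \<theta> = pol p ((1 - u) *\<^sub>R a + u *\<^sub>R b) \<theta>" for u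
    by (simp add: pol_def scaleR_conv_of_real algebra_simps)
  then have "closed_segment (pol p a \<theta>) (pol p b \<theta>) = (\<lambda>s. pol p s \<theta>) ` closed_segment a b"
    by (simp only: closed_segment_image_interval image_image)
  then show ?thesis using assms by (simp add: closed_segment_eq_real_ivl)
qed

lemma edge_set_0: "\<rho> k < fm k \<Longrightarrow> edge_set (k, 0) = radial k (fm k)"
  using closed_segment_pol [of "\<rho> k" "fm k" "\<Theta> k"]
  by (simp add: edge_set_def appendix_def radial_def from_pt_def to_pt_def closed_segment_commute)

lemma edge_set_1: "\<rho> k < f k (\<Theta> k) \<Longrightarrow> edge_set (k, 1) = radial k (f k (\<Theta> k))"
  using closed_segment_pol [of "\<rho> k" "f k (\<Theta> k)" "\<Theta> k"]
  by (simp add: edge_set_def appendix_def radial_def from_pt_def to_pt_def)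

text \<open>Here the second ray pays off: no sector is a full turn, so the end points of its curve
  are distinct and \<open>circ_arc_pol\<close> applies.\<close>

lemma gap_less_2pi: "k < M \<Longrightarrow> \<Theta> (Suc k) - \<Theta> k < 2 * pi"
  using M2 Th_ge_0 [of k] Th_le_2pi [of "Suc k"] Th_mono [of "Suc k" M] Th_mono [of 0 k] Th0 ThM
  by (cases "k = 0") auto

lemma edge_set_2:
  assumes "k < M"
  shows "edge_set (k, 2) = graph k"
proof (cases "arc k")
  case True
  then have "edge_set (k, 2) = circ_arc p r (pol p r (\<Theta> k)) (pol p r (\<omega> k)) (pol p r (\<Theta> (Suc k)))"
    using assms to_pt_2 [OF assms] arc by (simp add: edge_set_def appendix_def from_pt_def)
  also have "\<dots> = graph k" using circ_arc_pol [of r "\<Theta> k" "\<omega> k" "\<Theta> (Suc k)" p]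
    r_pos \<omega> [OF assms] gap_less_2pi [OF assms] arc [OF assms True] by (simp add: graph_def)
  finally show ?thesis .
next
  case False
  then show ?thesis using straight [OF assms False] to_pt_2 [OF assms]
    by (simp add: edge_set_def appendix_def from_pt_def)
qed

lemma radial_subset_graph: "k < M \<Longrightarrow> \<not> \<rho> k < f k (\<Theta> k) \<Longrightarrow> radial k (f k (\<Theta> k)) \<subseteq> graph k"
  using \<rho>_le [of k] Th_Suc [of k] by (auto simp: radial_def graph_def)

lemma pol_fm_graph: "k < M \<Longrightarrow> pol p (fm k) (\<Theta> k) \<in> (\<Union>j<M. graph j)"
proof (cases k)
  case 0
  have "pol p (fm 0) (2 * pi) \<in> graph (M - 1)"
    using fm_0 ThM M2 Th_Suc [of "M - 1"]
    by (auto simp: graph_def intro!: image_eqI [of _ _ "2 * pi"])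
  then show ?thesis using 0 Th0 M2 by auto
next
  case (Suc j)
  assume "k < M"
  then have "pol p (fm k) (\<Theta> k) \<in> graph j"
    using Suc fm_Suc Th_Suc [of j] by (auto simp: graph_def)
  then show ?thesis using Suc \<open>k < M\<close> by (auto intro!: bexI [of _ j])
qed

lemma frontier_edges: "frontier R = (\<Union>i<length fan_edges. edge p r fan_edges i)"
proof -
  have "(\<Union>i<length fan_edges. edge p r fan_edges i) = (\<Union>l\<in>set all_labels. edge_set l)"
    by (auto simp: length_fan_edges edge_fan_edges set_conv_nth)
  also have "\<dots> = frontier R"
  proof
    show "(\<Union>l\<in>set all_labels. edge_set l) \<subseteq> frontier R"
    proof (rule UN_least)
      fix l assume "l \<in> set all_labels"
      moreover obtain k t where "l = (k, t)" by (cases l)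
      ultimately show "edge_set l \<subseteq> frontier R"
        using radial_frontier [of k "fm k"] radial_frontier [of k "f k (\<Theta> k)"] graph_frontier [of k]
        by (auto simp: mem_all_labels edge_set_0 edge_set_1 [simplified] edge_set_2)
    qed
    show "frontier R \<subseteq> (\<Union>l\<in>set all_labels. edge_set l)"
    proof
      have gr: "graph k \<subseteq> (\<Union>l\<in>set all_labels. edge_set l)" if "k < M" for k
        using that edge_set_2 [of k] mem_all_labels [of "(k, 2)"] by auto
      fix x assume "x \<in> frontier R"
      then obtain k where k: "k < M" and
        "x \<in> graph k \<or> x \<in> radial k (fm k) \<or> x \<in> radial k (f k (\<Theta> k))"
        using frontier_subset by blast
      then consider "x \<in> graph k" | "x \<in> radial k (fm k)" | "x \<in> radial k (f k (\<Theta> k))" by blast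
      then show "x \<in> (\<Union>l\<in>set all_labels. edge_set l)"
      proof cases
        case 1
        then show ?thesis using gr k by blast
      next
        case 2
        show ?thesis
        proof (cases "\<rho> k < fm k")
          case True
          then have "x \<in> edge_set (k, 0)" "(k, 0) \<in> set all_labels"
            using 2 k by (simp_all add: edge_set_0 mem_all_labels)
          then show ?thesis by blast
        next
          \<comment> \<open>The omitted inward edge has shrunk to the point at radius
            \<open>fm k\<close>, where the curve of the preceding sector ends.\<close>
          case False
          moreover obtain s where s: "\<rho> k \<le> s" "s \<le> fm k" "x = pol p s (\<Theta> k)"
            using 2 by (auto simp: radial_def)
          ultimately have "s = fm k" by simp
          then have "x = pol p (fm k) (\<Theta> k)" using s by simp
          then show ?thesis using pol_fm_graph k gr by blast
        qed
      next
        case 3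
        show ?thesis
        proof (cases "\<rho> k < f k (\<Theta> k)")
          case True
          then have "x \<in> edge_set (k, 1)" "(k, 1) \<in> set all_labels"
            using 3 k edge_set_1 by (simp_all add: mem_all_labels)
          then show ?thesis by blast
        next
          case False
          then show ?thesis using 3 radial_subset_graph [of k] gr k by blast
        qed
      qed
    qed
  qed
  finally show ?thesis by simp
qed

lemma proper_fan_edges:
  assumes "i < length fan_edges"
  shows "proper_edge p r fan_edges i"
proof -
  have i: "i < length all_labels" using assms length_fan_edges by simp
  define l where "l = all_labels ! i"
  obtain k t where l: "l = (k, t)" by (cases l)
  have lm: "l \<in> set all_labels" using i by (simp add: l_def)
  then have k: "k < M" by (simp add: mem_all_labels l)
  have neq: "pol p a \<alpha> \<noteq> pol p b \<beta>"
    if "0 < a" "0 < b" "\<alpha> < \<beta>" "\<beta> - \<alpha> < 2 * pi" "0 \<le> \<alpha>" "\<beta> \<le> 2 * pi" for a b \<alpha> \<beta>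
    using pol_eqD [of p a \<alpha> b \<beta>] cis_eq_cases [of \<alpha> \<beta>] that by force
  have neq': "pol p a \<alpha> \<noteq> pol p b \<alpha>" if "0 \<le> a" "0 \<le> b" "a \<noteq> b" for a b \<alpha>
    using dist_pol [of p a \<alpha>] dist_pol [of p b \<alpha>] that by auto
  have w: "pol p r (\<omega> k) \<noteq> pol p r (\<Theta> k)" "pol p r (\<omega> k) \<noteq> pol p r (\<Theta> (Suc k))"
    using neq [of r r "\<Theta> k" "\<omega> k"] neq [of r r "\<omega> k" "\<Theta> (Suc k)"] r_pos \<omega> [OF k] gap_less_2pi [OF k]
      Th_ge_0 [of k] Th_le_2pi [of "Suc k"] k by force+
  consider "t = 0" "\<rho> k < fm k" | "t = 1" "\<rho> k < f k (\<Theta> k)" | "t = 2"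
    using lm by (auto simp: mem_all_labels l)
  then have "from_pt l \<noteq> to_pt l \<and> (case appendix l of None \<Rightarrow> True
      | Some w \<Rightarrow> from_pt l \<in> sphere p r \<and> to_pt l \<in> sphere p r \<and>
          w \<in> sphere p r - {from_pt l, to_pt l})"
  proof cases
    case 1
    then show ?thesis using l neq' [of "fm k" "\<rho> k" "\<Theta> k"] \<rho>_nonneg [OF k] fm_pos [OF k]
      by (simp add: from_pt_def to_pt_def appendix_def)
  next
    case 2
    then show ?thesis using l neq' [of "\<rho> k" "f k (\<Theta> k)" "\<Theta> k"] \<rho>_nonneg [OF k]
      by (simp add: from_pt_def to_pt_def appendix_def)
  next
    case 3
    have "from_pt l \<noteq> to_pt l"
      using neq [of "f k (\<Theta> k)" "f k (\<Theta> (Suc k))" "\<Theta> k" "\<Theta> (Suc k)"] f_pos [OF k] Th_Suc [OF k]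
        gap_less_2pi [OF k] Th_ge_0 [of k] Th_le_2pi [of "Suc k"] k to_pt_2 [OF k]
      by (simp add: l 3 from_pt_def)
    then show ?thesis using l 3 to_pt_2 [OF k] arc [OF k] r_pos w
      by (auto simp: appendix_def from_pt_def dist_pol)
  qed
  then show ?thesis
    by (simp add: proper_edge_def start_fan_edges target_fan_edges snd_fan_edges i l_def
        cong: option.case_cong)
qed

text \<open>The angles are recorded along with the points and become the witness in
  \<open>ccw_around\<close>. They could not be recovered from the points, since a vertex with
  \<open>\<rho> k = 0\<close> is \<open>p\<close> itself.\<close>

definition angles :: "nat \<times> nat \<Rightarrow> (complex \<times> real) list" where
  "angles l = (from_pt l, \<Theta> (fst l)) #
     (case appendix l of None \<Rightarrow> [] | Some w \<Rightarrow> [(w, \<omega> (fst l))])"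

lemma entries_angles: "map snd (entries fan_edges) = map fst (concat (map angles all_labels))"
proof -
  have "map snd (entries (map (\<lambda>l. (from_pt l, appendix l)) ls)) = map fst (concat (map angles ls))"
      for ls
    by (induction ls) (auto simp: entries_def angles_def split: option.split)
  then show ?thesis by (simp add: fan_edges_def all_labels_def)
qed

lemma sorted_angles_prefix:
  "m \<le> M \<Longrightarrow> sorted (map snd (concat (map angles (concat (map labels [0..<m]))))) \<and>
     (\<forall>x\<in>set (concat (map angles (concat (map labels [0..<m])))). snd x \<le> \<Theta> m)"
proof (induction m)
  case (Suc m)
  let ?A = "concat (map angles (concat (map labels [0..<m])))"
  let ?B = "concat (map angles (labels m))"
  have m: "m < M" using Suc by simp
  have A: "sorted (map snd ?A)" "\<forall>x\<in>set ?A. snd x \<le> \<Theta> m" using Suc by auto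
  have B: "sorted (map snd ?B)" "\<forall>x\<in>set ?B. \<Theta> m \<le> snd x \<and> snd x \<le> \<Theta> (Suc m)"
    using \<omega> [OF m] Th_Suc [OF m]
    by (auto simp: labels_def angles_def appendix_def split: if_splits)
  have "\<forall>x\<in>set ?A. snd x \<le> \<Theta> (Suc m)" using A(2) Th_Suc [OF m] by force
  moreover have "sorted (map snd ?A @ map snd ?B)"
    unfolding sorted_append using A B by force
  ultimately show ?case using B by auto
qed simp

lemma angles_polar:
  assumes "l \<in> set all_labels" "(z, \<phi>) \<in> set (angles l)"
  shows "z = p + of_real (dist p z) * cis \<phi> \<and> 0 \<le> \<phi> \<and> \<phi> \<le> 2 * pi"
proof -
  obtain k t where l: "l = (k, t)" by (cases l)
  have k: "k < M" using assms(1) by (simp add: mem_all_labels l)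
  have pol: "x = p + of_real (dist p x) * cis \<phi>" if "x = pol p s \<phi>" "0 \<le> s" for x s \<phi>
    using that dist_pol [of p s \<phi>] by (simp add: pol_def)
  consider "z = from_pt l" "\<phi> = \<Theta> k" | "z = pol p r (\<omega> k)" "\<phi> = \<omega> k"
    using assms(2) by (auto simp: angles_def l appendix_def split: if_splits)
  then show ?thesis
  proof cases
    case 1
    have "0 \<le> f k (\<Theta> k)" using f_pos [OF k, of "\<Theta> k"] Th_Suc [OF k] by simp
    then show ?thesis using 1 \<rho>_nonneg [OF k] fm_pos [OF k] Th_ge_0 [of k] Th_le_2pi [of k] k
      by (auto simp: from_pt_def l Let_def intro!: pol)
  next
    case 2
    then show ?thesis
      using \<omega> [OF k] Th_ge_0 [of k] Th_le_2pi [of "Suc k"] k r_pos by (auto intro!: pol)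
  qed
qed

lemma ccw_fan_edges: "ccw_around p (map snd (entries fan_edges))"
  unfolding entries_angles
proof (rule ccw_aroundI)
  show "sorted (map snd (concat (map angles all_labels)))"
    using sorted_angles_prefix [of M] by (simp add: all_labels_def)
qed (use angles_polar in auto)

section \<open>Overlaps of edges\<close>

lemma finite_graph_inter:
  assumes "k < M" "finite F" "\<And>\<theta>. \<Theta> k \<le> \<theta> \<Longrightarrow> \<theta> \<le> \<Theta> (Suc k) \<Longrightarrow> pol p (f k \<theta>) \<theta> \<in> S \<Longrightarrow> \<theta> \<in> F"
  shows "finite (graph k \<inter> S)"
proof (rule finite_subset)
  show "graph k \<inter> S \<subseteq> (\<lambda>\<theta>. pol p (f k \<theta>) \<theta>) ` F"
    using assms(3) by (auto simp: graph_def)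
qed (use assms in simp)

text \<open>A ray meets each curve at one radius, so a common point forces a common direction. Two
  sectors share directions only at bounding rays or at the seam, where the angles 0 and
  \<open>2 * pi\<close> agree.\<close>

lemma finite_graph_graph:
  assumes k: "k < M" and j: "j < M" and "k \<noteq> j"
  shows "finite (graph k \<inter> graph j)"
proof (rule finite_graph_inter [OF k, of "{\<Theta> k, \<Theta> (Suc k), 0, 2 * pi}"])
  fix \<theta> assume \<theta>: "\<Theta> k \<le> \<theta>" "\<theta> \<le> \<Theta> (Suc k)" "pol p (f k \<theta>) \<theta> \<in> graph j"
  then obtain \<phi> where \<phi>: "\<Theta> j \<le> \<phi>" "\<phi> \<le> \<Theta> (Suc j)" "pol p (f k \<theta>) \<theta> = pol p (f j \<phi>) \<phi>"
    by (auto simp: graph_def)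
  have "cis \<theta> = cis \<phi>"
    using pol_eqD(2) [OF \<phi>(3)] f_pos [OF k] f_pos [OF j] \<theta> \<phi> by (simp add: less_imp_le)
  then have "\<theta> = \<phi> \<or> \<theta> = 0 \<or> \<theta> = 2 * pi"
    using cis_eq_cases [of \<theta> \<phi>] \<theta> \<phi> Th_ge_0 [of k] Th_ge_0 [of j] Th_le_2pi [of "Suc k"]
      Th_le_2pi [of "Suc j"] k j by auto
  then show "\<theta> \<in> {\<Theta> k, \<Theta> (Suc k), 0, 2 * pi}"
    using \<theta> \<phi> Th_mono_le [of "Suc k" j] Th_mono_le [of "Suc j" k] k j \<open>k \<noteq> j\<close>
    by (cases "k < j") auto
qed simp

lemma finite_graph_radial:
  assumes k: "k < M" and j: "j < M"
  shows "finite (graph k \<inter> radial j b)"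
proof (rule finite_graph_inter [OF k, of "{\<Theta> j, 0, 2 * pi}"])
  fix \<theta> assume \<theta>: "\<Theta> k \<le> \<theta>" "\<theta> \<le> \<Theta> (Suc k)" "pol p (f k \<theta>) \<theta> \<in> radial j b"
  then obtain s where s: "\<rho> j \<le> s" "pol p (f k \<theta>) \<theta> = pol p s (\<Theta> j)"
    by (auto simp: radial_def)
  have "cis \<theta> = cis (\<Theta> j)"
    using pol_eqD(2) [OF s(2)] f_pos [OF k] \<theta> s(1) \<rho>_nonneg [OF j] by simp
  then show "\<theta> \<in> {\<Theta> j, 0, 2 * pi}"
    using cis_eq_cases [of \<theta> "\<Theta> j"] \<theta> Th_ge_0 [of k] Th_ge_0 [of j] Th_le_2pi [of "Suc k"]
      Th_le_2pi [of j] k j by auto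
qed simp

lemma finite_radial_radial:
  assumes k: "k < M" and j: "j < M" and "k \<noteq> j"
  shows "finite (radial k a \<inter> radial j b)"
proof (rule finite_subset)
  show "radial k a \<inter> radial j b \<subseteq> {p}"
  proof
    fix x assume "x \<in> radial k a \<inter> radial j b"
    then obtain s t where st: "\<rho> k \<le> s" "x = pol p s (\<Theta> k)" "\<rho> j \<le> t" "x = pol p t (\<Theta> j)"
      by (auto simp: radial_def)
    have nn: "0 \<le> s" "0 \<le> t" using st \<rho>_nonneg k j by (meson order_trans)+
    show "x \<in> {p}"
    proof (cases "s = 0")
      case False
      then have "cis (\<Theta> k) = cis (\<Theta> j)"
        using pol_eqD(2) [of p s "\<Theta> k" t "\<Theta> j"] st nn by simp
      then have "\<Theta> k = \<Theta> j"
        using cis_eq_cases [of "\<Theta> k" "\<Theta> j"] Th_ge_0 [of k] Th_ge_0 [of j] Th_less_2pi [of k]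
          Th_less_2pi [of j] k j by auto
      then show ?thesis using Th_inj [of k j] k j \<open>k \<noteq> j\<close> by simp
    qed (use st in simp)
  qed
qed simp

text \<open>The inward and the outward edge of one ray are the only edges that can have infinitely
  many points in common. They point in opposite directions, which is the retracing that
  \<open>represents_boundary\<close> permits.\<close>

lemma opposite_radial:
  assumes "\<rho> k < fm k" "\<rho> k < f k (\<Theta> k)"
  shows "\<exists>c<0. to_pt (k, 0) - from_pt (k, 0) = of_real c * (to_pt (k, 1) - from_pt (k, 1))"
    and "\<exists>c<0. to_pt (k, 1) - from_pt (k, 1) = of_real c * (to_pt (k, 0) - from_pt (k, 0))"
proof -
  have d0: "to_pt (k, 0) - from_pt (k, 0) = of_real (\<rho> k - fm k) * cis (\<Theta> k)"
    by (simp add: to_pt_def from_pt_def pol_def algebra_simps)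
  have d1: "to_pt (k, 1) - from_pt (k, 1) = of_real (f k (\<Theta> k) - \<rho> k) * cis (\<Theta> k)"
    by (simp add: to_pt_def from_pt_def pol_def algebra_simps)
  show "\<exists>c<0. to_pt (k, 0) - from_pt (k, 0) = of_real c * (to_pt (k, 1) - from_pt (k, 1))"
    unfolding d0 d1 mult.assoc [symmetric] of_real_mult [symmetric] using assms
    by (intro exI [of _ "(\<rho> k - fm k) / (f k (\<Theta> k) - \<rho> k)"]) (simp add: divide_neg_pos)
  show "\<exists>c<0. to_pt (k, 1) - from_pt (k, 1) = of_real c * (to_pt (k, 0) - from_pt (k, 0))"
    unfolding d0 d1 mult.assoc [symmetric] of_real_mult [symmetric] using assms
    by (intro exI [of _ "(f k (\<Theta> k) - \<rho> k) / (\<rho> k - fm k)"]) (simp add: divide_pos_neg)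
qed

lemma edges_overlap:
  assumes "l \<in> set all_labels" "l' \<in> set all_labels" "l \<noteq> l'"
  shows "finite (edge_set l \<inter> edge_set l') \<or>
    (\<exists>c<0. to_pt l - from_pt l = of_real c * (to_pt l' - from_pt l'))"
proof -
  obtain k t j u where l: "l = (k, t)" "l' = (j, u)" by (cases l; cases l')
  have kj: "k < M" "j < M" using assms by (auto simp: mem_all_labels l)
  show ?thesis
  proof (cases "t = 2 \<or> u = 2")
    case True
    then show ?thesis
    proof (cases "t = 2 \<and> u = 2")
      case True
      then show ?thesis using finite_graph_graph [of k j] kj assms l by (auto simp: edge_set_2)
    next
      case False
      then have "finite (edge_set l \<inter> edge_set l')"
        using True assms finite_graph_radial [of k j] finite_graph_radial [of j k] kj
        by (auto simp: mem_all_labels l edge_set_0 edge_set_1 [simplified] edge_set_2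
            Int_commute [of "radial k _"])
      then show ?thesis by blast
    qed
  next
    case False
    show ?thesis
    proof (cases "k = j")
      case True
      then show ?thesis using assms False opposite_radial [of k, simplified]
          by (auto simp: mem_all_labels l)
    next
      case neq: False
      have "finite (edge_set l \<inter> edge_set l')"
        using False assms finite_radial_radial [of k j] kj neq
        by (auto simp: mem_all_labels l edge_set_0 edge_set_1 [simplified])
      then show ?thesis by blast
    qed
  qed
qed

theorem represents_boundary_fan_edges: "represents_boundary p r fan_edges R"
  unfolding represents_boundary_def
proof (intro conjI allI impI)
  fix i j assume ij: "i < length fan_edges" "j < length fan_edges"
    "i \<noteq> j \<and> snd (fan_edges ! i) = None \<and> snd (fan_edges ! j) = None"
  then have "i < length all_labels" "j < length all_labels" by (simp_all add: length_fan_edges)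
  then show "finite (edge p r fan_edges i \<inter> edge p r fan_edges j) \<or>
      (\<exists>k<0. target fan_edges i - start fan_edges i =
        complex_of_real k * (target fan_edges j - start fan_edges j))"
    using edges_overlap [of "all_labels ! i" "all_labels ! j"] distinct_all_labels ij
    by (simp add: edge_fan_edges target_fan_edges start_fan_edges nth_eq_iff_index_eq)
qed (simp_all add: proper_fan_edges frontier_edges ccw_fan_edges)

end

section \<open>Cones and segments\<close>

definition cross :: "complex \<Rightarrow> complex \<Rightarrow> real" where
  "cross a b = Re a * Im b - Im a * Re b"

lemma cross_commute: "cross b a = - cross a b"
  by (simp add: cross_def)

lemma cross_add: "cross a (b + c) = cross a b + cross a c" "cross (a + b) c = cross a c + cross b c"
  by (simp_all add: cross_def algebra_simps)

lemma cross_diff: "cross a (b - c) = cross a b - cross a c" "cross (a - b) c = cross a c - cross b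
    c"
  by (simp_all add: cross_def algebra_simps)

lemma cross_mult: "cross a (of_real s * b) = s * cross a b" "cross (of_real s * a) b = s * cross a
    b"
  by (simp_all add: cross_def algebra_simps)

lemma cross_self [simp]: "cross a a = 0" "cross 0 a = 0" "cross a 0 = 0"
  by (simp_all add: cross_def)

lemma cross_cis: "cross (cis \<alpha>) (cis \<beta>) = sin (\<beta> - \<alpha>)"
  by (simp add: cross_def sin_diff algebra_simps)

lemma cross_cramer:
  "of_real (cross a b) * d = of_real (cross d b) * a + of_real (cross a d) * b"
  by (simp add: complex_eq_iff cross_def algebra_simps)

text \<open>The factor by which the vector \<open>d\<close> has to be scaled to reach the line through \<open>a\<close> and
  \<open>b\<close>.\<close>

definition hit :: "complex \<Rightarrow> complex \<Rightarrow> complex \<Rightarrow> real" where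
  "hit a b d = cross a b / cross d (b - a)"

lemma hit_commute: "hit b a d = hit a b d"
proof -
  have "cross d (a - b) = - cross d (b - a)" by (simp add: cross_diff)
  then show ?thesis by (simp add: hit_def cross_commute [of a b])
qed

lemma closed_segment_of_real:
  "x \<in> closed_segment a b \<longleftrightarrow> (\<exists>u. 0 \<le> u \<and> u \<le> 1 \<and> x = of_real (1 - u) * a + of_real u * b)"
  by (auto simp: in_segment scaleR_conv_of_real)

text \<open>Taking cross products of \<open>s * d = (1 - u) * a + u * b\<close> with
  \<open>a\<close> and with \<open>b\<close> isolates \<open>u\<close> and \<open>1 - u\<close>; the
  sum of the two equations determines \<open>s\<close>. Conversely, \<open>cross_cramer\<close>
  rebuilds the convex combination.\<close>

lemma ray_meets_segment_iff:
  assumes ab: "0 < cross a b" and s: "0 < s"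
  shows "of_real s * d \<in> closed_segment a b \<longleftrightarrow>
    0 \<le> cross a d \<and> 0 \<le> cross d b \<and> d \<noteq> 0 \<and> s = hit a b d"
proof
  assume "of_real s * d \<in> closed_segment a b"
  then obtain u where u: "0 \<le> u" "u \<le> 1" "of_real s * d = of_real (1 - u) * a + of_real u * b"
    unfolding closed_segment_of_real by blast
  have 1: "s * cross a d = u * cross a b"
    using arg_cong [OF u(3), of "cross a"] by (simp add: cross_mult cross_add del: of_real_diff)
  have 2: "s * cross d b = (1 - u) * cross a b"
    using arg_cong [OF u(3), of "\<lambda>x. cross x b"]
        by (simp add: cross_mult cross_add del: of_real_diff)
  have "0 \<le> s * cross a d" "0 \<le> s * cross d b" unfolding 1 2 using u ab by simp_all
  then have nn: "0 \<le> cross a d" "0 \<le> cross d b" using s by (simp_all add: zero_le_mult_iff)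
  have sum: "s * cross d (b - a) = cross a b"
    using 1 2 by (simp add: cross_diff cross_commute [of a d] algebra_simps)
  then have "cross d (b - a) \<noteq> 0" using ab by auto
  moreover from this have "d \<noteq> 0" by auto
  ultimately show "0 \<le> cross a d \<and> 0 \<le> cross d b \<and> d \<noteq> 0 \<and> s = hit a b d"
    using nn sum by (simp add: hit_def field_simps)
next
  assume *: "0 \<le> cross a d \<and> 0 \<le> cross d b \<and> d \<noteq> 0 \<and> s = hit a b d"
  define c where "c = cross d b + cross a d"
  have cd: "cross d (b - a) = c" by (simp add: c_def cross_diff cross_commute [of a d])
  have "c \<noteq> 0" using * s by (auto simp: hit_def cd)
  then have c: "0 < c" using * by (simp add: c_def less_le)
  \<comment> \<open>Dividing \<open>cross_cramer\<close> by \<open>c\<close> gives \<open>a\<close>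
    and \<open>b\<close> the weights \<open>cross d b / c\<close> and \<open>cross a d / c\<close>,
    which add up to 1.\<close>
  define u where "u = cross a d / c"
  have u: "0 \<le> u" "u \<le> 1" "1 - u = cross d b / c" using * c by (auto simp: u_def c_def field_simps)
  have "of_real c * (of_real (1 - u) * a + of_real u * b) = of_real (cross d b) * a + of_real (cross
      a d) * b"
    unfolding u(3) unfolding u_def using c by (simp add: algebra_simps)
  also have "\<dots> = of_real (cross a b) * d" by (rule cross_cramer [symmetric])
  also have "\<dots> = of_real c * (of_real s * d)"
    using * c by (simp add: hit_def cd)
  finally have "of_real (1 - u) * a + of_real u * b = of_real s * d" using c by simp
  then show "of_real s * d \<in> closed_segment a b"
    unfolding closed_segment_of_real using u by metis
qed

lemma hit_pos:
  assumes ab: "0 < cross a b" and "0 \<le> cross a d" "0 \<le> cross d b" "d \<noteq> 0"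
  shows "0 < cross d (b - a)" "0 < hit a b d"
proof -
  have e: "cross d (b - a) = cross d b + cross a d" by (simp add: cross_diff cross_commute [of a d])
  have "cross d b + cross a d \<noteq> 0"
  proof
    assume "cross d b + cross a d = 0"
    then have "cross d b = 0" "cross a d = 0" using assms by linarith+
    then have "of_real (cross a b) * d = 0" using cross_cramer [of a b d] by simp
    then show False using assms by simp
  qed
  then show "0 < cross d (b - a)" using assms e by linarith
  then show "0 < hit a b d" using ab by (simp add: hit_def)
qed

lemma sin_nonneg_cases:
  assumes "0 \<le> sin x" "- 2 * pi \<le> x" "x \<le> 2 * pi"
  shows "0 \<le> x \<and> x \<le> pi \<or> x \<le> - pi \<or> x = 2 * pi"
proof (rule ccontr)
  assume "\<not> ?thesis"
  then consider "pi < x" "x < 2 * pi" | "- pi < x" "x < 0" using assms by fastforce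
  then have "sin x < 0"
  proof cases
    case 1
    then show ?thesis using sin_lt_zero by blast
  next
    case 2
    then show ?thesis using sin_gt_zero [of "- x"] by simp
  qed
  then show False using assms by simp
qed

lemma sin_pos_cases:
  assumes "0 < sin x" "- 2 * pi < x" "x < 2 * pi"
  shows "0 < x \<and> x < pi \<or> x < - pi"
proof -
  have "x \<noteq> 0" "x \<noteq> pi" "x \<noteq> - pi" using assms(1) by auto
  then show ?thesis using sin_nonneg_cases [of x] assms by auto
qed

lemma sin_range_between:
  assumes "0 \<le> sin (\<theta> - \<alpha>)" "0 \<le> sin (\<beta> - \<theta>)" "0 \<le> \<alpha>" "\<alpha> < \<beta>" "\<beta> \<le> 2 * pi" "\<beta> - \<alpha> < pi"
    "0 \<le> \<theta>" "\<theta> < 2 * pi"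
  shows "\<alpha> \<le> \<theta> \<and> \<theta> \<le> \<beta> \<or> \<theta> = 0 \<and> \<beta> = 2 * pi"
  using sin_nonneg_cases [of "\<theta> - \<alpha>"] sin_nonneg_cases [of "\<beta> - \<theta>"] assms by linarith

lemma Arg2pi_polar: "z = of_real (norm z) * cis (Arg2pi z)"
  by (simp add: Arg2pi_eq [symmetric] cis_conv_exp)

lemma Arg2pi_unique_cis:
  assumes "0 < s" "0 \<le> \<theta>" "\<theta> < 2 * pi"
  shows "Arg2pi (of_real s * cis \<theta>) = \<theta>"
  using Arg2pi_unique [of s \<theta>] assms by (simp add: cis_conv_exp mult.commute)

text \<open>The angles of the cone spanned by \<open>a\<close> and \<open>b\<close>, for \<open>cross a b > 0\<close>. The half open
  version describes the sectors that are covered by the segment from \<open>a\<close> to \<open>b\<close>.\<close>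

definition in_cone :: "complex \<Rightarrow> complex \<Rightarrow> real \<Rightarrow> bool" where
  "in_cone a b \<theta> \<longleftrightarrow> (if Arg2pi a < Arg2pi b then Arg2pi a \<le> \<theta> \<and> \<theta> \<le> Arg2pi b
     else Arg2pi a \<le> \<theta> \<or> \<theta> \<le> Arg2pi b)"

definition in_half_cone :: "complex \<Rightarrow> complex \<Rightarrow> real \<Rightarrow> bool" where
  "in_half_cone a b \<theta> \<longleftrightarrow> (if Arg2pi a < Arg2pi b then Arg2pi a \<le> \<theta> \<and> \<theta> < Arg2pi b
     else Arg2pi a \<le> \<theta> \<or> \<theta> < Arg2pi b)"

lemma cross_Arg2pi: "cross a (cis \<theta>) = norm a * sin (\<theta> - Arg2pi a)"
    "cross (cis \<theta>) b = norm b * sin (Arg2pi b - \<theta>)"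
  by (metis Arg2pi_polar cross_cis cross_mult)+

lemma sin_Arg2pi_pos:
  assumes "0 < cross a b"
  shows "0 < sin (Arg2pi b - Arg2pi a)"
proof -
  have "cross a b = norm a * (norm b * sin (Arg2pi b - Arg2pi a))"
    by (metis Arg2pi_polar cross_Arg2pi(2) cross_mult(2))
  then show ?thesis using assms by (simp add: zero_less_mult_iff)
qed

text \<open>A positive cross product means less than half a turn from \<open>a\<close> to
  \<open>b\<close>. The second alternative is a cone that contains the positive real axis, where
  \<open>Arg2pi\<close> jumps.\<close>

lemma Arg2pi_gap:
  assumes "0 < cross a b"
  shows "0 < Arg2pi b - Arg2pi a \<and> Arg2pi b - Arg2pi a < pi \<or> Arg2pi b - Arg2pi a < - pi"
  using sin_pos_cases [OF sin_Arg2pi_pos [OF assms]] Arg2pi_ge_0 [of a] Arg2pi_lt_2pi [of a]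
    Arg2pi_ge_0 [of b] Arg2pi_lt_2pi [of b] by linarith

lemma in_cone_cross:
  assumes "0 < cross a b" "in_cone a b \<theta>" "0 \<le> \<theta>" "\<theta> \<le> 2 * pi"
  shows "0 \<le> cross a (cis \<theta>)" "0 \<le> cross (cis \<theta>) b"
proof -
  have s: "0 \<le> sin x" if "0 \<le> x \<and> x \<le> pi \<or> - 2 * pi \<le> x \<and> x \<le> - pi" for x
    using that sin_ge_zero [of x] sin_ge_zero [of "x + 2 * pi"] by (auto simp: sin_add)
  have "0 \<le> sin (\<theta> - Arg2pi a)" "0 \<le> sin (Arg2pi b - \<theta>)"
    using assms Arg2pi_gap [OF assms(1)] Arg2pi_ge_0 [of a] Arg2pi_lt_2pi [of a]
      Arg2pi_ge_0 [of b] Arg2pi_lt_2pi [of b]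
    by (intro s; auto simp: in_cone_def split: if_splits)+
  then show "0 \<le> cross a (cis \<theta>)" "0 \<le> cross (cis \<theta>) b" by (simp_all add: cross_Arg2pi)
qed

lemma cross_in_cone:
  assumes "0 < cross a b" "0 \<le> cross a (cis \<theta>)" "0 \<le> cross (cis \<theta>) b" "0 \<le> \<theta>" "\<theta> < 2 * pi"
  shows "in_cone a b \<theta>"
proof -
  have "a \<noteq> 0" "b \<noteq> 0" using assms(1) by auto
  then have s: "0 \<le> sin (\<theta> - Arg2pi a)" "0 \<le> sin (Arg2pi b - \<theta>)"
    using assms(2,3) by (auto simp: cross_Arg2pi zero_le_mult_iff)
  show ?thesis
    using sin_nonneg_cases [OF s(1)] sin_nonneg_cases [OF s(2)]
      Arg2pi_gap [OF assms(1)] Arg2pi_ge_0 [of a] Arg2pi_lt_2pi [of a]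
      Arg2pi_ge_0 [of b] Arg2pi_lt_2pi [of b] assms(4,5)
    unfolding in_cone_def by (smt (verit))
qed

text \<open>For a cone across the seam the angles form two pieces, each shorter than
  \<open>pi\<close>, and the mean \<open>\<mu>\<close> of the two end angles lies in the gap between
  them. An interval of cone angles misses \<open>\<mu>\<close>, hence lies in one piece.\<close>

lemma in_cone_gap:
  assumes "0 < cross a b" "\<And>\<theta>. \<alpha> \<le> \<theta> \<Longrightarrow> \<theta> \<le> \<beta> \<Longrightarrow> in_cone a b \<theta>" "0 \<le> \<alpha>" "\<alpha> < \<beta>" "\<beta> \<le> 2 * pi"
  shows "\<beta> - \<alpha> < pi"
proof (rule ccontr)
  assume c: "\<not> \<beta> - \<alpha> < pi"
  define \<mu> where "\<mu> = (Arg2pi a + Arg2pi b) / 2"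
  note b = Arg2pi_ge_0 [of a] Arg2pi_lt_2pi [of a] Arg2pi_ge_0 [of b] Arg2pi_lt_2pi [of b]
  have cone: "in_cone a b \<alpha>" "in_cone a b \<beta>" using assms by auto
  show False
  proof (cases "Arg2pi a < Arg2pi b")
    case True
    then have "Arg2pi b - Arg2pi a < pi" using Arg2pi_gap [OF assms(1)] pi_gt_zero by linarith
    then show False using True cone c by (auto simp: in_cone_def)
  next
    case False
    then have g: "Arg2pi b - Arg2pi a < - pi" using Arg2pi_gap [OF assms(1)] by linarith
    then have "Arg2pi b < Arg2pi a" using pi_gt_zero by linarith
    then have \<mu>: "Arg2pi b < \<mu>" "\<mu> < Arg2pi a" by (simp_all add: \<mu>_def)
    then have "\<not> in_cone a b \<mu>" using False by (simp add: in_cone_def)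
    then have "\<mu> < \<alpha> \<or> \<beta> < \<mu>" using assms(2) [of \<mu>] by linarith
    moreover have "Arg2pi a \<le> \<alpha> \<or> \<alpha> \<le> Arg2pi b" "Arg2pi a \<le> \<beta> \<or> \<beta> \<le> Arg2pi b"
      using cone False by (simp_all add: in_cone_def)
    ultimately show False using g \<mu> c b assms(3-5) by linarith
  qed
qed

text \<open>Both \<open>h \<alpha>\<close> and \<open>h \<beta>\<close> lie on the line through
  \<open>a\<close> and \<open>b\<close>, so \<open>hit\<close> is the same for the subsegment
  between them. Then \<open>ray_meets_segment_iff\<close>, applied to the subsegment, describes its
  points by their angles, and its two sign conditions become conditions on sines that place the
  angle between \<open>\<alpha>\<close> and \<open>\<beta>\<close>.\<close>

lemma visible_part_of_segment:
  assumes ab: "0 < cross a b" and cone: "\<And>\<theta>. \<alpha> \<le> \<theta> \<Longrightarrow> \<theta> \<le> \<beta> \<Longrightarrow> in_cone a b \<theta>"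
    and r: "0 \<le> \<alpha>" "\<alpha> < \<beta>" "\<beta> \<le> 2 * pi"
  defines "h \<equiv> \<lambda>\<theta>. of_real (hit a b (cis \<theta>)) * cis \<theta>"
  shows "h ` {\<alpha>..\<beta>} = closed_segment (h \<alpha>) (h \<beta>)"
proof -
  have gap: "\<beta> - \<alpha> < pi" using in_cone_gap [OF ab cone r] .
  have cr: "0 \<le> cross a (cis \<theta>)" "0 \<le> cross (cis \<theta>) b" if "\<alpha> \<le> \<theta>" "\<theta> \<le> \<beta>" for \<theta>
    using in_cone_cross [OF ab cone] that r by auto
  have pos: "0 < hit a b (cis \<theta>)" if "\<alpha> \<le> \<theta>" "\<theta> \<le> \<beta>" for \<theta>
    using hit_pos(2) [OF ab] cr that by simp
  have on: "h \<theta> \<in> closed_segment a b" if "\<alpha> \<le> \<theta>" "\<theta> \<le> \<beta>" for \<theta>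
    unfolding h_def using ray_meets_segment_iff [OF ab pos] cr that by simp
  obtain u where u: "h \<alpha> = of_real (1 - u) * a + of_real u * b"
    using on [of \<alpha>] r unfolding closed_segment_of_real by auto
  obtain v where v: "h \<beta> = of_real (1 - v) * a + of_real v * b"
    using on [of \<beta>] r unfolding closed_segment_of_real by auto
  have hb: "h \<beta> - h \<alpha> = of_real (v - u) * (b - a)" unfolding u v by (simp add: algebra_simps)
  have cx: "cross (h \<alpha>) (h \<beta>) = (v - u) * cross a b"
    unfolding u v
    by (simp only: cross_add cross_mult cross_self cross_commute [of b a]) (simp add: algebra_simps)
  have "cross (h \<alpha>) (h \<beta>) = hit a b (cis \<alpha>) * hit a b (cis \<beta>) * sin (\<beta> - \<alpha>)"
    unfolding h_def by (simp add: cross_mult cross_cis)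
  moreover have "0 < sin (\<beta> - \<alpha>)" using gap r sin_gt_zero by simp
  ultimately have AB: "0 < cross (h \<alpha>) (h \<beta>)" using pos r by simp
  then have "v \<noteq> u" using cx by auto
  then have same: "hit (h \<alpha>) (h \<beta>) d = hit a b d" for d
    unfolding hit_def hb cx cross_mult by simp
  have key: "of_real s * cis \<theta> \<in> closed_segment (h \<alpha>) (h \<beta>) \<longleftrightarrow>
      0 \<le> sin (\<theta> - \<alpha>) \<and> 0 \<le> sin (\<beta> - \<theta>) \<and> s = hit a b (cis \<theta>)" if "0 < s" for s \<theta>
    unfolding ray_meets_segment_iff [OF AB that] same
    using pos [of \<alpha>] pos [of \<beta>] r
    by (simp add: h_def cross_mult cross_cis zero_le_mult_iff)
  show ?thesis
  proof
    show "h ` {\<alpha>..\<beta>} \<subseteq> closed_segment (h \<alpha>) (h \<beta>)"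
    proof safe
      fix \<theta> assume "\<theta> \<in> {\<alpha>..\<beta>}"
      then show "h \<theta> \<in> closed_segment (h \<alpha>) (h \<beta>)"
        using key [OF pos, of \<theta> \<theta>] gap sin_ge_zero [of "\<theta> - \<alpha>"] sin_ge_zero [of "\<beta> - \<theta>"]
        by (simp add: h_def)
    qed
    show "closed_segment (h \<alpha>) (h \<beta>) \<subseteq> h ` {\<alpha>..\<beta>}"
    proof
      fix x assume x: "x \<in> closed_segment (h \<alpha>) (h \<beta>)"
      have "x \<noteq> 0"
      proof
        assume "x = 0"
        then obtain w where w: "0 = of_real (1 - w) * h \<alpha> + of_real w * h \<beta>"
          using x unfolding closed_segment_of_real by auto
        have "w * cross (h \<alpha>) (h \<beta>) = 0" "(1 - w) * cross (h \<alpha>) (h \<beta>) = 0"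
          using arg_cong [OF w, of "cross (h \<alpha>)"] arg_cong [OF w, of "\<lambda>x. cross x (h \<beta>)"]
          by (simp_all add: cross_add cross_mult del: of_real_diff)
        then show False using AB by simp
      qed
      define \<theta> where "\<theta> = Arg2pi x"
      have x_eq: "x = of_real (norm x) * cis \<theta>" unfolding \<theta>_def by (rule Arg2pi_polar)
      then have *: "0 \<le> sin (\<theta> - \<alpha>)" "0 \<le> sin (\<beta> - \<theta>)" "norm x = hit a b (cis \<theta>)"
        using key [of "norm x" \<theta>] x \<open>x \<noteq> 0\<close> by auto
      then have "\<alpha> \<le> \<theta> \<and> \<theta> \<le> \<beta> \<or> \<theta> = 0 \<and> \<beta> = 2 * pi"
        using sin_range_between [OF *(1,2)] gap r Arg2pi_ge_0 [of x] Arg2pi_lt_2pi [of x]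
        by (simp add: \<theta>_def)
      then show "x \<in> h ` {\<alpha>..\<beta>}"
      proof
        assume "\<alpha> \<le> \<theta> \<and> \<theta> \<le> \<beta>"
        then show ?thesis using x_eq * by (intro image_eqI [of _ _ \<theta>]) (auto simp: h_def)
      next
        \<comment> \<open>\<open>Arg2pi\<close> is 0 on the positive real axis, while a sector may
          end there with the angle \<open>2 * pi\<close>.\<close>
        assume "\<theta> = 0 \<and> \<beta> = 2 * pi"
        then show ?thesis using x_eq * r by (intro image_eqI [of _ _ \<beta>]) (auto simp: h_def)
      qed
    qed
  qed
qed

lemma continuous_on_hit:
  assumes "0 < cross a b" "\<And>\<theta>. \<alpha> \<le> \<theta> \<Longrightarrow> \<theta> \<le> \<beta> \<Longrightarrow> in_cone a b \<theta>" "0 \<le> \<alpha>" "\<beta> \<le> 2 * pi"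
  shows "continuous_on {\<alpha>..\<beta>} (\<lambda>\<theta>. hit a b (cis \<theta>))"
proof -
  have "cross (cis \<theta>) (b - a) \<noteq> 0" if "\<theta> \<in> {\<alpha>..\<beta>}" for \<theta>
    using hit_pos(1) [OF assms(1), of "cis \<theta>"] in_cone_cross [OF assms(1), of \<theta>] assms that by force
  then show ?thesis unfolding hit_def
    by (intro continuous_intros) (auto simp: cross_def intro!: continuous_intros)
qed

text \<open>On a line through the origin the segment is an interval of signed distances between
  \<open>x\<close> and \<open>y\<close>. If \<open>inner a b = x * y\<close> is not positive, the
  segment contains the origin; otherwise the nearer endpoint comes no later than the hit at
  \<open>t\<close>. The two alternatives match the two values of \<open>reach\<close>.\<close>

lemma collinear_ray_meets_segment:
  assumes "cross a b = 0" "0 < t" "of_real t * cis \<theta> \<in> closed_segment a b" "0 \<le> \<theta>" "\<theta> < 2 * pi"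
  obtains e where "e \<in> {a, b}" "e \<noteq> 0" "Arg2pi e = \<theta>" "inner a b \<le> 0 \<or> norm e \<le> t"
proof -
  let ?d = "cis \<theta>"
  obtain u where u: "0 \<le> u" "u \<le> 1" "of_real t * ?d = of_real (1 - u) * a + of_real u * b"
    using assms(3) unfolding closed_segment_of_real by blast
  have cu: "t * cross c ?d = (1 - u) * cross c a + u * cross c b" for c
    using arg_cong [OF u(3), of "cross c"] by (simp add: cross_mult cross_add del: of_real_diff)
  have ca: "cross a ?d = 0" "cross b ?d = 0"
    using cu [of a] cu [of b] assms(1,2) cross_commute [of a b] by auto
  have par: "x = of_real (inner x ?d) * ?d" if "cross x ?d = 0" for x
  proof -
    have c: "Re x * sin \<theta> = Im x * cos \<theta>" using that by (simp add: cross_def)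
    have sc: "cos \<theta> * cos \<theta> + sin \<theta> * sin \<theta> = 1"
      using sin_cos_squared_add [of \<theta>] by (simp add: power2_eq_square)
    have "Re x = (Re x * cos \<theta> + Im x * sin \<theta>) * cos \<theta>" "Im x = (Re x * cos \<theta> + Im x * sin \<theta>) * sin
        \<theta>"
      using c sc by algebra+
    then show ?thesis by (simp add: complex_eq_iff inner_complex_def)
  qed
  define x y where "x = inner a ?d" and "y = inner b ?d"
  have ab: "a = of_real x * ?d" "b = of_real y * ?d" using par ca by (simp_all add: x_def y_def)
  have "of_real t * ?d = of_real ((1 - u) * x + u * y) * ?d"
    using u(3) ab by (simp add: algebra_simps)
  then have t: "t = (1 - u) * x + u * y"
    by (metis cis_neq_zero mult_right_cancel of_real_eq_iff)
  have inn: "inner a b = x * y"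
  proof -
    have "inner a b = x * cos \<theta> * (y * cos \<theta>) + x * sin \<theta> * (y * sin \<theta>)"
      by (simp add: ab inner_complex_def)
    then show ?thesis using sin_cos_squared_add [of \<theta>] by algebra
  qed
  have arg: "Arg2pi (of_real z * ?d) = \<theta>" if "0 < z" for z
    using Arg2pi_unique_cis that assms by blast
  have conv: "min x y \<le> t" "t \<le> max x y"
  proof -
    have "(1 - u) * min x y + u * min x y \<le> t" unfolding t
      using u by (intro add_mono mult_left_mono) auto
    then show "min x y \<le> t" by (simp add: algebra_simps)
    have "t \<le> (1 - u) * max x y + u * max x y" unfolding t
      using u by (intro add_mono mult_left_mono) auto
    then show "t \<le> max x y" by (simp add: algebra_simps)
  qed
  show thesis
  proof (cases "0 < x * y")
    case True
    then have "0 < x" "0 < y" using conv assms(2) by (auto simp: zero_less_mult_iff)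
    then show thesis
      using that [of a] that [of b] conv arg by (cases "x \<le> y") (auto simp: ab norm_mult)
  next
    case False
    then have "inner a b \<le> 0" using inn by simp
    moreover have "0 < x \<or> 0 < y" using conv assms(2) by (auto simp: max_def split: if_splits)
    ultimately show thesis using that [of a] that [of b] arg by (auto simp: ab)
  qed
qed

section \<open>Sectors of the visibility region\<close>

text \<open>An open segment from the centre to a point of the closed disk stays in the open disk,
  and there the candidates cover the same points as the original obstacles.\<close>

lemma circ_vis_region_candidates:
  assumes "candidate_obstacles p r obs cs"
  shows "circ_vis_region obs p r = circ_vis_region cs p r"
proof -
  have "visible obs p q \<longleftrightarrow> visible cs p q" if q: "q \<in> cball p r" for q
  proof -
    have "open_segment p q \<subseteq> ball p r"
    proof
      fix x assume x: "x \<in> open_segment p q"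
      then have "dist x p < dist p q" using dist_in_open_segment [of x p q] by simp
      then show "x \<in> ball p r" using q by (simp add: dist_commute)
    qed
    then show ?thesis using assms unfolding visible_def candidate_obstacles_def by blast
  qed
  then show ?thesis by (auto simp: circ_vis_region_def)
qed

section \<open>Obstacles in polar coordinates around the viewer\<close>

locale obst =
  fixes p :: complex and r :: real and cs :: "obstacle list"
  assumes r_pos: "0 < r" and in_disk: "\<And>s. s \<in> set cs \<Longrightarrow> seg s \<subseteq> cball p r"
    and disj: "disjoint_family_on (\<lambda>i. seg (cs ! i)) {..<length cs}"
begin

abbreviation n :: nat where "n \<equiv> length cs"

text \<open>The endpoints \<open>2 * q\<close> and \<open>2 * q + 1\<close> of obstacle \<open>q\<close>, relative to \<open>p\<close>. The
  out-of-range value \<open>0\<close> makes the two artificial events of the algorithm look like the endpoints of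
  a point obstacle at \<open>p\<close>, which blocks nothing.\<close>

definition Z :: "nat \<Rightarrow> complex" where
  "Z e = (if e < 2 * n then (if even e then fst (cs ! (e div 2)) else snd (cs ! (e div 2))) - p else
      0)"

definition mate :: "nat \<Rightarrow> nat" where
  "mate e = (if even e then e + 1 else e - 1)"

definition cr :: "nat \<Rightarrow> real" where
  "cr e = cross (Z e) (Z (mate e))"

text \<open>The endpoints in counterclockwise order.\<close>

definition spt :: "nat \<Rightarrow> complex" where
  "spt q = (if 0 < cr (2 * q) then Z (2 * q) else Z (2 * q + 1))"

definition ept :: "nat \<Rightarrow> complex" where
  "ept q = (if 0 < cr (2 * q) then Z (2 * q + 1) else Z (2 * q))"

definition nondeg :: "nat \<Rightarrow> bool" where
  "nondeg q \<longleftrightarrow> q < n \<and> cr (2 * q) \<noteq> 0"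

definition cover :: "real \<Rightarrow> nat \<Rightarrow> bool" where
  "cover \<theta> q \<longleftrightarrow> nondeg q \<and> in_half_cone (spt q) (ept q) \<theta>"

definition H :: "nat \<Rightarrow> real \<Rightarrow> real" where
  "H q \<theta> = hit (Z (2 * q)) (Z (2 * q + 1)) (cis \<theta>)"

text \<open>How far one sees along the ray through an endpoint, as far as the obstacle of that endpoint
  is concerned; \<open>0\<close> if that obstacle contains \<open>p\<close>.\<close>

definition reach :: "nat \<Rightarrow> real" where
  "reach e = (if cr e = 0 \<and> inner (Z e) (Z (mate e)) \<le> 0 then 0 else norm (Z e))"

lemma cross_spt_ept: "nondeg q \<Longrightarrow> 0 < cross (spt q) (ept q)"
  using cross_commute [of "Z (Suc (2 * q))" "Z (2 * q)"]
  by (auto simp: spt_def ept_def nondeg_def cr_def mate_def)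

lemma H_eq: "H q \<theta> = hit (spt q) (ept q) (cis \<theta>)"
  by (simp add: H_def spt_def ept_def hit_commute)

lemma seg_rel:
  assumes "q < n"
  shows "p + x \<in> seg (cs ! q) \<longleftrightarrow> x \<in> closed_segment (Z (2 * q)) (Z (2 * q + 1))"
proof -
  have "seg (cs ! q) = closed_segment (p + Z (2 * q)) (p + Z (2 * q + 1))"
    using assms by (simp add: seg_def Z_def)
  then show ?thesis by (simp add: closed_segment_translation_eq)
qed

lemma seg_rel': "q < n \<Longrightarrow> p + x \<in> seg (cs ! q) \<longleftrightarrow> x \<in> closed_segment (spt q) (ept q)"
  using seg_rel by (auto simp: spt_def ept_def closed_segment_commute)

lemma nondeg_blocks_iff:
  assumes "nondeg q" "0 < t"
  shows "pol p t \<theta> \<in> seg (cs ! q) \<longleftrightarrow>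
    0 \<le> cross (spt q) (cis \<theta>) \<and> 0 \<le> cross (cis \<theta>) (ept q) \<and> t = H q \<theta>"
  using assms seg_rel' [of q] ray_meets_segment_iff [OF cross_spt_ept, of q t "cis \<theta>"]
  by (simp add: pol_def nondeg_def H_eq)

lemma H_pos: "nondeg q \<Longrightarrow> in_cone (spt q) (ept q) \<theta> \<Longrightarrow> 0 \<le> \<theta> \<Longrightarrow> \<theta> \<le> 2 * pi \<Longrightarrow> 0 < H q \<theta>"
  unfolding H_eq using hit_pos(2) [OF cross_spt_ept] in_cone_cross [OF cross_spt_ept] by simp

lemma H_in_seg:
  "nondeg q \<Longrightarrow> in_cone (spt q) (ept q) \<theta> \<Longrightarrow> 0 \<le> \<theta> \<Longrightarrow> \<theta> \<le> 2 * pi \<Longrightarrow>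
    pol p (H q \<theta>) \<theta> \<in> seg (cs ! q)"
  using nondeg_blocks_iff [OF _ H_pos, of q q \<theta> \<theta>] in_cone_cross [OF cross_spt_ept, of q \<theta>] by simp

lemma H_le_r:
  assumes "nondeg q" "in_cone (spt q) (ept q) \<theta>" "0 \<le> \<theta>" "\<theta> \<le> 2 * pi"
  shows "H q \<theta> \<le> r"
proof -
  have "pol p (H q \<theta>) \<theta> \<in> cball p r"
    using H_in_seg [OF assms] in_disk [of "cs ! q"] assms(1) by (auto simp: nondeg_def)
  then show ?thesis by (simp add: dist_pol)
qed

lemma H_neq:
  assumes "nondeg q" "nondeg q'" "q \<noteq> q'" "in_cone (spt q) (ept q) \<theta>" "in_cone (spt q') (ept q') \<theta>"
    "0 \<le> \<theta>" "\<theta> \<le> 2 * pi"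
  shows "H q \<theta> \<noteq> H q' \<theta>"
proof
  assume "H q \<theta> = H q' \<theta>"
  then have "pol p (H q \<theta>) \<theta> \<in> seg (cs ! q) \<inter> seg (cs ! q')"
    using H_in_seg [of q \<theta>] H_in_seg [of q' \<theta>] assms by simp
  then show False using disj assms(1-3) by (auto simp: disjoint_family_on_def nondeg_def)
qed

text \<open>Disjoint obstacles do not change their order along a rotating ray, by the intermediate value
  theorem.\<close>

lemma H_less_const:
  assumes q: "nondeg q" "nondeg q'"
    and cone: "\<And>\<theta>. \<alpha> \<le> \<theta> \<Longrightarrow> \<theta> \<le> \<beta> \<Longrightarrow> in_cone (spt q) (ept q) \<theta> \<and> in_cone (spt q') (ept q') \<theta>"
    and b: "0 \<le> \<alpha>" "\<alpha> \<le> \<beta>" "\<beta> \<le> 2 * pi"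
  shows "H q \<alpha> < H q' \<alpha> \<longleftrightarrow> H q \<beta> < H q' \<beta>"
proof (cases "q = q'")
  case False
  have cont: "continuous_on {\<alpha>..\<beta>} (H u)" if "u = q \<or> u = q'" for u
    unfolding H_eq using continuous_on_hit [OF cross_spt_ept, of u \<alpha> \<beta>] that q cone b by auto
  have conn: "connected ((\<lambda>\<theta>. H q \<theta> - H q' \<theta>) ` {\<alpha>..\<beta>})"
    by (intro connected_continuous_image continuous_intros cont) auto
  have nz: "0 \<notin> (\<lambda>\<theta>. H q \<theta> - H q' \<theta>) ` {\<alpha>..\<beta>}"
    using H_neq [OF q False] cone b by force
  show ?thesis
    using connectedD_interval [OF conn, of "H q \<alpha> - H q' \<alpha>" "H q \<beta> - H q' \<beta>" 0]
      connectedD_interval [OF conn, of "H q \<beta> - H q' \<beta>" "H q \<alpha> - H q' \<alpha>" 0] nz b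
    by fastforce
qed simp

text \<open>An obstacle on a line through \<open>p\<close> can block only in the directions of its
  endpoints. It thus matters on event rays alone, through \<open>reach\<close>, and need not take
  part in the order by distance.\<close>

lemma deg_blocks:
  assumes "q < n" "\<not> nondeg q" "0 < t" "pol p t \<theta> \<in> seg (cs ! q)" "0 \<le> \<theta>" "\<theta> < 2 * pi"
  obtains e where "e < 2 * n" "Z e \<noteq> 0" "Arg2pi (Z e) = \<theta>" "reach e \<le> t"
proof -
  let ?a = "Z (2 * q)" and ?b = "Z (2 * q + 1)"
  have c: "cross ?a ?b = 0" "cross ?b ?a = 0" using assms(1,2) cross_commute [of ?b ?a]
    by (auto simp: nondeg_def cr_def mate_def)
  have "of_real t * cis \<theta> \<in> closed_segment ?a ?b"
    using assms(1,4) seg_rel by (simp add: pol_def)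
  then obtain z where z: "z \<in> {?a, ?b}" "z \<noteq> 0" "Arg2pi z = \<theta>" "inner ?a ?b \<le> 0 \<or> norm z \<le> t"
    using collinear_ray_meets_segment [OF c(1) assms(3)] assms(5,6) by blast
  have "reach (2 * q) \<le> t" if "z = ?a" using z that c assms(3)
      by (auto simp: reach_def mate_def cr_def)
  moreover have "reach (2 * q + 1) \<le> t" if "z = ?b"
    using z that c assms(3) by (auto simp: reach_def mate_def cr_def inner_commute)
  ultimately show thesis using that [of "2 * q"] that [of "2 * q + 1"] z assms(1) by force
qed

lemma region_iff:
  assumes "0 \<le> s"
  shows "pol p s \<theta> \<in> circ_vis_region cs p r \<longleftrightarrow>
    s \<le> r \<and> (\<forall>t q. 0 < t \<and> t < s \<and> q < n \<longrightarrow> pol p t \<theta> \<notin> seg (cs ! q))"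
proof -
  have eq: "open_segment p (pol p s \<theta>) = (\<lambda>t. pol p t \<theta>) ` {0<..<s}"
  proof (cases "s = 0")
    case False
    then have s: "0 < s" using assms by simp
    have "(1 - u) *\<^sub>R p + u *\<^sub>R pol p s \<theta> = pol p (u * s) \<theta>" for u
      by (simp add: pol_def scaleR_conv_of_real algebra_simps)
    moreover have "p \<noteq> pol p s \<theta>" using dist_pol [of p s \<theta>] s by auto
    ultimately have "open_segment p (pol p s \<theta>) = (\<lambda>u. pol p (u * s) \<theta>) ` {0<..<1}"
      by (simp add: open_segment_image_interval)
    also have "\<dots> = (\<lambda>t. pol p t \<theta>) ` ((\<lambda>u. u * s) ` {0<..<1})" by (simp add: image_image)
    also have "(\<lambda>u. u * s) ` {0<..<1} = {0<..<s}"
    proof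
      show "{0<..<s} \<subseteq> (\<lambda>u. u * s) ` {0<..<1}"
      proof
        fix x assume "x \<in> {0<..<s}"
        then show "x \<in> (\<lambda>u. u * s) ` {0<..<1}" using s by (intro image_eqI [of _ _ "x / s"]) auto
      qed
    qed (use s in auto)
    finally show ?thesis .
  qed simp
  have "visible cs p (pol p s \<theta>) \<longleftrightarrow>
      (\<forall>t q. 0 < t \<and> t < s \<and> q < n \<longrightarrow> pol p t \<theta> \<notin> seg (cs ! q))"
  proof -
    have "visible cs p (pol p s \<theta>) \<longleftrightarrow>
        (\<forall>x\<in>(\<lambda>t. pol p t \<theta>) ` {0<..<s}. \<forall>c\<in>set cs. x \<notin> seg c)"
      unfolding visible_def eq obstructed_def by blast
    then show ?thesis by (auto simp: all_set_conv_all_nth)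
  qed
  then show ?thesis using assms by (simp add: circ_vis_region_def dist_pol)
qed

lemma endpoint_in_seg:
  assumes "e < 2 * n"
  shows "p + Z e \<in> seg (cs ! (e div 2))"
proof -
  have "e div 2 < n" using assms by simp
  moreover have "e = 2 * (e div 2) \<or> e = 2 * (e div 2) + 1" by presburger
  ultimately show ?thesis using seg_rel [of "e div 2" "Z e"] by (metis ends_in_segment)
qed

text \<open>Beyond \<open>reach e\<close> the view is blocked either by the endpoint itself or, if
  the obstacle contains \<open>p\<close>, by the piece of it from \<open>p\<close> to the endpoint,
  which blocks arbitrarily early.\<close>

lemma reach_blocks:
  assumes e: "e < 2 * n" "Z e \<noteq> 0" and s: "reach e < s"
  obtains t q where "0 < t" "t < s" "q < n" "pol p t (Arg2pi (Z e)) \<in> seg (cs ! q)"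
proof -
  define q where "q = e div 2"
  have q: "q < n" using e by (simp add: q_def)
  have pol: "pol p (norm (Z e)) (Arg2pi (Z e)) = p + Z e"
    unfolding pol_def using Arg2pi_polar [of "Z e"] by simp
  show thesis
  proof (cases "norm (Z e) < s")
    case True
    then show thesis using that [of "norm (Z e)" q] q e endpoint_in_seg [OF e(1)] pol
      by (simp add: q_def)
  next
    case False
    then have z: "reach e \<noteq> norm (Z e)" using s by simp
    let ?a = "Z e" and ?b = "Z (mate e)"
    have c: "cross ?a ?b = 0" "inner ?a ?b \<le> 0" "reach e = 0"
      using z by (auto simp: reach_def cr_def split: if_splits)
    have ab: "closed_segment ?a ?b = closed_segment (Z (2 * q)) (Z (2 * q + 1))"
    proof (cases "even e")
      case True
      then have "e = 2 * q" by (simp add: q_def)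
      then show ?thesis by (simp add: mate_def)
    next
      case False
      then have "e = 2 * q + 1" by (simp add: q_def)
      then show ?thesis by (simp add: mate_def closed_segment_commute)
    qed
    define d where "d = norm ?a ^ 2"
    have d: "0 < d" using e by (simp add: d_def)
    \<comment> \<open>By collinearity \<open>?b\<close> is \<open>inner ?a ?b / d\<close> times
      \<open>?a\<close>; this is the parameter at which the convex combination vanishes.\<close>
    define u where "u = d / (d - inner ?a ?b)"
    have u: "0 \<le> u" "u \<le> 1" using d c by (simp_all add: u_def field_simps)
    have "of_real d * ?b = of_real (inner ?a ?b) * ?a"
    proof -
      have "Re ?a * Im ?b = Im ?a * Re ?b" using c(1) by (simp add: cross_def)
      then show ?thesis
        unfolding d_def cmod_power2 complex_eq_iff inner_complex_def
        by (simp add: power2_eq_square algebra_simps)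
    qed
    then have "of_real d * ((1 - of_real u) * ?a + of_real u * ?b) =
        of_real (d * (1 - u) + u * inner ?a ?b) * ?a"
      by (simp add: algebra_simps)
    also have "d * (1 - u) + u * inner ?a ?b = 0"
      using d c by (simp add: u_def field_simps)
    finally have "0 = of_real (1 - u) * ?a + of_real u * ?b" using d by simp
    then have "0 \<in> closed_segment ?a ?b" unfolding closed_segment_of_real using u by metis
    then have sub: "closed_segment 0 ?a \<subseteq> closed_segment (Z (2 * q)) (Z (2 * q + 1))"
      unfolding ab [symmetric] by (simp add: subset_closed_segment)
    define t where "t = s / 2"
    have t: "0 < t" "t < s" "t < norm ?a" "0 < norm ?a" using s c False e by (auto simp: t_def)
    have "of_real t * cis (Arg2pi ?a) = of_real (t / norm ?a) * ?a"
      using e by (subst (2) Arg2pi_polar [of ?a]) simp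
    then have "of_real t * cis (Arg2pi ?a) \<in> closed_segment 0 ?a"
      unfolding closed_segment_of_real using t
      by (intro exI [of _ "t / norm ?a"]) (simp add: field_simps)
    then show thesis using that [of t q] t q sub seg_rel [OF q] by (auto simp: pol_def)
  qed
qed

lemma spt_event: "q < n \<Longrightarrow> \<exists>e<2 * n. spt q = Z e"
  unfolding spt_def by (rule exI [of _ "if 0 < cr (2 * q) then 2 * q else 2 * q + 1"]) auto

lemma ept_event: "q < n \<Longrightarrow> \<exists>e<2 * n. ept q = Z e"
  unfolding ept_def by (rule exI [of _ "if 0 < cr (2 * q) then 2 * q + 1 else 2 * q"]) auto

end

text \<open>What the geometry has to know about the result of the sweep. \<open>C k\<close> is the
  visible obstacle of sector \<open>k\<close> plus one, or 0 for the circle; it is required to be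
  nearest on the first ray of the sector only, and \<open>near_sector\<close> extends this to the
  whole sector. \<open>pt k\<close> is the least \<open>reach\<close> of the endpoints on the ray,
  capped by \<open>r\<close>.\<close>

locale sectors = obst +
  fixes M :: nat and \<Theta> :: "nat \<Rightarrow> real" and C :: "nat \<Rightarrow> nat" and pt :: "nat \<Rightarrow> real"
    and \<omega> :: "nat \<Rightarrow> real"
  assumes M2: "2 \<le> M" and Th0: "\<Theta> 0 = 0" and ThM: "\<Theta> M = 2 * pi"
    and Th_mono: "\<And>i j. i < j \<Longrightarrow> j \<le> M \<Longrightarrow> \<Theta> i < \<Theta> j"
    and \<omega>: "\<And>k. k < M \<Longrightarrow> \<Theta> k < \<omega> k \<and> \<omega> k < \<Theta> (Suc k)"
    and event: "\<And>e. e < 2 * n \<Longrightarrow> \<exists>k<M. \<Theta> k = Arg2pi (Z e)"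
    and near_0: "\<And>k q. k < M \<Longrightarrow> C k = 0 \<Longrightarrow> \<not> cover (\<Theta> k) q"
    and near_Suc: "\<And>k q. k < M \<Longrightarrow> C k = Suc q \<Longrightarrow>
      cover (\<Theta> k) q \<and> (\<forall>q'. cover (\<Theta> k) q' \<longrightarrow> H q (\<Theta> k) \<le> H q' (\<Theta> k))"
    and pt_le_r: "\<And>k. k < M \<Longrightarrow> pt k \<le> r"
    and pt_le: "\<And>k e. k < M \<Longrightarrow> e < 2 * n \<Longrightarrow> Z e \<noteq> 0 \<Longrightarrow> Arg2pi (Z e) = \<Theta> k \<Longrightarrow> pt k \<le> reach e"
    and pt_eq: "\<And>k. k < M \<Longrightarrow> pt k = r \<or>
      (\<exists>e<2 * n. Z e \<noteq> 0 \<and> Arg2pi (Z e) = \<Theta> k \<and> pt k = reach e)"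
begin

definition f :: "nat \<Rightarrow> real \<Rightarrow> real" where
  "f k \<theta> = (if C k = 0 then r else H (C k - 1) \<theta>)"

definition fm :: "nat \<Rightarrow> real" where
  "fm k = (if k = 0 then f (M - 1) (2 * pi) else f (k - 1) (\<Theta> k))"

definition \<rho> :: "nat \<Rightarrow> real" where
  "\<rho> k = min (min (fm k) (f k (\<Theta> k))) (pt k)"

lemma Th_bounds: "k \<le> M \<Longrightarrow> 0 \<le> \<Theta> k" "k \<le> M \<Longrightarrow> \<Theta> k \<le> 2 * pi" "k < M \<Longrightarrow> \<Theta> k < 2 * pi"
  using Th_mono [of 0 k] Th_mono [of k M] Th0 ThM by (cases "k = 0"; cases "k = M"; force)+

lemma Th_Suc: "k < M \<Longrightarrow> \<Theta> k < \<Theta> (Suc k)"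
  using Th_mono by simp

lemma event_angle_ge:
  assumes "e < 2 * n" "k < M" "\<Theta> k < Arg2pi (Z e)"
  shows "\<Theta> (Suc k) \<le> Arg2pi (Z e)"
proof -
  obtain j where j: "j < M" "\<Theta> j = Arg2pi (Z e)" using event assms by blast
  then have "k < j" using assms Th_mono [of j k] by (cases j k rule: linorder_cases) auto
  then show ?thesis using j Th_mono [of "Suc k" j] by (cases "Suc k = j") auto
qed

lemma event_angle_le:
  assumes "e < 2 * n" "k < M" "Arg2pi (Z e) < \<Theta> (Suc k)"
  shows "Arg2pi (Z e) \<le> \<Theta> k"
  using event_angle_ge [of e k] assms by linarith

text \<open>No event lies strictly inside a sector, so a cone that has not ended on the first ray
  lasts up to and including the next one.\<close>

lemma cover_imp_in_cone:
  assumes "k < M" "cover (\<Theta> k) q" "\<Theta> k \<le> \<theta>" "\<theta> \<le> \<Theta> (Suc k)"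
  shows "in_cone (spt q) (ept q) \<theta>"
proof -
  have "q < n" using assms by (simp add: cover_def nondeg_def)
  then obtain e where e: "e < 2 * n" "ept q = Z e" using ept_event by blast
  show ?thesis
    using assms event_angle_ge [OF e(1), of k]
    by (auto simp: cover_def in_half_cone_def in_cone_def e(2) split: if_splits)
qed

lemma in_cone_imp_cover:
  assumes "k < M" "nondeg q" "in_cone (spt q) (ept q) \<theta>" "\<Theta> k < \<theta>" "\<theta> < \<Theta> (Suc k)"
  shows "cover (\<Theta> k) q"
proof -
  have "q < n" using assms by (simp add: nondeg_def)
  then obtain e where e: "e < 2 * n" "spt q = Z e" using spt_event by blast
  show ?thesis
    using assms event_angle_le [OF e(1), of k]
    by (auto simp: cover_def in_half_cone_def in_cone_def e(2) split: if_splits)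
qed

text \<open>The half open cone omits the ray on which an obstacle ends; such an obstacle covers the
  preceding sector, which is sector \<open>M - 1\<close> for ray 0.\<close>

lemma in_cone_imp_cover_either:
  assumes "k < M" "nondeg q" "in_cone (spt q) (ept q) (\<Theta> k)"
  shows "cover (\<Theta> k) q \<or> cover (\<Theta> (if k = 0 then M - 1 else k - 1)) q"
proof (rule ccontr)
  assume nc: "\<not> ?thesis"
  have "q < n" using assms by (simp add: nondeg_def)
  then obtain e where e: "e < 2 * n" "spt q = Z e" using spt_event by blast
  have nk: "\<not> in_half_cone (spt q) (ept q) (\<Theta> k)" using nc assms by (simp add: cover_def)
  then have eq: "\<Theta> k = Arg2pi (ept q)"
    using assms(3) by (auto simp: in_half_cone_def in_cone_def split: if_splits)
  have no: "\<not> in_half_cone (spt q) (ept q) (\<Theta> (if k = 0 then M - 1 else k - 1))"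
    using nc assms by (simp add: cover_def)
  show False
  proof (cases k)
    case 0
    then have "Arg2pi (ept q) = 0" using eq Th0 by simp
    then have wrap: "\<not> Arg2pi (spt q) < Arg2pi (ept q)" using Arg2pi_ge_0 [of "spt q"] by simp
    obtain j where j: "j < M" "\<Theta> j = Arg2pi (Z e)" using event e by blast
    then have "j = M - 1 \<or> j < M - 1" by linarith
    then have "\<Theta> j \<le> \<Theta> (M - 1)" using Th_mono [of j "M - 1"] by auto
    then show False using no 0 wrap j e by (simp add: in_half_cone_def)
  next
    case (Suc j)
    have "Arg2pi (spt q) \<le> \<Theta> j" if "Arg2pi (spt q) < Arg2pi (ept q)"
      using event_angle_le [OF e(1), of j] e(2) that eq Suc assms(1) by simp
    moreover have "\<Theta> j < Arg2pi (ept q)" using Th_Suc [of j] Suc assms(1) eq by simp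
    ultimately show False using no Suc by (auto simp: in_half_cone_def split: if_splits)
  qed
qed

lemma near_sector:
  assumes k: "k < M" and "C k = Suc q" "cover (\<Theta> k) q'" "\<Theta> k \<le> \<theta>" "\<theta> \<le> \<Theta> (Suc k)"
  shows "H q \<theta> \<le> H q' \<theta>"
proof (cases "q = q'")
  case False
  have q: "cover (\<Theta> k) q" and le: "H q (\<Theta> k) \<le> H q' (\<Theta> k)" using near_Suc assms by blast+
  have nd: "nondeg q" "nondeg q'" using q assms by (auto simp: cover_def)
  have b: "0 \<le> \<Theta> k" "\<theta> \<le> 2 * pi" using Th_bounds [of k] Th_bounds [of "Suc k"] k assms by auto
  have cone: "in_cone (spt q) (ept q) \<phi> \<and> in_cone (spt q') (ept q') \<phi>" if "\<Theta> k \<le> \<phi>" "\<phi> \<le> \<theta>" for \<phi>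
    using cover_imp_in_cone [OF k, of _ \<phi>] q assms that by auto
  have "H q (\<Theta> k) \<noteq> H q' (\<Theta> k)" using H_neq [OF nd False] cone [of "\<Theta> k"] b assms by auto
  then have "H q (\<Theta> k) < H q' (\<Theta> k)" using le by simp
  then show ?thesis using H_less_const [OF nd cone b(1) assms(4) b(2)] by simp
qed simp

lemma f_cases:
  assumes "k < M"
  obtains "C k = 0" "\<And>\<theta>. f k \<theta> = r" | q where "C k = Suc q" "cover (\<Theta> k) q" "nondeg q"
      "\<And>\<theta>. f k \<theta> = H q \<theta>"
proof (cases "C k")
  case 0
  then show thesis using that(1) by (simp add: f_def)
next
  case (Suc q)
  then show thesis using that(2) [of q] near_Suc [OF assms] by (simp add: f_def cover_def)
qed

lemma f_bounds:
  assumes k: "k < M" and \<theta>: "\<Theta> k \<le> \<theta>" "\<theta> \<le> \<Theta> (Suc k)"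
  shows "0 < f k \<theta>" "f k \<theta> \<le> r"
proof -
  have "0 < f k \<theta> \<and> f k \<theta> \<le> r"
    using k
  proof (cases rule: f_cases)
    case 1
    then show ?thesis using r_pos by simp
  next
    case (2 q)
    then show ?thesis using H_pos [of q \<theta>] H_le_r [of q \<theta>] cover_imp_in_cone [OF k _ \<theta>, of q]
      Th_bounds [of k] Th_bounds [of "Suc k"] k \<theta> by simp
  qed
  then show "0 < f k \<theta>" "f k \<theta> \<le> r" by auto
qed

lemma f_le_H:
  assumes k: "k < M" and \<theta>: "\<Theta> k \<le> \<theta>" "\<theta> \<le> \<Theta> (Suc k)" and c: "cover (\<Theta> k) q"
  shows "f k \<theta> \<le> H q \<theta>"
  using k
proof (cases rule: f_cases)
  case 1
  then show ?thesis using near_0 [OF k] c by simp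
next
  case (2 q')
  then show ?thesis using near_sector [OF k _ c \<theta>] by simp
qed

lemma f_blocks:
  assumes k: "k < M" and \<theta>: "\<Theta> k \<le> \<theta>" "\<theta> \<le> \<Theta> (Suc k)"
  shows "f k \<theta> = r \<or> (\<exists>q<n. pol p (f k \<theta>) \<theta> \<in> seg (cs ! q))"
  using k
proof (cases rule: f_cases)
  case (2 q)
  then show ?thesis using H_in_seg [of q \<theta>] cover_imp_in_cone [OF k _ \<theta>, of q]
    Th_bounds [of k] Th_bounds [of "Suc k"] k \<theta> by (auto simp: nondeg_def)
qed simp

lemma region_in:
  assumes k: "k < M" and \<theta>: "\<Theta> k < \<theta>" "\<theta> < \<Theta> (Suc k)" and s: "0 \<le> s"
  shows "pol p s \<theta> \<in> circ_vis_region cs p r \<longleftrightarrow> s \<le> f k \<theta>"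
proof
  assume R: "pol p s \<theta> \<in> circ_vis_region cs p r"
  then show "s \<le> f k \<theta>"
    using f_blocks [OF k, of \<theta>] f_bounds [OF k, of \<theta>] region_iff [OF s] \<theta> by force
next
  assume le: "s \<le> f k \<theta>"
  have b: "0 \<le> \<theta>" "\<theta> < 2 * pi" using Th_bounds [of k] Th_bounds [of "Suc k"] k \<theta> by auto
  have "pol p t \<theta> \<notin> seg (cs ! q)" if t: "0 < t" "t < s" "q < n" for t q
  proof
    assume seg: "pol p t \<theta> \<in> seg (cs ! q)"
    show False
    proof (cases "nondeg q")
      case True
      then have *: "0 \<le> cross (spt q) (cis \<theta>)" "0 \<le> cross (cis \<theta>) (ept q)" "t = H q \<theta>"
        using nondeg_blocks_iff t seg by blast+
      then have "cover (\<Theta> k) q"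
        using in_cone_imp_cover [OF k True _ \<theta>] cross_in_cone [OF cross_spt_ept [OF True]] b
            by blast
      then show False using f_le_H [OF k, of \<theta> q] \<theta> * t le by simp
    next
      case False
      then obtain e where e: "e < 2 * n" "Arg2pi (Z e) = \<theta>"
        using deg_blocks [OF t(3) False t(1) seg b] by blast
      then show False using event_angle_le [OF e(1) k] \<theta> by simp
    qed
  qed
  then show "pol p s \<theta> \<in> circ_vis_region cs p r"
    using region_iff [OF s] le f_bounds [OF k, of \<theta>] \<theta> by force
qed

lemma fm_cases:
  assumes "k < M"
  obtains j \<phi> where "j < M" "j = (if k = 0 then M - 1 else k - 1)" "\<phi> = \<Theta> (Suc j)"
    "cis \<phi> = cis (\<Theta> k)" "fm k = f j \<phi>"
proof (cases k)
  case 0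
  then have "Suc (M - 1) = M" using assms by simp
  then show thesis using that [of "M - 1" "2 * pi"] 0 M2 ThM Th0 by (simp add: fm_def)
next
  case (Suc j)
  show thesis by (rule that [of j "\<Theta> k"]) (use Suc assms in \<open>auto simp: fm_def\<close>)
qed

lemma fm_bounds:
  assumes "k < M"
  shows "0 < fm k" "fm k \<le> r"
proof -
  obtain j \<phi> where "j < M" "\<phi> = \<Theta> (Suc j)" "fm k = f j \<phi>" using fm_cases [OF assms] by blast
  then show "0 < fm k" "fm k \<le> r" using f_bounds [of j \<phi>] Th_Suc [of j] by simp_all
qed

lemma H_cis: "cis \<theta> = cis \<phi> \<Longrightarrow> H q \<theta> = H q \<phi>"
  by (simp add: H_def)

lemma pol_cis: "cis \<theta> = cis \<phi> \<Longrightarrow> pol p s \<theta> = pol p s \<phi>"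
  by (simp add: pol_def)

lemma reach_nonneg: "0 \<le> reach e"
  by (simp add: reach_def)

lemma \<rho>_nonneg: "k < M \<Longrightarrow> 0 \<le> \<rho> k"
  using fm_bounds [of k] f_bounds [of k "\<Theta> k"] Th_Suc [of k] pt_eq [of k] reach_nonneg r_pos
  by (auto simp: \<rho>_def less_imp_le)

text \<open>A non-degenerate obstacle that meets the ray covers the sector after or before it, so
  \<open>f k\<close> or \<open>fm k\<close> accounts for it. A degenerate one meets the ray at or
  beyond the \<open>reach\<close> of one of its endpoints, which \<open>pt k\<close> bounds. Hence
  the minimum of three radii in \<open>\<rho>\<close>.\<close>

lemma region_at:
  assumes k: "k < M" and s: "0 \<le> s"
  shows "pol p s (\<Theta> k) \<in> circ_vis_region cs p r \<longleftrightarrow> s \<le> \<rho> k"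
proof
  let ?\<theta> = "\<Theta> k"
  have b: "0 \<le> ?\<theta>" "?\<theta> < 2 * pi" using Th_bounds [of k] k by auto
  obtain j \<phi> where j: "j < M" "j = (if k = 0 then M - 1 else k - 1)" "\<phi> = \<Theta> (Suc j)"
    "cis \<phi> = cis ?\<theta>" "fm k = f j \<phi>" using fm_cases [OF k] .
  have fk: "0 < f k ?\<theta>" "f k ?\<theta> \<le> r" using f_bounds [OF k, of ?\<theta>] Th_Suc [OF k] by auto
  {
    assume R: "pol p s ?\<theta> \<in> circ_vis_region cs p r"
    then have vis: "s \<le> r" "\<And>t q. 0 < t \<Longrightarrow> t < s \<Longrightarrow> q < n \<Longrightarrow> pol p t ?\<theta> \<notin> seg (cs ! q)"
      using region_iff [OF s] by auto
    have blocked: "s \<le> u" if "u = r \<or> (\<exists>q<n. pol p u ?\<theta> \<in> seg (cs ! q))" "0 < u" for u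
      using vis that by (metis linorder_not_le)
    have "s \<le> f k ?\<theta>" using f_blocks [OF k, of ?\<theta>] Th_Suc [OF k] fk by (intro blocked) auto
    moreover have "fm k = r \<or> (\<exists>q<n. pol p (fm k) ?\<theta> \<in> seg (cs ! q))"
      using f_blocks [OF j(1), of \<phi>] Th_Suc [OF j(1)] pol_cis [OF j(4)] j(3,5) by simp
    then have "s \<le> fm k" using fm_bounds [OF k] by (intro blocked)
    moreover have "s \<le> pt k"
    proof (rule ccontr)
      assume "\<not> s \<le> pt k"
      then have "pt k < s" by simp
      then obtain e where "e < 2 * n" "Z e \<noteq> 0" "Arg2pi (Z e) = \<Theta> k" "reach e < s"
        using pt_eq [OF k] vis(1) by auto
      then show False using reach_blocks [of e s] vis(2) by metis
    qed
    ultimately show "s \<le> \<rho> k" by (simp add: \<rho>_def)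
  next
    assume "s \<le> \<rho> k"
    then have le: "s \<le> fm k" "s \<le> f k ?\<theta>" "s \<le> pt k" by (simp_all add: \<rho>_def)
    have "pol p t ?\<theta> \<notin> seg (cs ! q)" if t: "0 < t" "t < s" "q < n" for t q
    proof
      assume seg: "pol p t ?\<theta> \<in> seg (cs ! q)"
      show False
      proof (cases "nondeg q")
        case True
        then have *: "0 \<le> cross (spt q) (cis ?\<theta>)" "0 \<le> cross (cis ?\<theta>) (ept q)" "t = H q ?\<theta>"
          using nondeg_blocks_iff t seg by blast+
        then have "cover ?\<theta> q \<or> cover (\<Theta> j) q"
          using in_cone_imp_cover_either [OF k True] cross_in_cone [OF cross_spt_ept [OF True]] b
              j(2)
          by auto
        then show False
        proof
          assume "cover ?\<theta> q"
          then show False using f_le_H [OF k, of ?\<theta> q] Th_Suc [OF k] * t le by simp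
        next
          assume "cover (\<Theta> j) q"
          then have "f j \<phi> \<le> H q \<phi>" using f_le_H [OF j(1), of \<phi> q] Th_Suc [OF j(1)] j(3) by simp
          then show False using H_cis [OF j(4), of q] * t le j(5) by simp
        qed
      next
        case False
        then obtain e where "e < 2 * n" "Z e \<noteq> 0" "Arg2pi (Z e) = ?\<theta>" "reach e \<le> t"
          using deg_blocks [OF t(3) False t(1) seg b] by blast
        then show False using pt_le [OF k, of e] t le by simp
      qed
    qed
    then show "pol p s ?\<theta> \<in> circ_vis_region cs p r"
      using region_iff [OF s] le fk by force
  }
qed

sublocale fan p r M \<Theta> f \<rho> "circ_vis_region cs p r" fm
proof
  fix k assume k: "k < M"
  show "continuous_on {\<Theta> k..\<Theta> (Suc k)} (f k)"
    using k
  proof (cases rule: f_cases)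
    case 1
    then show ?thesis by (simp cong: continuous_on_cong)
  next
    case (2 q)
    have "continuous_on {\<Theta> k..\<Theta> (Suc k)} (\<lambda>\<theta>. hit (spt q) (ept q) (cis \<theta>))"
      using continuous_on_hit [OF cross_spt_ept [OF 2(3)]] cover_imp_in_cone [OF k 2(2)]
        Th_bounds [of k] Th_bounds [of "Suc k"] k by simp
    then show ?thesis using 2(4) by (simp add: H_eq cong: continuous_on_cong)
  qed
qed (use M2 Th0 ThM Th_mono f_bounds \<rho>_nonneg region_in region_at in
  \<open>auto simp: fm_def \<rho>_def split: if_splits\<close>)

sublocale fan_boundary p r M \<Theta> f \<rho> "circ_vis_region cs p r" fm "\<lambda>k. C k = 0" \<omega>
proof
  fix k assume k: "k < M"
  show "f k \<theta> = r" if "C k = 0" for \<theta> using that by (simp add: f_def)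
  show "\<Theta> k < \<omega> k \<and> \<omega> k < \<Theta> (Suc k)" using \<omega> k by simp
  assume "C k \<noteq> 0"
  then obtain q where q: "C k = Suc q" using not0_implies_Suc by blast
  note q = q near_Suc [OF k q, THEN conjunct1]
  have q: "C k = Suc q" "cover (\<Theta> k) q" "nondeg q" "\<And>\<theta>. f k \<theta> = H q \<theta>"
    using q by (simp_all add: cover_def f_def)
  let ?h = "\<lambda>\<theta>. of_real (hit (spt q) (ept q) (cis \<theta>)) * cis \<theta>"
  have eq: "pol p (f k \<theta>) \<theta> = p + ?h \<theta>" for \<theta> by (simp add: pol_def q(4) H_eq)
  have "?h ` {\<Theta> k..\<Theta> (Suc k)} = closed_segment (?h (\<Theta> k)) (?h (\<Theta> (Suc k)))"
    using visible_part_of_segment [OF cross_spt_ept [OF q(3)] cover_imp_in_cone [OF k q(2)]]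
      Th_bounds [of k] Th_bounds [of "Suc k"] Th_Suc [OF k] k by simp
  then have "(+) p ` ?h ` {\<Theta> k..\<Theta> (Suc k)} = closed_segment (p + ?h (\<Theta> k)) (p + ?h (\<Theta> (Suc k)))"
    by (simp add: closed_segment_translation)
  then show "graph k = closed_segment (pol p (f k (\<Theta> k)) (\<Theta> k)) (pol p (f k (\<Theta> (Suc k))) (\<Theta> (Suc
      k)))"
    by (simp add: graph_def eq image_image)
qed

end

section \<open>Pseudo-angles\<close>

text \<open>A parametrisation of the unit circle by the interval from 0 to 4 that is increasing in the
  angle and needs nothing but square roots. It replaces the angle in the algorithm.\<close>

definition kang :: "real \<Rightarrow> real" where
  "kang \<kappa> = (if \<kappa> \<le> 2 then arccos (1 - \<kappa>) else 2 * pi - arccos (\<kappa> - 3))"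

text \<open>Written with operations of the machine, branch by branch as the program
  \<open>direction\<close> computes it.\<close>

definition kdir :: "real \<Rightarrow> complex" where
  "kdir \<kappa> = (if 2 < \<kappa> then Complex (\<kappa> - 3) (0 - sqrt (1 - (\<kappa> - 3) * (\<kappa> - 3)))
     else Complex (1 - \<kappa>) (sqrt (1 - (1 - \<kappa>) * (1 - \<kappa>))))"

text \<open>With \<open>c\<close> the cosine of the angle, \<open>1 - c\<close> runs from 0 to 2
  over the closed upper half plane and \<open>3 + c\<close> from 2 to 4 below the real axis. The
  zero vector gets key 0, in line with \<open>Arg2pi 0 = 0\<close>, so an endpoint at
  \<open>p\<close> belongs to the first ray.\<close>

definition key :: "complex \<Rightarrow> real" where
  "key z = (if z = 0 then 0 else if Im z < 0 then 3 + Re z / norm z else 1 - Re z / norm z)"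

lemma cis_kang:
  assumes "0 \<le> \<kappa>" "\<kappa> \<le> 4"
  shows "cis (kang \<kappa>) = kdir \<kappa>"
proof (cases "\<kappa> \<le> 2")
  case True
  then show ?thesis using assms
    by (simp add: kang_def kdir_def complex_eq_iff sin_arccos cos_arccos power2_eq_square)
next
  case False
  then show ?thesis using assms
    by (simp add: kang_def kdir_def complex_eq_iff sin_arccos cos_arccos power2_eq_square
        sin_diff cos_diff)
qed

lemma kang_strict_mono:
  assumes "0 \<le> \<kappa>" "\<kappa> < \<mu>" "\<mu> \<le> 4"
  shows "kang \<kappa> < kang \<mu>"
proof -
  consider "\<mu> \<le> 2" | "2 < \<kappa>" | "\<kappa> \<le> 2" "2 < \<mu>" using assms by linarith
  then show ?thesis
  proof cases
    case 1
    then show ?thesis using assms arccos_less_arccos [of "1 - \<mu>" "1 - \<kappa>"] by (simp add: kang_def)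
  next
    case 2
    then show ?thesis using assms arccos_less_arccos [of "\<kappa> - 3" "\<mu> - 3"] by (simp add: kang_def)
  next
    case 3
    have "arccos (1 - \<kappa>) \<le> pi" using 3 assms by (intro arccos_ubound) auto
    moreover have "arccos (\<mu> - 3) < pi" using 3 assms arccos_less_arccos [of "-1" "\<mu> - 3"] by simp
    ultimately show ?thesis using 3 by (simp add: kang_def)
  qed
qed

lemma kang_0 [simp]: "kang 0 = 0" and kang_4 [simp]: "kang 4 = 2 * pi"
  by (simp_all add: kang_def)

lemma kang_less_iff:
  "0 \<le> \<kappa> \<Longrightarrow> \<kappa> \<le> 4 \<Longrightarrow> 0 \<le> \<mu> \<Longrightarrow> \<mu> \<le> 4 \<Longrightarrow> kang \<kappa> < kang \<mu> \<longleftrightarrow> \<kappa> < \<mu>"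
  using kang_strict_mono by (metis less_asym linorder_neqE_linordered_idom)

lemma kang_le_iff:
  "0 \<le> \<kappa> \<Longrightarrow> \<kappa> \<le> 4 \<Longrightarrow> 0 \<le> \<mu> \<Longrightarrow> \<mu> \<le> 4 \<Longrightarrow> kang \<kappa> \<le> kang \<mu> \<longleftrightarrow> \<kappa> \<le> \<mu>"
  using kang_less_iff [of \<mu> \<kappa>] by (simp add: linorder_not_less [symmetric])

lemma key_bounds: "0 \<le> key z" "key z < 4"
proof -
  have "0 \<le> key z \<and> key z < 4"
  proof (cases "z = 0")
    case False
    have le: "\<bar>Re z / norm z\<bar> \<le> 1" using abs_Re_le_cmod [of z] False by (simp add: divide_le_eq_1)
    show ?thesis
    proof (cases "Im z < 0")
      case True
      have "\<bar>Re z\<bar> < norm z"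
        using True abs_Re_le_cmod [of z] cmod_eq_Re [of z] by (metis abs_Re_le_cmod cmod_power2
            less_eq_real_def less_irrefl power2_abs add_cancel_left_right power2_less_0
                zero_eq_power2)
      then have "Re z / norm z < 1" "- 1 < Re z / norm z" using False
        by (auto simp: divide_less_eq less_divide_eq abs_less_iff)
      then show ?thesis using True False by (simp add: key_def)
    next
      case nn: False
      have "- 1 \<le> Re z / norm z" "Re z / norm z \<le> 1" using le unfolding abs_le_iff by linarith+
      then show ?thesis using nn False unfolding key_def by simp
    qed
  qed (simp add: key_def)
  then show "0 \<le> key z" "key z < 4" by auto
qed

lemma kdir_key:
  assumes "z \<noteq> 0"
  shows "of_real (norm z) * kdir (key z) = z"
proof -
  define c where "c = Re z / norm z"
  have nz: "0 < norm z" using assms by simp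
  have le: "\<bar>c\<bar> \<le> 1" using abs_Re_le_cmod [of z] assms by (simp add: c_def divide_le_eq_1)
  have re: "Re z = norm z * c" using nz by (simp add: c_def)
  have "1 - c * c = ((norm z)\<^sup>2 - (Re z)\<^sup>2) / (norm z)\<^sup>2"
    using nz by (simp add: c_def diff_divide_distrib power2_eq_square)
  also have "\<dots> = (Im z / norm z)\<^sup>2" using cmod_power2 [of z] by (simp add: power_divide)
  finally have "1 - c * c = (Im z / norm z)\<^sup>2" .
  then have im: "norm z * sqrt (1 - c * c) = \<bar>Im z\<bar>" using nz by (simp add: real_sqrt_abs)
  show ?thesis
  proof (cases "Im z < 0")
    case True
    then have k: "key z = 3 + c" using assms by (simp add: key_def c_def)
    have "c \<noteq> - 1" using im True by auto
    then have "2 < key z" using k le by (simp add: abs_le_iff)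
    then have "kdir (key z) = Complex c (- sqrt (1 - c * c))" by (simp add: kdir_def k)
    then show ?thesis using True im re by (simp add: complex_eq_iff)
  next
    case False
    then have k: "key z = 1 - c" using assms by (simp add: key_def c_def)
    then have "\<not> 2 < key z" using le by (simp add: abs_le_iff)
    then have "kdir (key z) = Complex c (sqrt (1 - c * c))" by (simp add: kdir_def k)
    then show ?thesis using False im re by (simp add: complex_eq_iff)
  qed
qed

lemma kang_key: "kang (key z) = Arg2pi z"
proof (cases "z = 0")
  case True
  then show ?thesis by (simp add: key_def Arg2pi_def)
next
  case False
  have b: "0 \<le> kang (key z)" "kang (key z) < 2 * pi"
    using key_bounds [of z] kang_le_iff [of 0 "key z"] kang_less_iff [of "key z" 4] by auto
  have "z = of_real (norm z) * cis (kang (key z))"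
    using kdir_key [OF False] cis_kang [of "key z"] key_bounds [of z] by simp
  then show ?thesis using Arg2pi_unique_cis [OF _ b, of "norm z"] False by simp
qed

lemma key_less_iff: "key z < key w \<longleftrightarrow> Arg2pi z < Arg2pi w"
  using kang_less_iff [of "key z" "key w"] key_bounds [of z] key_bounds [of w]
      by (simp add: kang_key)

section \<open>Program logic\<close>

definition runs :: "com \<Rightarrow> state \<Rightarrow> nat \<Rightarrow> (state \<Rightarrow> bool) \<Rightarrow> bool" where
  "runs c s k Q \<longleftrightarrow> (\<exists>t s'. exec c s t s' \<and> t \<le> k \<and> Q s')"

lemma runs_mono: "runs c s k P \<Longrightarrow> k \<le> l \<Longrightarrow> (\<And>s'. P s' \<Longrightarrow> Q s') \<Longrightarrow> runs c s l Q"
  unfolding runs_def by (meson order_trans)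

lemma runs_Seq: "runs c s k P \<Longrightarrow> (\<And>s'. P s' \<Longrightarrow> runs d s' l Q) \<Longrightarrow> runs (Seq c d) s (k + l) Q"
  unfolding runs_def by (meson add_mono exec.Seq)

lemma exec_Seq_assoc:
  assumes "exec (Seq (Seq a b) c) s t s'"
  shows "exec (Seq a (Seq b c)) s t s'"
proof -
  obtain t1 s1 t2 where 1: "exec (Seq a b) s t1 s1" "exec c s1 t2 s'" "t = t1 + t2"
    using assms by (rule exec_SeqE)
  obtain t3 s2 t4 where 2: "exec a s t3 s2" "exec b s2 t4 s1" "t1 = t3 + t4"
    using 1(1) by (rule exec_SeqE)
  have "exec (Seq a (Seq b c)) s (t3 + (t4 + t2)) s'"
    by (rule exec.Seq [OF 2(1) exec.Seq [OF 2(2) 1(2)]])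
  then show ?thesis using 1 2 by (simp add: add.assoc)
qed

lemma runs_Seq_assoc: "runs (Seq (Seq a b) c) s k Q \<Longrightarrow> runs (Seq a (Seq b c)) s k Q"
  unfolding runs_def using exec_Seq_assoc by blast

lemma runs_While:
  assumes body: "\<And>s. I s \<Longrightarrow> bval b s \<Longrightarrow> runs c s k (\<lambda>s'. I s' \<and> \<mu> s' < \<mu> s)" and "I s"
  shows "runs (While b c) s (Suc (\<mu> s) * (1 + bcost b + k)) (\<lambda>s'. I s' \<and> \<not> bval b s')"
  using \<open>I s\<close>
proof (induction "\<mu> s" arbitrary: s rule: less_induct)
  case less
  show ?case
  proof (cases "bval b s")
    case True
    obtain t s' where s': "exec c s t s'" "t \<le> k" "I s'" "\<mu> s' < \<mu> s"
      using body [OF less.prems True] unfolding runs_def by blast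
    obtain t' s'' where s'': "exec (While b c) s' t' s''" "t' \<le> Suc (\<mu> s') * (1 + bcost b + k)"
        "I s''" "\<not> bval b s''"
      using less.hyps [OF s'(4,3)] unfolding runs_def by blast
    have "Suc (\<mu> s') * (1 + bcost b + k) \<le> \<mu> s * (1 + bcost b + k)" using s'(4)
        by (intro mult_le_mono) auto
    then have "1 + bcost b + t + t' \<le> Suc (\<mu> s) * (1 + bcost b + k)" using s'(2) s''(2) by simp
    then show ?thesis unfolding runs_def
      using exec.WhileTrue [OF True s'(1) s''(1)] s''(3,4) by blast
  next
    case False
    have "1 + bcost b \<le> Suc (\<mu> s) * (1 + bcost b + k)" by simp
    then show ?thesis unfolding runs_def using exec.WhileFalse [OF False, of c] less.prems False
        by blast
  qed
qed

text \<open>For loop free programs only: the precondition of a loop is \<open>False\<close>.\<close>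

primrec wp :: "com \<Rightarrow> (state \<Rightarrow> bool) \<Rightarrow> state \<Rightarrow> bool" where
  "wp Skip Q s \<longleftrightarrow> Q s"
| "wp (NAssign b a e) Q s \<longleftrightarrow> Q (nwrite b (nval a s) (nval e s) s)"
| "wp (RAssign b a e) Q s \<longleftrightarrow> Q (rwrite b (nval a s) (rval e s) s)"
| "wp (Seq c d) Q s \<longleftrightarrow> wp c (wp d Q) s"
| "wp (If b c d) Q s \<longleftrightarrow> (bval b s \<longrightarrow> wp c Q s) \<and> (\<not> bval b s \<longrightarrow> wp d Q s)"
| "wp (While b c) Q s \<longleftrightarrow> False"

lemma wp_mono: "wp c P s \<Longrightarrow> (\<And>s'. P s' \<Longrightarrow> Q s') \<Longrightarrow> wp c Q s"
proof (induction c arbitrary: P Q s)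
  case (Seq c d)
  have "wp c (wp d P) s" using Seq.prems(1) by simp
  then have "wp c (wp d Q) s" by (rule Seq.IH(1)) (use Seq.IH(2) Seq.prems(2) in blast)
  then show ?case by simp
next
  case (If b c d)
  then show ?case unfolding wp.simps by blast
qed auto

text \<open>Both branches of a conditional are charged: a crude bound, but a plain sum without
  maxima and a constant for each loop free program.\<close>

primrec cmax :: "com \<Rightarrow> nat" where
  "cmax Skip = 1"
| "cmax (NAssign b a e) = 1 + ncost a + ncost e"
| "cmax (RAssign b a e) = 1 + ncost a + rcost e"
| "cmax (Seq c d) = cmax c + cmax d"
| "cmax (If b c d) = 1 + bcost b + (cmax c + cmax d)"
| "cmax (While b c) = 0"

lemma runs_wp: "wp c Q s \<Longrightarrow> runs c s (cmax c) Q"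
proof (induction c arbitrary: Q s)
  case (NAssign b a e)
  then show ?case unfolding runs_def using exec.NAssign [of b a e s] by auto
next
  case (RAssign b a e)
  then show ?case unfolding runs_def using exec.RAssign [of b a e s] by auto
next
  case (Seq c d)
  then have "runs c s (cmax c) (wp d Q)" by simp
  then show ?case using runs_Seq [of c s "cmax c" "wp d Q" d "cmax d" Q] Seq.IH(2) by simp
next
  case (If b c d)
  show ?case
  proof (cases "bval b s")
    case True
    then obtain t s' where "exec c s t s'" "t \<le> cmax c" "Q s'"
      using If.IH(1) [of Q s] If.prems unfolding runs_def by auto
    then show ?thesis unfolding runs_def using exec.IfTrue [OF True, of c t s' d]
      by (intro exI [of _ "1 + bcost b + t"] exI [of _ s']) simp
  next
    case False
    then obtain t s' where "exec d s t s'" "t \<le> cmax d" "Q s'"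
      using If.IH(2) [of Q s] If.prems unfolding runs_def by auto
    then show ?thesis unfolding runs_def using exec.IfFalse [OF False, of d t s' c]
      by (intro exI [of _ "1 + bcost b + t"] exI [of _ s']) simp
  qed
next
  case Skip
  then show ?case unfolding runs_def using exec.Skip [of s] by auto
qed simp

primrec nbanks :: "com \<Rightarrow> nat set" where
  "nbanks Skip = {}"
| "nbanks (NAssign b a e) = {b}"
| "nbanks (RAssign b a e) = {}"
| "nbanks (Seq c d) = nbanks c \<union> nbanks d"
| "nbanks (If b c d) = nbanks c \<union> nbanks d"
| "nbanks (While b c) = nbanks c"

primrec rbanks :: "com \<Rightarrow> nat set" where
  "rbanks Skip = {}"
| "rbanks (NAssign b a e) = {}"
| "rbanks (RAssign b a e) = {b}"
| "rbanks (Seq c d) = rbanks c \<union> rbanks d"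
| "rbanks (If b c d) = rbanks c \<union> rbanks d"
| "rbanks (While b c) = rbanks c"

text \<open>Whole banks are the unit of framing. This is fine enough because every array and every
  register that the program writes has a bank of its own.\<close>

definition frame :: "nat set \<Rightarrow> nat set \<Rightarrow> state \<Rightarrow> state \<Rightarrow> bool" where
  "frame A B s s' \<longleftrightarrow> (\<forall>b. b \<notin> A \<longrightarrow> nmem s' b = nmem s b) \<and> (\<forall>b. b \<notin> B \<longrightarrow> rmem s' b = rmem s b)"

lemma nmem_nwrite [simp]: "nmem (nwrite b i x s) = (nmem s)(b := (nmem s b)(i := x))"
  and rmem_nwrite [simp]: "rmem (nwrite b i x s) = rmem s"
  and nmem_rwrite [simp]: "nmem (rwrite b i y s) = nmem s"
  and rmem_rwrite [simp]: "rmem (rwrite b i y s) = (rmem s)(b := (rmem s b)(i := y))"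
  by (simp_all add: nwrite_def rwrite_def)

lemma exec_frame: "exec c s t s' \<Longrightarrow> frame (nbanks c) (rbanks c) s s'"
  by (induction rule: exec.induct) (auto simp: frame_def)

lemma runs_frame: "runs c s k Q \<Longrightarrow> runs c s k (\<lambda>s'. Q s' \<and> frame (nbanks c) (rbanks c) s s')"
  unfolding runs_def using exec_frame by blast

section \<open>Tournament trees\<close>

text \<open>A tournament tree with leaves \<open>N, \<dots>, 2 * N - 1\<close> in an array; the children of node \<open>u\<close> are
  \<open>2 * u\<close> and \<open>2 * u + 1\<close>. The entry \<open>0\<close> means that there is no contestant.\<close>

definition winner :: "(nat \<Rightarrow> real) \<Rightarrow> nat \<Rightarrow> nat \<Rightarrow> nat" where
  "winner g x y = (if 0 < y \<and> \<not> (0 < x \<and> \<not> g y < g x) then y else x)"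

definition tourn :: "(nat \<Rightarrow> real) \<Rightarrow> nat \<Rightarrow> (nat \<Rightarrow> nat) \<Rightarrow> bool" where
  "tourn g N T \<longleftrightarrow> (\<forall>u. 1 \<le> u \<and> u < N \<longrightarrow> T u = winner g (T (2 * u)) (T (2 * u + 1)))"

lemma winner_cases: "winner g x y = x \<or> winner g x y = y"
  by (simp add: winner_def)

lemma tourn_from_leaf:
  assumes "tourn g N T" "1 \<le> u" "u < 2 * N"
  shows "\<exists>l. N \<le> l \<and> l < 2 * N \<and> T u = T l"
  using assms(2,3)
proof (induction "2 * N - u" arbitrary: u rule: less_induct)
  case less
  show ?case
  proof (cases "N \<le> u")
    case False
    then have "T u = winner g (T (2 * u)) (T (2 * u + 1))" using assms(1) less.prems
        by (simp add: tourn_def)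
    then have "T u = T (2 * u) \<or> T u = T (2 * u + 1)" using winner_cases by metis
    then show ?thesis using less.hyps [of "2 * u"] less.hyps [of "2 * u + 1"] False less.prems
        by force
  qed (use less.prems in blast)
qed

lemma tourn_root_least:
  assumes "tourn g N T" "1 \<le> u" "u < 2 * N" "0 < T u"
  shows "0 < T 1 \<and> g (T 1) \<le> g (T u)"
  using assms(2-4)
proof (induction u rule: less_induct)
  case (less u)
  show ?case
  proof (cases "u = 1")
    case False
    define v where "v = u div 2"
    have v: "1 \<le> v" "v < u" "v < N" "u = 2 * v \<or> u = 2 * v + 1"
      using False less.prems by (auto simp: v_def)
    then have "T v = winner g (T (2 * v)) (T (2 * v + 1))" using assms(1) by (simp add: tourn_def)
    then have "0 < T v \<and> g (T v) \<le> g (T u)" using v(4) less.prems(3)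
      by (auto simp: winner_def split: if_splits)
    then show ?thesis using less.IH [of v] v less.prems by force
  qed (use less.prems in simp)
qed

text \<open>Every match compares entries that stem from leaves, so a valuation with the same order
  on the leaves keeps all matches valid. This is how a tree survives a turn of the ray without being
  touched.\<close>

lemma tourn_cong:
  assumes "tourn g N T"
    and "\<And>u v. N \<le> u \<Longrightarrow> u < 2 * N \<Longrightarrow> N \<le> v \<Longrightarrow> v < 2 * N \<Longrightarrow> 0 < T u \<Longrightarrow> 0 < T v \<Longrightarrow>
      g (T u) < g (T v) \<longleftrightarrow> h (T u) < h (T v)"
  shows "tourn h N T"
  unfolding tourn_def
proof (intro allI impI)
  fix u assume u: "1 \<le> u \<and> u < N"
  obtain l where l: "N \<le> l" "l < 2 * N" "T (2 * u) = T l"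
    using tourn_from_leaf [OF assms(1), of "2 * u"] u by auto
  obtain l' where l': "N \<le> l'" "l' < 2 * N" "T (2 * u + 1) = T l'"
    using tourn_from_leaf [OF assms(1), of "2 * u + 1"] u by auto
  have "winner g (T l) (T l') = winner h (T l) (T l')"
    using assms(2) [of l' l] l l' by (auto simp: winner_def)
  then show "T u = winner h (T (2 * u)) (T (2 * u + 1))"
    using assms(1) u l l' by (simp add: tourn_def)
qed

text \<open>Memory of the algorithm. Natural banks: 5 number of events, 6 table of halves, 7 event queue,
  8 tree of active obstacles, 9 nearest obstacle for each sector, 10 and above registers (11 current
  tree node, 13 current event, 15 index of the current ray, 16 length of the output, 17 and 18 loop
  variables of the output). Real banks: 3 and 4 coordinates of the endpoints relative to \<open>p\<close>, 5 keys
  of the events, 6 keys of the rays, 7 distance to the nearest endpoint on a ray, 8 and 9 unit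
      vector
  of the current ray, 10 and above registers. In trees and in bank 9, obstacle or event \<open>i\<close> is
  stored as \<open>i + 1\<close>.\<close>

abbreviation V :: "nat \<Rightarrow> nexp" where "V b \<equiv> NRead b (NConst 0)"
abbreviation W :: "nat \<Rightarrow> rexp" where "W b \<equiv> RRead b (NConst 0)"

definition node :: "nat \<Rightarrow> (nexp \<Rightarrow> rexp) \<Rightarrow> com" where
  "node T g = (let x = NRead T (NAdd (V 11) (V 11)); y = NRead T (NAdd (NAdd (V 11) (V 11)) (NConst
      1)) in
     If (BAnd (NLess (NConst 0) y) (BNot (BAnd (NLess (NConst 0) x) (BNot (RLess (g y) (g x))))))
       (NAssign T (V 11) y) (NAssign T (V 11) x))"

text \<open>The parent of a node is looked up in the table of halves, as the machine cannot divide
  natural numbers.\<close>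

definition path :: "nat \<Rightarrow> (nexp \<Rightarrow> rexp) \<Rightarrow> com" where
  "path T g = While (NLess (NConst 1) (V 11))
     (Seq (NAssign 11 (NConst 0) (NRead 6 (V 11))) (node T g))"

text \<open>Replaying matches overwrites the tree and register 11. The valuation \<open>g\<close>
  must not depend on these, and on its argument only through the value.\<close>

definition indep :: "nat \<Rightarrow> (nexp \<Rightarrow> rexp) \<Rightarrow> bool" where
  "indep T g \<longleftrightarrow> (\<forall>s s' e e'. frame {T, 11} {} s s' \<longrightarrow> nval e s = nval e' s' \<longrightarrow>
     rval (g e) s = rval (g e') s')"

definition gval :: "(nexp \<Rightarrow> rexp) \<Rightarrow> state \<Rightarrow> nat \<Rightarrow> real" where
  "gval g s x = rval (g (NConst x)) s"

lemma wp_node: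
  assumes "indep T g" "T \<noteq> 11"
  shows "wp (node T g) Q s \<longleftrightarrow> Q (nwrite T (nmem s 11 0)
    (winner (gval g s) (nmem s T (2 * nmem s 11 0)) (nmem s T (2 * nmem s 11 0 + 1))) s)"
proof -
  have "rval (g e) s = gval g s (nval e s)" for e
    using assms(1) unfolding indep_def gval_def by (metis frame_def nval.simps(1))
  then show ?thesis by (auto simp: node_def Let_def winner_def mult_2)
qed

lemma gval_frame: "indep T g \<Longrightarrow> frame {T, 11} {} s s' \<Longrightarrow> gval g s' = gval g s"
  unfolding indep_def gval_def by (metis nval.simps(1))

text \<open>After a change of a leaf, only the equations at its ancestors may fail. While the loop climbs
  up, the only equation that may fail is the one at the parent of the current node.\<close>

lemma runs_path:
  assumes "indep T g" "T \<noteq> 11" "T \<noteq> 6"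
    and half: "\<forall>j<2 * N. nmem s 6 j = j div 2"
    and v: "1 \<le> nmem s 11 0" "nmem s 11 0 < 2 * N" "nmem s 11 0 < 2 ^ Suc L"
    and T: "\<forall>u. 1 \<le> u \<and> u < N \<and> u \<noteq> nmem s 11 0 div 2 \<longrightarrow>
      nmem s T u = winner (gval g s) (nmem s T (2 * u)) (nmem s T (2 * u + 1))"
  shows "runs (path T g) s (Suc L * (20 + cmax (node T g)))
    (\<lambda>s'. tourn (gval g s) N (nmem s' T) \<and> (\<forall>u\<ge>N. nmem s' T u = nmem s T u) \<and>
        frame {T, 11} {} s s')"
proof -
  let ?v = "\<lambda>s'. nmem s' 11 0"
  define I where "I s' \<longleftrightarrow> frame {T, 11} {} s s' \<and> 1 \<le> ?v s' \<and> ?v s' < 2 * N \<and>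
    (\<forall>u\<ge>N. nmem s' T u = nmem s T u) \<and>
    (\<forall>u. 1 \<le> u \<and> u < N \<and> u \<noteq> ?v s' div 2 \<longrightarrow>
      nmem s' T u = winner (gval g s) (nmem s' T (2 * u)) (nmem s' T (2 * u + 1)))" for s'
  \<comment> \<open>The integer part of the binary logarithm of the current node. It drops at each
    halving, so at most \<open>L\<close> matches are replayed.\<close>
  define \<mu> where "\<mu> s' = (LEAST l. ?v s' < 2 ^ Suc l)" for s' :: state
  have ex: "x < 2 ^ Suc x" for x :: nat using less_exp [of x] unfolding power_Suc by linarith
  have \<mu>_step: "\<mu> s2 < \<mu> s1" if gt: "1 < ?v s1" and eq: "?v s2 = ?v s1 div 2" for s1 s2 :: state
  proof -
    have 1: "?v s1 < 2 ^ Suc (\<mu> s1)" unfolding \<mu>_def by (rule LeastI [of _ "?v s1"]) (rule ex)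
    then obtain l where l: "\<mu> s1 = Suc l" using gt by (cases "\<mu> s1") auto
    then have "?v s2 < 2 ^ Suc l" using 1 eq by simp
    then have "\<mu> s2 \<le> l" unfolding \<mu>_def by (rule Least_le)
    then show ?thesis using l by simp
  qed
  let ?c = "Seq (NAssign 11 (NConst 0) (NRead 6 (V 11))) (node T g)"
  have "runs (While (NLess (NConst 1) (V 11)) ?c) s (Suc (\<mu> s) * (1 + bcost (NLess (NConst 1) (V
      11)) + cmax ?c))
    (\<lambda>s'. I s' \<and> \<not> bval (NLess (NConst 1) (V 11)) s')"
  proof (rule runs_While)
    show "I s" using v T by (simp add: I_def frame_def)
    fix s1 assume I: "I s1" and "bval (NLess (NConst 1) (V 11)) s1"
    then have gt: "1 < ?v s1" by simp
    define v1 where "v1 = ?v s1 div 2"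
    have v1: "1 \<le> v1" "v1 < N" "v1 < ?v s1" using gt I by (auto simp: v1_def I_def)
    have h: "nmem s1 6 (?v s1) = v1"
      using I half assms(2,3) by (simp add: I_def frame_def v1_def)
    define s2 where "s2 = nwrite 11 0 v1 s1"
    define w where "w = winner (gval g s) (nmem s1 T (2 * v1)) (nmem s1 T (2 * v1 + 1))"
    have fr: "frame {T, 11} {} s s2" using I by (auto simp: I_def frame_def s2_def)
    have "I (nwrite T v1 w s2) \<and> \<mu> (nwrite T v1 w s2) < \<mu> s1"
    proof
      show "\<mu> (nwrite T v1 w s2) < \<mu> s1" using assms(2) gt
          by (intro \<mu>_step) (auto simp: s2_def v1_def)
      show "I (nwrite T v1 w s2)"
        unfolding I_def
      proof (intro conjI allI impI)
        show "frame {T, 11} {} s (nwrite T v1 w s2)" using fr by (auto simp: frame_def)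
      next
        fix u assume "N \<le> u"
        then show "nmem (nwrite T v1 w s2) T u = nmem s T u" using I v1 assms(2)
            by (simp add: I_def s2_def)
      next
        fix u assume u: "1 \<le> u \<and> u < N \<and> u \<noteq> nmem (nwrite T v1 w s2) 11 0 div 2"
        then have u2: "2 * u \<noteq> v1" "2 * u + 1 \<noteq> v1" using assms(2) by (auto simp: s2_def)
        show "nmem (nwrite T v1 w s2) T u = winner (gval g s) (nmem (nwrite T v1 w s2) T (2 * u))
            (nmem (nwrite T v1 w s2) T (2 * u + 1))"
        proof (cases "u = v1")
          case True
          then show ?thesis using u2 assms(2) by (simp add: w_def s2_def)
        next
          case False
          then show ?thesis using u2 u I assms(2) by (simp add: I_def s2_def v1_def)
        qed
      qed (use v1 I assms(2) in \<open>auto simp: s2_def\<close>)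
    qed
    moreover have "gval g s2 = gval g s" using gval_frame [OF assms(1) fr] .
    ultimately have "wp ?c (\<lambda>s'. I s' \<and> \<mu> s' < \<mu> s1) s1"
      using h assms(2) by (simp add: wp_node [OF assms(1,2)] s2_def [symmetric] w_def)
        (simp add: s2_def w_def)
    then show "runs ?c s1 (cmax ?c) (\<lambda>s'. I s' \<and> \<mu> s' < \<mu> s1)" by (rule runs_wp)
  qed
  moreover have "\<mu> s \<le> L" unfolding \<mu>_def using v(3) by (rule Least_le)
  then have "Suc (\<mu> s) * (1 + bcost (NLess (NConst 1) (V 11)) + cmax ?c) \<le> Suc L * (20 + cmax (node
      T g))"
    by (intro mult_le_mono) simp_all
  ultimately show ?thesis unfolding path_def
  proof (rule runs_mono)
    fix s' assume "I s' \<and> \<not> bval (NLess (NConst 1) (V 11)) s'"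
    then have I: "I s'" and "?v s' = 1" by (auto simp: I_def)
    then show "tourn (gval g s) N (nmem s' T) \<and> (\<forall>u\<ge>N. nmem s' T u = nmem s T u) \<and>
        frame {T, 11} {} s s'"
      by (auto simp: I_def tourn_def)
  qed
qed

section \<open>Initialisation\<close>

abbreviation Xe :: "nexp \<Rightarrow> rexp" where "Xe e \<equiv> RRead 3 e"
abbreviation Ye :: "nexp \<Rightarrow> rexp" where "Ye e \<equiv> RRead 4 e"
abbreviation Ke :: "nexp \<Rightarrow> rexp" where "Ke e \<equiv> RRead 5 e"

definition crossE :: "nexp \<Rightarrow> nexp \<Rightarrow> rexp" where
  "crossE a b = RSub (RMul (Xe a) (Ye b)) (RMul (Ye a) (Xe b))"

definition keyE :: "nexp \<Rightarrow> rexp" where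
  "keyE x = Ke (NSub x (NConst 1))"

definition hitE :: "nexp \<Rightarrow> rexp" where
  "hitE x = (let a = NAdd (NSub x (NConst 1)) (NSub x (NConst 1)); b = NAdd a (NConst 1) in
     RDiv (crossE a b)
       (RSub (RMul (W 8) (RSub (Ye b) (Ye a))) (RMul (W 9) (RSub (Xe b) (Xe a)))))"

text \<open>The summand 2 counts the artificial events. Event \<open>2 * n + 1\<close> gets its key
  here because \<open>load\<close> computes keys of genuine endpoints only; event
  \<open>2 * n\<close> keeps the default key 0. The ray starts in direction 1, with the radius as
  its \<open>pt\<close> value.\<close>

definition init :: com where
  "init = Seq (NAssign 5 (NConst 0) (NAdd (NAdd (V 0) (V 0)) (NConst 2)))
    (Seq (RAssign 5 (NAdd (NAdd (V 0) (V 0)) (NConst 1)) (RConst 2))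
    (Seq (RAssign 7 (NConst 0) (RRead 0 (NConst 2))) (RAssign 8 (NConst 0) (RConst 1))))"

definition load_event :: com where
  "load_event = Seq (RAssign 3 (V 10) (RSub (RRead 0 (NAdd (NConst 3) (NAdd (V 10) (V 10)))) (RRead
      0 (NConst 0))))
    (Seq (RAssign 4 (V 10) (RSub (RRead 0 (NAdd (NConst 4) (NAdd (V 10) (V 10)))) (RRead 0 (NConst
        1))))
    (Seq (RAssign 11 (NConst 0) (RSqrt (RAdd (RMul (Xe (V 10)) (Xe (V 10))) (RMul (Ye (V 10)) (Ye (V
        10))))))
    (If (RLess (RConst 0) (W 11))
      (If (RLess (Ye (V 10)) (RConst 0))
        (RAssign 5 (V 10) (RAdd (RConst 3) (RDiv (Xe (V 10)) (W 11))))
        (RAssign 5 (V 10) (RSub (RConst 1) (RDiv (Xe (V 10)) (W 11)))))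
      Skip)))"

definition load_body :: com where
  "load_body = Seq (NAssign 6 (NAdd (V 10) (V 10)) (V 10))
    (Seq (NAssign 6 (NAdd (NAdd (V 10) (V 10)) (NConst 1)) (V 10))
    (Seq (NAssign 7 (NAdd (V 5) (V 10)) (NAdd (V 10) (NConst 1)))
    (Seq (If (NLess (V 10) (NAdd (V 0) (V 0))) load_event Skip)
      (NAssign 10 (NConst 0) (NAdd (V 10) (NConst 1))))))"

definition load :: com where
  "load = While (NLess (V 10) (V 5)) load_body"

definition wrap_body :: com where
  "wrap_body = (let a = NAdd (V 12) (V 12); b = NAdd (NAdd (V 12) (V 12)) (NConst 1);
      act = NAssign 8 (NAdd (V 5) (V 12)) (NAdd (V 12) (NConst 1)) in
    Seq (If (RLess (RConst 0) (crossE a b)) (If (RLess (Ke b) (Ke a)) act Skip)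
        (If (RLess (crossE a b) (RConst 0)) (If (RLess (Ke a) (Ke b)) act Skip) Skip))
      (NAssign 12 (NConst 0) (NAdd (V 12) (NConst 1))))"

definition wraps :: com where
  "wraps = While (NLess (V 12) (V 0)) wrap_body"

definition build_body :: com where
  "build_body = Seq (NAssign 11 (NConst 0) (NSub (V 11) (NConst 1))) (Seq (node 7 keyE) (node 8
      hitE))"

text \<open>Nodes are visited in decreasing order, so both children are final before a match is
  played. This takes linear time for the two trees together.\<close>

definition build :: com where
  "build = Seq (NAssign 11 (NConst 0) (V 5)) (While (NLess (NConst 1) (V 11)) build_body)"

lemma gval_keyE: "gval keyE s x = rmem s 5 (x - 1)"
  by (simp add: gval_def keyE_def)

lemma gval_hitE: "gval hitE s x = hit (Complex (rmem s 3 (2 * (x - 1))) (rmem s 4 (2 * (x - 1))))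
    (Complex (rmem s 3 (2 * (x - 1) + 1)) (rmem s 4 (2 * (x - 1) + 1))) (Complex (rmem s 8 0) (rmem
        s 9 0))"
  by (simp add: gval_def hitE_def crossE_def hit_def cross_def mult_2 Let_def)

lemma indep_keyE: "indep 7 keyE"
  by (simp add: indep_def keyE_def frame_def)

lemma indep_hitE: "indep 8 hitE"
  by (simp add: indep_def hitE_def crossE_def frame_def Let_def)

lemma nth_concat4:
  assumes "q < length xs" "\<And>x. length (h x) = 4" "j < 4"
  shows "concat (map h xs) ! (4 * q + j) = h (xs ! q) ! j" "4 * q + j < length (concat (map h xs))"
  using assms(1)
proof (induction xs arbitrary: q)
  case (Cons x xs)
  { case 1 then show ?case using Cons.IH(1) [of "q - 1"] assms(2,3)
      by (cases q) (auto simp: nth_append) }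
  { case 2 then show ?case using Cons.IH(2) [of "q - 1"] assms(2,3) by (cases q) auto }
qed simp_all

context obst
begin

definition N :: nat where "N = 2 * n + 2"

text \<open>The artificial event \<open>2 * n + 1\<close> guarantees that there are at least two directions.\<close>

definition KK :: "nat \<Rightarrow> real" where
  "KK e = (if e = 2 * n + 1 then 2 else key (Z e))"

lemma KK_bounds: "0 \<le> KK e" "KK e < 4"
  using key_bounds by (simp_all add: KK_def)

lemma KK_event: "e < 2 * n \<Longrightarrow> KK e = key (Z e)"
  by (simp add: KK_def)

lemma input_coords:
  assumes "e < 2 * n"
  shows "rmem (input_state p r cs) 0 (3 + 2 * e) - Re p = Re (Z e)"
    "rmem (input_state p r cs) 0 (4 + 2 * e) - Im p = Im (Z e)"
proof -
  define h where "h = (\<lambda>(a, b). [Re a, Im a, Re b, Im b])"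
  define q where "q = e div 2"
  have q: "q < n" using assms by (simp add: q_def)
  have h4: "length (h x) = 4" for x by (cases x) (simp add: h_def)
  have dat: "rmem (input_state p r cs) 0 (3 + (4 * q + j)) = h (cs ! q) ! j" if "j < 4" for j
    using nth_concat4 [of q cs h j, OF q h4 that]
    by (simp add: input_state_def input_data_def h_def [symmetric] nth_append)
  obtain a b where ab: "cs ! q = (a, b)" by (cases "cs ! q")
  define j :: nat where "j = (if even e then 0 else 2)"
  have ix: "3 + 2 * e = 3 + (4 * q + j)" "4 + 2 * e = 3 + (4 * q + (j + 1))"
    by (auto simp: q_def j_def elim!: evenE oddE)
  have "h (cs ! q) ! j = Re (Z e + p)" "h (cs ! q) ! (j + 1) = Im (Z e + p)"
    using assms by (auto simp: h_def ab j_def Z_def q_def [symmetric])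
  moreover have "j < 4" "j + 1 < 4" by (auto simp: j_def)
  ultimately show "rmem (input_state p r cs) 0 (3 + 2 * e) - Re p = Re (Z e)"
    "rmem (input_state p r cs) 0 (4 + 2 * e) - Im p = Im (Z e)"
    unfolding ix by (simp_all only: dat) simp_all
qed

lemma input_params:
  "rmem (input_state p r cs) 0 0 = Re p" "rmem (input_state p r cs) 0 (Suc 0) = Im p"
  "rmem (input_state p r cs) 0 2 = r" "nmem (input_state p r cs) 0 0 = n"
  by (simp_all add: input_state_def input_data_def eval_nat_numeral)

definition env :: "state \<Rightarrow> bool" where
  "env s \<longleftrightarrow> nmem s 0 0 = n \<and> nmem s 5 0 = N \<and> (\<forall>j<2 * N. nmem s 6 j = j div 2) \<and>
     (\<forall>e<N. rmem s 3 e = Re (Z e) \<and> rmem s 4 e = Im (Z e) \<and> rmem s 5 e = KK e) \<and>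
     rmem s 0 0 = Re p \<and> rmem s 0 (Suc 0) = Im p \<and> rmem s 0 2 = r"

lemma env_frame:
  assumes "frame A B s s'" "env s" "A \<inter> {0, 5, 6} = {}" "B \<inter> {0, 3, 4, 5} = {}"
  shows "env s'"
proof -
  have "\<And>b. b \<in> {0, 5, 6} \<Longrightarrow> nmem s' b = nmem s b" "\<And>b. b \<in> {0, 3, 4, 5} \<Longrightarrow> rmem s' b = rmem s b"
    using assms by (auto simp: frame_def)
  then show ?thesis using assms(2) by (simp add: env_def)
qed

definition load_inv :: "state \<Rightarrow> bool" where
  "load_inv s \<longleftrightarrow> nmem s 10 0 \<le> N \<and> nmem s 0 0 = n \<and> nmem s 5 0 = N \<and>
     (\<forall>j<2 * nmem s 10 0. nmem s 6 j = j div 2) \<and>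
     (\<forall>e<nmem s 10 0. nmem s 7 (N + e) = e + 1) \<and>
     (\<forall>e. rmem s 3 e = (if e < nmem s 10 0 then Re (Z e) else 0) \<and>
       rmem s 4 e = (if e < nmem s 10 0 then Im (Z e) else 0) \<and>
       rmem s 5 e = (if e < nmem s 10 0 \<or> e = 2 * n + 1 then KK e else 0)) \<and>
     rmem s 0 = rmem (input_state p r cs) 0"

lemma norm_Z: "sqrt (Re (Z e) * Re (Z e) + Im (Z e) * Im (Z e)) = norm (Z e)"
  by (simp add: cmod_def power2_eq_square)

lemma wp_load_body:
  assumes inv: "load_inv s" and lt: "nmem s 10 0 < N"
  shows "wp load_body (\<lambda>s'. load_inv s' \<and> N - nmem s' 10 0 < N - nmem s 10 0) s"
proof -
  define i where "i = nmem s 10 0"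
  have i: "i < N" using lt by (simp add: i_def)
  note inv' = inv [unfolded load_inv_def, folded i_def]
  have R0: "rmem s 0 = rmem (input_state p r cs) 0" using inv by (simp add: load_inv_def)
  define s1 where "s1 = nwrite 7 (N + i) (i + 1) (nwrite 6 (i + i + 1) i (nwrite 6 (i + i) i s))"
  have n1: "nmem s1 0 0 = n" "nmem s1 5 0 = N" "nmem s1 10 0 = i"
    "\<forall>j<2 * (i + 1). nmem s1 6 j = j div 2" "\<forall>e<i + 1. nmem s1 7 (N + e) = e + 1"
    using inv' by (auto simp: s1_def i_def less_Suc_eq)
  have r1: "rmem s1 = rmem s" by (simp add: s1_def)
  have fin: "load_inv (nwrite 10 0 (i + 1) s2)"
    if "nmem s2 = nmem s1" "rmem s2 0 = rmem s 0" "rmem s2 3 = (rmem s 3)(i := Re (Z i))"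
      "rmem s2 4 = (rmem s 4)(i := Im (Z i))" "rmem s2 5 = (rmem s 5)(i := KK i)" for s2
    using that n1 inv' i unfolding load_inv_def by (simp add: less_Suc_eq)
  have "wp (If (NLess (V 10) (NAdd (V 0) (V 0))) load_event Skip)
    (\<lambda>s2. nmem s2 = nmem s1 \<and> rmem s2 0 = rmem s 0 \<and> rmem s2 3 = (rmem s 3)(i := Re (Z i)) \<and>
      rmem s2 4 = (rmem s 4)(i := Im (Z i)) \<and> rmem s2 5 = (rmem s 5)(i := KK i)) s1"
  proof (cases "i < 2 * n")
    case True
    have c: "rmem s 0 (2 * i + 3) = Re (Z i) + Re p" "rmem s 0 (2 * i + 4) = Im (Z i) + Im p"
      "rmem s 0 0 = Re p" "rmem s 0 (Suc 0) = Im p"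
      unfolding R0 input_params using input_coords [OF True] by (simp_all add: add.commute)
    have k0: "rmem s 5 i = 0" using inv True by (simp add: load_inv_def i_def)
    have lt: "i < n + n" using True by simp
    have up: "(rmem s 5)(i := 0) = rmem s 5" by (rule ext) (simp add: k0)
    have kk: "KK i = (if 0 < norm (Z i) then if Im (Z i) < 0 then 3 + Re (Z i) / norm (Z i)
        else 1 - Re (Z i) / norm (Z i) else 0)" using True by (auto simp: KK_def key_def)
    show ?thesis
      by (simp add: load_event_def r1 n1(1-3) lt c norm_Z kk up)
  next
    case False
    then have z: "Z i = 0" by (simp add: Z_def)
    have nl: "\<not> i < n + n" using False by simp
    have 0: "rmem s 3 i = 0" "rmem s 4 i = 0" "rmem s 5 i = KK i"
      using inv z by (auto simp: load_inv_def i_def KK_def key_def)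
    then have "(rmem s 3)(i := 0) = rmem s 3" "(rmem s 4)(i := 0) = rmem s 4"
        "(rmem s 5)(i := KK i) = rmem s 5"
      by (auto simp: fun_eq_iff)
    then show ?thesis by (simp add: r1 n1(1-3) nl z)
  qed
  then have "wp (If (NLess (V 10) (NAdd (V 0) (V 0))) load_event Skip)
    (wp (NAssign 10 (NConst 0) (NAdd (V 10) (NConst 1)))
      (\<lambda>s'. load_inv s' \<and> N - nmem s' 10 0 < N - nmem s 10 0)) s1"
    by (rule wp_mono) (use fin n1 i in \<open>simp add: i_def [symmetric]\<close>)
  then show ?thesis using inv' i unfolding load_body_def by (simp add: s1_def i_def)
qed

lemma runs_load:
  assumes "load_inv s"
  shows "runs load s (Suc N * (10 + cmax load_body)) (\<lambda>s'. env s' \<and>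
      (\<forall>e<N. nmem s' 7 (N + e) = e + 1) \<and>
    frame {6, 7, 10} {3, 4, 5, 11} s s')"
proof -
  have "runs (While (NLess (V 10) (V 5)) load_body) s
    (Suc (N - nmem s 10 0) * (1 + bcost (NLess (V 10) (V 5)) + cmax load_body))
    (\<lambda>s'. load_inv s' \<and> \<not> bval (NLess (V 10) (V 5)) s')"
    using assms wp_load_body by (intro runs_While runs_wp) (auto simp: load_inv_def)
  from runs_frame [OF this] show ?thesis
    unfolding load_def
  proof (rule runs_mono)
    show "Suc (N - nmem s 10 0) * (1 + bcost (NLess (V 10) (V 5)) + cmax load_body) \<le>
      Suc N * (10 + cmax load_body)" by (intro mult_le_mono) simp_all
    fix s' assume *: "(load_inv s' \<and> \<not> bval (NLess (V 10) (V 5)) s') \<and>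
      frame (nbanks (While (NLess (V 10) (V 5)) load_body)) (rbanks (While (NLess (V 10) (V 5))
          load_body)) s s'"
    have "nbanks load_body = {6, 7, 10}" "rbanks load_body = {3, 4, 5, 11}"
      by (auto simp: load_body_def load_event_def)
    then have fr: "frame {6, 7, 10} {3, 4, 5, 11} s s'" using * by simp
    have inv: "load_inv s'" and "nmem s' 10 0 = N" using * by (auto simp: load_inv_def)
    then have "env s'" "\<forall>e<N. nmem s' 7 (N + e) = e + 1"
      using input_params unfolding load_inv_def env_def by simp_all
    then show "env s' \<and> (\<forall>e<N. nmem s' 7 (N + e) = e + 1) \<and> frame {6, 7, 10} {3, 4, 5, 11} s s'"
      using fr by blast
  qed
qed

text \<open>The cone passes the seam when traversed counterclockwise. An obstacle whose last
  endpoint has direction 0 counts as well; its end event has key 0 and retires it while the first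
  ray is processed.\<close>

definition wrapping :: "nat \<Rightarrow> bool" where
  "wrapping q \<longleftrightarrow> nondeg q \<and> key (ept q) < key (spt q)"

definition wrap_inv :: "state \<Rightarrow> state \<Rightarrow> bool" where
  "wrap_inv s0 s \<longleftrightarrow> env s \<and> frame {8, 12} {} s0 s \<and> nmem s 12 0 \<le> n \<and>
     (\<forall>q. nmem s 8 (N + q) = (if q < nmem s 12 0 \<and> wrapping q then q + 1 else 0))"

lemma cr_rmem: "env s \<Longrightarrow> q < n \<Longrightarrow>
  rmem s 3 (2 * q) * rmem s 4 (2 * q + 1) - rmem s 4 (2 * q) * rmem s 3 (2 * q + 1) = cr (2 * q)"
  by (simp add: env_def N_def cr_def cross_def mate_def)

lemma wp_wrap_body:
  assumes inv: "wrap_inv s0 s" and lt: "nmem s 12 0 < n"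
  shows "wp wrap_body (\<lambda>s'. wrap_inv s0 s' \<and> n - nmem s' 12 0 < n - nmem s 12 0) s"
proof -
  define q where "q = nmem s 12 0"
  have q: "q < n" using lt by (simp add: q_def)
  have env: "env s" using inv by (simp add: wrap_inv_def)
  have N: "nmem s 5 0 = N" using env by (simp add: env_def)
  have keys: "rmem s 5 (q + q) = key (Z (2 * q))" "rmem s 5 (q + q + 1) = key (Z (2 * q + 1))"
    using env q by (simp_all add: env_def N_def KK_def mult_2)
  have cr: "rmem s 3 (q + q) * rmem s 4 (Suc (q + q)) - rmem s 4 (q + q) * rmem s 3 (Suc (q + q)) =
      cr (2 * q)"
    using cr_rmem [OF env q] by (simp add: mult_2)
  define s1 where "s1 = (if wrapping q then nwrite 8 (N + q) (q + 1) s else s)"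
  have fin: "wrap_inv s0 (nwrite 12 0 (q + 1) s1)"
    unfolding wrap_inv_def
  proof (intro conjI allI)
    have "frame {8, 12} {} s (nwrite 12 0 (q + 1) s1)" by (auto simp: frame_def s1_def)
    then show "env (nwrite 12 0 (q + 1) s1)" by (rule env_frame [OF _ env]) auto
    show "frame {8, 12} {} s0 (nwrite 12 0 (q + 1) s1)" using inv
        by (auto simp: frame_def wrap_inv_def s1_def)
    show "nmem (nwrite 12 0 (q + 1) s1) 12 0 \<le> n" using q by simp
    fix u
    show "nmem (nwrite 12 0 (q + 1) s1) 8 (N + u) =
      (if u < nmem (nwrite 12 0 (q + 1) s1) 12 0 \<and> wrapping u then u + 1 else 0)"
      using inv by (auto simp: wrap_inv_def s1_def q_def less_Suc_eq)
  qed
  have w: "wrapping q \<longleftrightarrow> (if 0 < cr (2 * q) then key (Z (2 * q + 1)) < key (Z (2 * q))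
      else cr (2 * q) < 0 \<and> key (Z (2 * q)) < key (Z (2 * q + 1)))"
    using q by (auto simp: wrapping_def nondeg_def spt_def ept_def)
  have "nwrite 12 0 (q + 1) s1 = (if wrapping q then nwrite 12 0 (q + 1) (nwrite 8 (N + q) (q + 1)
      s) else nwrite 12 0 (q + 1) s)"
    by (simp add: s1_def)
  then have fin': "wrapping q \<Longrightarrow> wrap_inv s0 (nwrite 12 0 (Suc q) (nwrite 8 (N + q) (Suc q) s))"
    "\<not> wrapping q \<Longrightarrow> wrap_inv s0 (nwrite 12 0 (Suc q) s)" using fin by auto
  show ?thesis
    using fin' w keys cr N diff_less_mono2 [of q "Suc q" n] q
    by (simp add: wrap_body_def Let_def crossE_def q_def [symmetric])
qed

lemma runs_wraps:
  assumes "env s" "nmem s 12 0 = 0" "\<forall>u. nmem s 8 u = 0"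
  shows "runs wraps s (Suc n * (10 + cmax wrap_body))
    (\<lambda>s'. (\<forall>q. nmem s' 8 (N + q) = (if wrapping q then q + 1 else 0)) \<and> frame {8, 12} {} s s')"
proof -
  have "wrap_inv s s" using assms by (simp add: wrap_inv_def frame_def)
  moreover have "bval (NLess (V 12) (V 0)) s' \<longleftrightarrow> nmem s' 12 0 < n" if "wrap_inv s s'" for s'
    using that by (simp add: wrap_inv_def env_def)
  ultimately have "runs (While (NLess (V 12) (V 0)) wrap_body) s
    (Suc (n - nmem s 12 0) * (1 + bcost (NLess (V 12) (V 0)) + cmax wrap_body))
    (\<lambda>s'. wrap_inv s s' \<and> \<not> bval (NLess (V 12) (V 0)) s')"
    using wp_wrap_body by (intro runs_While runs_wp) auto
  then show ?thesis
    unfolding wraps_def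
  proof (rule runs_mono)
    show "Suc (n - nmem s 12 0) * (1 + bcost (NLess (V 12) (V 0)) + cmax wrap_body) \<le>
      Suc n * (10 + cmax wrap_body)" by (intro mult_le_mono) simp_all
    fix s' assume *: "wrap_inv s s' \<and> \<not> bval (NLess (V 12) (V 0)) s'"
    then have "nmem s' 12 0 = n" by (auto simp: wrap_inv_def env_def)
    then show "(\<forall>q. nmem s' 8 (N + q) = (if wrapping q then q + 1 else 0)) \<and> frame {8, 12} {} s s'"
      using * by (auto simp: wrap_inv_def wrapping_def nondeg_def)
  qed
qed

definition build_inv :: "state \<Rightarrow> state \<Rightarrow> bool" where
  "build_inv s0 s \<longleftrightarrow> frame {7, 8, 11} {} s0 s \<and> 1 \<le> nmem s 11 0 \<and> nmem s 11 0 \<le> N \<and>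
     (\<forall>u\<ge>N. nmem s 7 u = nmem s0 7 u \<and> nmem s 8 u = nmem s0 8 u) \<and>
     (\<forall>u. nmem s 11 0 \<le> u \<and> u < N \<longrightarrow>
       nmem s 7 u = winner (gval keyE s0) (nmem s 7 (2 * u)) (nmem s 7 (2 * u + 1)) \<and>
       nmem s 8 u = winner (gval hitE s0) (nmem s 8 (2 * u)) (nmem s 8 (2 * u + 1)))"

lemma wp_build_body:
  assumes inv: "build_inv s0 s" and gt: "1 < nmem s 11 0"
  shows "wp build_body (\<lambda>s'. build_inv s0 s' \<and> nmem s' 11 0 < nmem s 11 0) s"
proof -
  define v where "v = nmem s 11 0 - 1"
  have v: "1 \<le> v" "v < N" "nmem s 11 0 = Suc v" using inv gt by (auto simp: v_def build_inv_def)
  define x where "x = winner (gval keyE s0) (nmem s 7 (2 * v)) (nmem s 7 (2 * v + 1))"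
  define y where "y = winner (gval hitE s0) (nmem s 8 (2 * v)) (nmem s 8 (2 * v + 1))"
  define s1 where "s1 = nwrite 11 0 v s"
  define s2 where "s2 = nwrite 7 v x s1"
  have fr: "frame {7, 8, 11} {} s0 s1" "frame {7, 8, 11} {} s0 s2"
    using inv by (auto simp: build_inv_def frame_def s1_def s2_def)
  then have g: "gval keyE s1 = gval keyE s0" "gval hitE s2 = gval hitE s0"
    by (auto simp: fun_eq_iff gval_keyE gval_hitE frame_def)
  have "build_inv s0 (nwrite 8 v y s2)"
    unfolding build_inv_def
  proof (intro conjI allI impI)
    show "frame {7, 8, 11} {} s0 (nwrite 8 v y s2)" using fr by (auto simp: frame_def)
  qed (use inv v in \<open>auto simp: build_inv_def s1_def s2_def x_def y_def Suc_le_eq less_Suc_eq\<close>)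
  then show ?thesis using v g unfolding build_body_def
    by (simp add: wp_node [OF indep_keyE] wp_node [OF indep_hitE] s1_def [symmetric])
      (simp add: s1_def s2_def x_def y_def)
qed

lemma runs_build:
  assumes "nmem s 5 0 = N"
  shows "runs build s (Suc N * (20 + cmax build_body))
    (\<lambda>s'. tourn (gval keyE s) N (nmem s' 7) \<and> tourn (gval hitE s) N (nmem s' 8) \<and>
      (\<forall>u\<ge>N. nmem s' 7 u = nmem s 7 u \<and> nmem s' 8 u = nmem s 8 u) \<and> frame {7, 8, 11} {} s s')"
proof -
  let ?a = "NAssign 11 (NConst 0) (V 5)"
  let ?b = "NLess (NConst 1) (V 11)"
  have "runs build s (cmax ?a + Suc N * (1 + bcost ?b + cmax build_body)) (\<lambda>s'. build_inv s s' \<and>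
      \<not> bval ?b s')"
    unfolding build_def
  proof (rule runs_Seq)
    show "runs ?a s (cmax ?a) (\<lambda>s'. build_inv s s' \<and> nmem s' 11 0 = N)"
      by (rule runs_wp) (use assms in \<open>auto simp: build_inv_def frame_def N_def\<close>)
    fix s' assume s': "build_inv s s' \<and> nmem s' 11 0 = N"
    then have "runs (While ?b build_body) s' (Suc (nmem s' 11 0) * (1 + bcost ?b + cmax build_body))
        (\<lambda>s'. build_inv s s' \<and> \<not> bval ?b s')"
      using wp_build_body by (intro runs_While runs_wp) auto
    then show "runs (While ?b build_body) s' (Suc N * (1 + bcost ?b + cmax build_body))
        (\<lambda>s'. build_inv s s' \<and> \<not> bval ?b s')" using s' by simp
  qed
  then show ?thesis
  proof (rule runs_mono)
    show "cmax ?a + Suc N * (1 + bcost ?b + cmax build_body) \<le> Suc N * (20 + cmax build_body)"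
      by (simp add: algebra_simps)
    fix s' assume *: "build_inv s s' \<and> \<not> bval ?b s'"
    then have "nmem s' 11 0 = 1" by (auto simp: build_inv_def)
    then show "tourn (gval keyE s) N (nmem s' 7) \<and> tourn (gval hitE s) N (nmem s' 8) \<and>
      (\<forall>u\<ge>N. nmem s' 7 u = nmem s 7 u \<and> nmem s' 8 u = nmem s 8 u) \<and> frame {7, 8, 11} {} s s'"
      using * by (auto simp: build_inv_def tourn_def)
  qed
qed

end

section \<open>The rotating ray\<close>

definition pop_event :: com where
  "pop_event = Seq (NAssign 13 (NConst 0) (NSub (NRead 7 (NConst 1)) (NConst 1)))
    (Seq (NAssign 7 (NAdd (V 5) (V 13)) (NConst 0)) (NAssign 11 (NConst 0) (NAdd (V 5) (V 13))))"

definition direction :: com where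
  "direction = If (RLess (RConst 2) (W 10))
    (Seq (RAssign 8 (NConst 0) (RSub (W 10) (RConst 3)))
      (RAssign 9 (NConst 0) (RSub (RConst 0) (RSqrt (RSub (RConst 1) (RMul (W 8) (W 8)))))))
    (Seq (RAssign 8 (NConst 0) (RSub (RConst 1) (W 10)))
      (RAssign 9 (NConst 0) (RSqrt (RSub (RConst 1) (RMul (W 8) (W 8))))))"

definition advance :: com where
  "advance = If (RLess (RRead 6 (V 15)) (Ke (V 13)))
    (Seq (NAssign 15 (NConst 0) (NAdd (V 15) (NConst 1)))
    (Seq (RAssign 6 (V 15) (Ke (V 13)))
    (Seq (RAssign 7 (V 15) (RRead 0 (NConst 2)))
    (Seq (RAssign 10 (NConst 0) (Ke (V 13))) direction)))) Skip"

text \<open>Comparing \<open>e\<close> with twice its entry in the table of halves is a test of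
  parity, which selects the other endpoint.\<close>

definition locate :: com where
  "locate = Seq (If (NLess (NAdd (NRead 6 (V 13)) (NRead 6 (V 13))) (V 13))
      (NAssign 14 (NConst 0) (NSub (V 13) (NConst 1))) (NAssign 14 (NConst 0) (NAdd (V 13) (NConst
          1))))
    (Seq (RAssign 12 (NConst 0) (crossE (V 13) (V 14)))
    (Seq (RAssign 13 (NConst 0) (RAdd (RMul (Xe (V 13)) (Xe (V 14))) (RMul (Ye (V 13)) (Ye (V
        14)))))
      (RAssign 11 (NConst 0) (RSqrt (RAdd (RMul (Xe (V 13)) (Xe (V 13))) (RMul (Ye (V 13)) (Ye (V
          13))))))))"

definition update_pt :: com where
  "update_pt = If (RLess (RConst 0) (W 11))
    (Seq (If (BAnd (BNot (RLess (RConst 0) (W 12))) (BAnd (BNot (RLess (W 12) (RConst 0)))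
        (BNot (RLess (RConst 0) (W 13))))) (RAssign 11 (NConst 0) (RConst 0)) Skip)
      (If (RLess (W 11) (RRead 7 (V 15))) (RAssign 7 (V 15) (W 11)) Skip)) Skip"

text \<open>The sign of \<open>cr e\<close> tells the endpoints of an obstacle apart: it is positive
  at the counterclockwise first one and negative at the other. It is 0 for degenerate obstacles and
  artificial events, which leave the leaves unchanged.\<close>

definition update_leaf :: com where
  "update_leaf = Seq (If (RLess (RConst 0) (W 12))
      (NAssign 8 (NAdd (V 5) (NRead 6 (V 13))) (NAdd (NRead 6 (V 13)) (NConst 1)))
      (If (RLess (W 12) (RConst 0)) (NAssign 8 (NAdd (V 5) (NRead 6 (V 13))) (NConst 0)) Skip))
    (NAssign 11 (NConst 0) (NAdd (V 5) (NRead 6 (V 13))))"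

definition sweep_body :: com where
  "sweep_body = Seq pop_event (Seq (path 7 keyE) (Seq advance (Seq locate (Seq update_pt
    (Seq update_leaf (Seq (path 8 hitE) (NAssign 9 (V 15) (NRead 8 (NConst 1)))))))))"

definition sweep :: com where
  "sweep = While (NLess (NConst 0) (NRead 7 (NConst 1))) sweep_body"

lemma wp_direction:
  "wp direction Q s \<longleftrightarrow>
    Q (rwrite 9 0 (Im (kdir (rmem s 10 0))) (rwrite 8 0 (Re (kdir (rmem s 10 0))) s))"
  by (auto simp: direction_def kdir_def)

definition main_cost :: "nat \<Rightarrow> nat" where
  "main_cost L = cmax pop_event + Suc L * (20 + cmax (node 7 keyE)) + cmax advance + cmax locate +
     cmax update_pt + cmax update_leaf + Suc L * (20 + cmax (node 8 hitE)) +
     cmax (NAssign 9 (V 15) (NRead 8 (NConst 1)))"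

context obst
begin

definition start_event :: "nat \<Rightarrow> nat" where
  "start_event q = (if 0 < cr (2 * q) then 2 * q else 2 * q + 1)"

definition end_event :: "nat \<Rightarrow> nat" where
  "end_event q = (if 0 < cr (2 * q) then 2 * q + 1 else 2 * q)"

text \<open>The obstacles whose sectors contain the current ray after the events in \<open>X\<close> have been
  processed. An obstacle that crosses the ray of angle \<open>0\<close> is active from the beginning.\<close>

definition act :: "nat set \<Rightarrow> nat \<Rightarrow> bool" where
  "act X q \<longleftrightarrow> nondeg q \<and> (if key (spt q) < key (ept q) then start_event q \<in> X \<and> end_event q \<notin> X
     else start_event q \<in> X \<or> end_event q \<notin> X)"

lemma Z_start_event: "Z (start_event q) = spt q" and Z_end_event: "Z (end_event q) = ept q"
  by (simp_all add: start_event_def end_event_def spt_def ept_def)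

lemma event_bound: "nondeg q \<Longrightarrow> start_event q < 2 * n" "nondeg q \<Longrightarrow> end_event q < 2 * n"
  by (simp_all add: start_event_def end_event_def nondeg_def)

lemma KK_start: "nondeg q \<Longrightarrow> KK (start_event q) = key (spt q)"
  and KK_end: "nondeg q \<Longrightarrow> KK (end_event q) = key (ept q)"
  using event_bound by (simp_all add: KK_event Z_start_event Z_end_event)

lemma key_spt_neq: "nondeg q \<Longrightarrow> key (spt q) \<noteq> key (ept q)"
  using Arg2pi_gap [OF cross_spt_ept, of q] kang_key [of "spt q"] kang_key [of "ept q"] by auto

lemma act_empty: "act {} q \<longleftrightarrow> wrapping q"
  using key_spt_neq [of q] by (auto simp: act_def wrapping_def)

lemma act_cover:
  assumes "\<And>e. e < N \<Longrightarrow> e \<in> X \<longleftrightarrow> KK e \<le> \<kappa>" "0 \<le> \<kappa>" "\<kappa> \<le> 4"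
  shows "act X q \<longleftrightarrow> cover (kang \<kappa>) q"
proof (cases "nondeg q")
  case True
  have a: "start_event q \<in> X \<longleftrightarrow> Arg2pi (spt q) \<le> kang \<kappa>"
    using assms(1) [of "start_event q"] event_bound [OF True] KK_start [OF True]
      kang_le_iff [of "key (spt q)" \<kappa>] key_bounds [of "spt q"] assms(2,3)
    by (simp add: N_def kang_key)
  have b: "end_event q \<notin> X \<longleftrightarrow> kang \<kappa> < Arg2pi (ept q)"
    using assms(1) [of "end_event q"] event_bound [OF True] KK_end [OF True]
      kang_less_iff [of \<kappa> "key (ept q)"] key_bounds [of "ept q"] assms(2,3)
    by (simp add: N_def kang_key not_le)
  show ?thesis using True a b by (simp add: act_def cover_def in_half_cone_def key_less_iff)
qed (simp add: act_def cover_def)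

text \<open>Start events in \<open>X\<close> have an angle of at most \<open>\<theta>\<close>, end
  events outside \<open>X\<close> one of at least \<open>\<theta>\<close>, which pins the ray into
  the closed cone. With the current key for \<open>a\<close> and the next one for \<open>b\<close>,
  this is the range over which \<open>H_less_const\<close> preserves the order in the tree.\<close>

lemma act_in_cone:
  assumes "act X q" "\<And>e. e \<in> X \<Longrightarrow> KK e \<le> a" "\<And>e. e < N \<Longrightarrow> e \<notin> X \<Longrightarrow> b \<le> KK e"
    "0 \<le> a" "a \<le> 4" "0 \<le> b" "b \<le> 4" "kang a \<le> \<theta>" "\<theta> \<le> kang b"
  shows "in_cone (spt q) (ept q) \<theta>"
proof -
  have nd: "nondeg q" using assms(1) by (simp add: act_def)
  have a: "Arg2pi (spt q) \<le> \<theta>" if "start_event q \<in> X"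
    using assms(2) [OF that] KK_start [OF nd] kang_le_iff [of "key (spt q)" a] key_bounds [of
        "spt q"]
      assms(4,5,8) by (simp add: kang_key)
  have b: "\<theta> \<le> Arg2pi (ept q)" if "end_event q \<notin> X"
    using assms(3) [OF _ that] KK_end [OF nd] kang_le_iff [of b "key (ept q)"] key_bounds [of
        "ept q"]
      event_bound [OF nd] assms(6,7,9) by (simp add: kang_key N_def)
  show ?thesis using assms(1) a b by (auto simp: act_def in_cone_def key_less_iff split: if_splits)
qed

text \<open>\<open>D\<close> lists the distinct keys of the rays met so far, the last one being
  current. Tying every \<open>D k\<close> to an event bounds the number of rays by that of the
  events, see \<open>m_less_N\<close>.\<close>

definition inv_dirs :: "nat set \<Rightarrow> nat \<Rightarrow> (nat \<Rightarrow> real) \<Rightarrow> bool" where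
  "inv_dirs X m D \<longleftrightarrow> D 0 = 0 \<and> (\<forall>i j. i < j \<and> j \<le> m \<longrightarrow> D i < D j) \<and> (\<forall>k\<le>m. \<exists>e<N. D k = KK e) \<and>
     (\<forall>e\<in>X. \<exists>k\<le>m. D k = KK e) \<and> (\<forall>e<N. e \<notin> X \<longrightarrow> D m \<le> KK e)"

definition inv_pts :: "nat set \<Rightarrow> nat \<Rightarrow> (nat \<Rightarrow> real) \<Rightarrow> (nat \<Rightarrow> real) \<Rightarrow> bool" where
  "inv_pts X m D pt \<longleftrightarrow> (\<forall>k\<le>m. pt k \<le> r \<and> (\<forall>e\<in>X. Z e \<noteq> 0 \<and> KK e = D k \<longrightarrow> pt k \<le> reach e) \<and>
     (pt k = r \<or> (\<exists>e\<in>X. Z e \<noteq> 0 \<and> KK e = D k \<and> pt k = reach e)))"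

definition nearest :: "real \<Rightarrow> nat \<Rightarrow> bool" where
  "nearest \<kappa> c \<longleftrightarrow> (c = 0 \<longrightarrow> (\<forall>q. \<not> cover (kang \<kappa>) q)) \<and>
     (\<forall>q. c = Suc q \<longrightarrow> cover (kang \<kappa>) q \<and> (\<forall>q'. cover (kang \<kappa>) q' \<longrightarrow> H q (kang \<kappa>) \<le> H q' (kang \<kappa>)))"

definition leaves :: "nat set \<Rightarrow> (nat \<Rightarrow> nat) \<Rightarrow> bool" where
  "leaves X T \<longleftrightarrow> (\<forall>q<N. T (N + q) = (if act X q then q + 1 else 0))"

definition events :: "nat set \<Rightarrow> (nat \<Rightarrow> nat) \<Rightarrow> bool" where
  "events X T \<longleftrightarrow> X \<subseteq> {..<N} \<and> (\<forall>e<N. T (N + e) = (if e \<in> X then 0 else e + 1))"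

definition faces :: "state \<Rightarrow> real \<Rightarrow> bool" where
  "faces s \<kappa> \<longleftrightarrow> rmem s 8 0 = Re (kdir \<kappa>) \<and> rmem s 9 0 = Im (kdir \<kappa>)"

text \<open>For the current ray, only the agreement of its entry in bank 9 with the root is kept.
  That the root is the nearest obstacle holds once the last event of the ray is processed, which
  becomes known when the ray turns; so \<open>nearest\<close> is asserted for earlier rays.\<close>

definition sweep_inv :: "nat set \<Rightarrow> state \<Rightarrow> bool" where
  "sweep_inv X s \<longleftrightarrow> env s \<and> events X (nmem s 7) \<and> tourn (gval keyE s) N (nmem s 7) \<and>
     inv_dirs X (nmem s 15 0) (rmem s 6) \<and> faces s (rmem s 6 (nmem s 15 0)) \<and>
     inv_pts X (nmem s 15 0) (rmem s 6) (rmem s 7) \<and>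
     leaves X (nmem s 8) \<and> tourn (gval hitE s) N (nmem s 8) \<and>
     (\<forall>k<nmem s 15 0. nearest (rmem s 6 k) (nmem s 9 k)) \<and>
     (X \<noteq> {} \<longrightarrow> nmem s 9 (nmem s 15 0) = nmem s 8 1)"

lemma inv_dirs_bounds: "inv_dirs X m D \<Longrightarrow> k \<le> m \<Longrightarrow> 0 \<le> D k \<and> D k < 4"
  unfolding inv_dirs_def using KK_bounds by metis

lemma inv_dirs_le: "inv_dirs X m D \<Longrightarrow> e \<in> X \<Longrightarrow> KK e \<le> D m"
  unfolding inv_dirs_def by (metis le_neq_implies_less less_imp_le order_refl)

lemma gval_hitE_H:
  assumes "env s" "faces s \<kappa>" "0 \<le> \<kappa>" "\<kappa> \<le> 4" "q < n"
  shows "gval hitE s (Suc q) = H q (kang \<kappa>)"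
  using assms by (simp add: gval_hitE H_def env_def faces_def N_def cis_kang)

lemma leaf_act:
  assumes "leaves X T" "N \<le> u" "u < 2 * N" "0 < T u"
  obtains q where "T u = Suc q" "act X q" "q < n" "nondeg q"
proof -
  define q where "q = u - N"
  have "u = N + q" "q < N" using assms(2,3) by (auto simp: q_def)
  then have "T u = Suc q" "act X q" using assms(1,4) by (auto simp: leaves_def split: if_splits)
  moreover from this have "q < n" "nondeg q" by (auto simp: act_def nondeg_def)
  ultimately show thesis using that by blast
qed

lemma nearest_root:
  assumes env: "env s" "faces s \<kappa>" "0 \<le> \<kappa>" "\<kappa> < 4" and lv: "leaves X T" and t:
      "tourn (gval hitE s) N T"
    and X: "\<And>e. e < N \<Longrightarrow> e \<in> X \<longleftrightarrow> KK e \<le> \<kappa>"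
  shows "nearest \<kappa> (T 1)"
proof -
  have ac: "act X q \<longleftrightarrow> cover (kang \<kappa>) q" for q using act_cover [OF X] env by simp
  have N: "1 < 2 * N" by (simp add: N_def)
  have best: "0 < T 1 \<and> gval hitE s (T 1) \<le> H q (kang \<kappa>)" if "cover (kang \<kappa>) q" for q
  proof -
    have q: "q < n" using that by (simp add: cover_def nondeg_def)
    have "T (N + q) = Suc q" using lv that ac q by (simp add: leaves_def N_def)
    then show ?thesis using tourn_root_least [OF t, of "N + q"] q gval_hitE_H [OF env(1,2)] env
      by (simp add: N_def)
  qed
  show ?thesis
    unfolding nearest_def
  proof (intro conjI impI allI)
    fix q assume "T 1 = 0"
    then show "\<not> cover (kang \<kappa>) q" using best by force
  next
    fix q assume Suc: "T 1 = Suc q"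
    obtain l where l: "N \<le> l" "l < 2 * N" "T 1 = T l" using tourn_from_leaf [OF t, of 1] N by auto
    obtain q' where q': "T l = Suc q'" "act X q'" "q' < n" using leaf_act [OF lv l(1,2)] l(3) Suc
        by force
    then have "q' = q" using l Suc by simp
    then show "cover (kang \<kappa>) q" using q' ac by simp
    fix q2 assume "cover (kang \<kappa>) q2"
    then show "H q (kang \<kappa>) \<le> H q2 (kang \<kappa>)"
      using best [of q2] Suc gval_hitE_H [OF env(1,2), of q] env q' \<open>q' = q\<close> by simp
  qed
qed

lemma runs_pop_event:
  assumes inv: "sweep_inv X s" and pos: "0 < nmem s 7 1" and L: "2 * N \<le> 2 ^ Suc L"
  shows "runs (Seq pop_event (path 7 keyE)) s (cmax pop_event + Suc L * (20 + cmax (node 7 keyE)))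
    (\<lambda>s'. \<exists>e. e < N \<and> e \<notin> X \<and> (\<forall>e'<N. e' \<notin> X \<longrightarrow> KK e \<le> KK e') \<and> nmem s' 13 0 = e \<and>
      events (insert e X) (nmem s' 7) \<and> tourn (gval keyE s) N (nmem s' 7) \<and>
          frame {7, 11, 13} {} s s')"
proof -
  define e where "e = nmem s 7 1 - 1"
  have env: "env s" and ev: "events X (nmem s 7)" and t: "tourn (gval keyE s) N (nmem s 7)"
    using inv by (auto simp: sweep_inv_def)
  have N: "nmem s 5 0 = N" "\<forall>j<2 * N. nmem s 6 j = j div 2" using env by (auto simp: env_def)
  have gk: "gval keyE s (Suc e') = KK e'" if "e' < N" for e'
    using that env by (simp add: gval_keyE env_def)
  have N2: "2 \<le> N" by (simp add: N_def)
  obtain l where l: "N \<le> l" "l < 2 * N" "nmem s 7 1 = nmem s 7 l"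
      using tourn_from_leaf [OF t, of 1] N2 by auto
  have "nmem s 7 (N + (l - N)) = (if l - N \<in> X then 0 else l - N + 1)" using ev l
    unfolding events_def by (metis add_diff_inverse_nat less_diff_conv2 mult_2 not_less)
  then have le: "l - N = e" "l - N \<notin> X" using l pos by (auto simp: e_def split: if_splits)
  then have e: "e < N" "e \<notin> X" "nmem s 7 1 = Suc e" using l pos by (auto simp: e_def)
  have min: "KK e \<le> KK e'" if "e' < N" "e' \<notin> X" for e'
    using tourn_root_least [OF t, of "N + e'"] ev that gk e by (simp add: events_def)
  define s1 where "s1 = nwrite 11 0 (N + e) (nwrite 7 (N + e) 0 (nwrite 13 0 e s))"
  have fr1: "frame {7, 11, 13} {} s s1" by (auto simp: frame_def s1_def)
  have g1: "gval keyE s1 = gval keyE s" using fr1 by (auto simp: gval_keyE frame_def fun_eq_iff)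
  have v1: "nmem s1 11 0 = N + e" "nmem s1 7 = (nmem s 7)(N + e := 0)" "nmem s1 6 = nmem s 6"
      "nmem s1 13 0 = e"
    by (auto simp: s1_def)
  have "wp pop_event (\<lambda>s'. s' = s1) s" using e N by (simp add: pop_event_def s1_def)
  then have pop: "runs pop_event s (cmax pop_event) (\<lambda>s'. s' = s1)" by (rule runs_wp)
  have "runs (path 7 keyE) s1 (Suc L * (20 + cmax (node 7 keyE)))
    (\<lambda>s'. tourn (gval keyE s1) N (nmem s' 7) \<and> (\<forall>u\<ge>N. nmem s' 7 u = nmem s1 7 u) \<and>
        frame {7, 11} {} s1 s')"
  proof (rule runs_path [OF indep_keyE])
    show "\<forall>u. 1 \<le> u \<and> u < N \<and> u \<noteq> nmem s1 11 0 div 2 \<longrightarrow>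
      nmem s1 7 u = winner (gval keyE s1) (nmem s1 7 (2 * u)) (nmem s1 7 (2 * u + 1))"
    proof (intro allI impI)
      fix u assume u: "1 \<le> u \<and> u < N \<and> u \<noteq> nmem s1 11 0 div 2"
      then have "2 * u \<noteq> N + e" "2 * u + 1 \<noteq> N + e" "u \<noteq> N + e" using v1 by auto
      then show "nmem s1 7 u = winner (gval keyE s1) (nmem s1 7 (2 * u)) (nmem s1 7 (2 * u + 1))"
        using t u unfolding v1 g1 tourn_def by simp
    qed
  qed (use v1 N e N2 L in auto)
  then have "runs (Seq pop_event (path 7 keyE)) s (cmax pop_event + Suc L * (20 + cmax (node 7
      keyE)))
    (\<lambda>s'. tourn (gval keyE s1) N (nmem s' 7) \<and> (\<forall>u\<ge>N. nmem s' 7 u = nmem s1 7 u) \<and>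
        frame {7, 11} {} s1 s')"
    by (intro runs_Seq [OF pop]) simp
  then show ?thesis
  proof (rule runs_mono)
    fix s' assume *: "tourn (gval keyE s1) N (nmem s' 7) \<and> (\<forall>u\<ge>N. nmem s' 7 u = nmem s1 7 u) \<and>
      frame {7, 11} {} s1 s'"
    have "frame {7, 11, 13} {} s s'" using * fr1 by (auto simp: frame_def)
    moreover have "nmem s' 13 0 = e" using * v1 by (simp add: frame_def)
    moreover have "events (insert e X) (nmem s' 7)" using * ev e v1 by (auto simp: events_def)
    ultimately show "\<exists>e. e < N \<and> e \<notin> X \<and> (\<forall>e'<N. e' \<notin> X \<longrightarrow> KK e \<le> KK e') \<and> nmem s' 13 0 = e \<and>
      events (insert e X) (nmem s' 7) \<and> tourn (gval keyE s) N (nmem s' 7) \<and>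
          frame {7, 11, 13} {} s s'"
      using * g1 e min by auto
  qed simp
qed

text \<open>The state after the sweep has turned to the ray of the next event \<open>e\<close>, which has been
  taken out of the event queue but is not yet processed.\<close>

definition mid_inv :: "nat set \<Rightarrow> nat \<Rightarrow> state \<Rightarrow> bool" where
  "mid_inv X e s \<longleftrightarrow> env s \<and> inv_dirs X (nmem s 15 0) (rmem s 6) \<and> faces s (rmem s 6 (nmem s 15 0)) \<and>
     inv_pts X (nmem s 15 0) (rmem s 6) (rmem s 7) \<and>
     leaves X (nmem s 8) \<and> tourn (gval hitE s) N (nmem s 8) \<and>
     (\<forall>k<nmem s 15 0. nearest (rmem s 6 k) (nmem s 9 k)) \<and>
     e < N \<and> e \<notin> X \<and> X \<subseteq> {..<N} \<and> nmem s 13 0 = e \<and> rmem s 6 (nmem s 15 0) = KK e"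

text \<open>If the next event has a larger key, all events of the current ray are done, and
  \<open>nearest_root\<close> interprets the recorded root. The tree remains valid for the new ray
  because the active obstacles keep their order between the two rays.\<close>

lemma wp_advance:
  assumes env: "env s" and dirs: "inv_dirs X (nmem s 15 0) (rmem s 6)"
    and fc: "faces s (rmem s 6 (nmem s 15 0))"
    and pts: "inv_pts X (nmem s 15 0) (rmem s 6) (rmem s 7)"
    and lv: "leaves X (nmem s 8)" and t: "tourn (gval hitE s) N (nmem s 8)"
    and near: "\<forall>k<nmem s 15 0. nearest (rmem s 6 k) (nmem s 9 k)"
    and root: "X \<noteq> {} \<Longrightarrow> nmem s 9 (nmem s 15 0) = nmem s 8 1"
    and e: "e < N" "e \<notin> X" "X \<subseteq> {..<N}" "nmem s 13 0 = e" and min: "\<forall>e'<N. e' \<notin> X \<longrightarrow> KK e \<le> KK e'"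
  shows "wp advance (\<lambda>s'. mid_inv X e s' \<and> frame {15} {6, 7, 8, 9, 10} s s') s"
proof -
  define m D where "m = nmem s 15 0" and "D = rmem s 6"
  have ke: "rmem s 5 e = KK e" using env e by (simp add: env_def)
  have rr: "rmem s 0 2 = r" using env by (simp add: env_def)
  have Dm: "0 \<le> D m" "D m < 4" using inv_dirs_bounds [OF dirs order_refl]
      by (auto simp: m_def D_def)
  show ?thesis
  proof (cases "D m < KK e")
    case False
    then have "D m = KK e" using dirs e by (auto simp: inv_dirs_def m_def D_def)
    then have "mid_inv X e s" unfolding mid_inv_def using assms by (simp add: m_def D_def)
    then show ?thesis using False ke e by (simp add: advance_def m_def D_def frame_def)
  next
    case True
    define s' where "s' = rwrite 9 0 (Im (kdir (KK e))) (rwrite 8 0 (Re (kdir (KK e)))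
      (rwrite 10 0 (KK e) (rwrite 7 (Suc m) r (rwrite 6 (Suc m) (KK e) (nwrite 15 0 (Suc m) s)))))"
    have mem: "nmem s' = (nmem s)(15 := (nmem s 15)(0 := Suc m))" "rmem s' 6 = D(Suc m := KK e)"
      "rmem s' 7 = (rmem s 7)(Suc m := r)"
      by (simp_all add: s'_def D_def)
    have fr: "frame {15} {6, 7, 8, 9, 10} s s'" by (auto simp: frame_def s'_def)
    have env': "env s'" by (rule env_frame [OF fr env]) auto
    have fc': "faces s' (KK e)" by (simp add: faces_def s'_def)
    have wp: "wp advance (\<lambda>s2. s2 = s') s"
      using True ke rr e by (simp add: advance_def wp_direction s'_def m_def D_def)
    have XD: "KK e' \<le> D m" if "e' \<in> X" for e' using inv_dirs_le [OF dirs that]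
        by (simp add: m_def D_def)
    have dirs': "inv_dirs X (Suc m) (D(Suc m := KK e))"
      unfolding inv_dirs_def
    proof (intro conjI allI impI ballI)
      fix i j assume ij: "i < j \<and> j \<le> Suc m"
      have old: "D i < D j" if "i < j" "j \<le> m" for i j
        using dirs that by (auto simp: inv_dirs_def m_def D_def)
      have "D i \<le> D m" if "i \<le> m" using old [of i m] that by (cases "i = m") auto
      then show "(D(Suc m := KK e)) i < (D(Suc m := KK e)) j"
        using ij True old [of i j] by (cases "j = Suc m") auto
    next
      fix e' assume "e' \<in> X"
      then obtain k where "k \<le> m" "D k = KK e'" using dirs by (auto simp: inv_dirs_def m_def D_def)
      then show "\<exists>k\<le>Suc m. (D(Suc m := KK e)) k = KK e'" by (intro exI [of _ k]) auto
    next
      fix k assume "k \<le> Suc m"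
      then show "\<exists>e'<N. (D(Suc m := KK e)) k = KK e'"
        using dirs e(1) by (cases "k = Suc m") (auto simp: inv_dirs_def m_def D_def)
    qed (use dirs min in \<open>auto simp: inv_dirs_def m_def D_def\<close>)
    have pts': "inv_pts X (Suc m) (D(Suc m := KK e)) ((rmem s 7)(Suc m := r))"
      unfolding inv_pts_def
    proof (intro allI impI)
      fix k assume k: "k \<le> Suc m"
      show "((rmem s 7)(Suc m := r)) k \<le> r \<and>
        (\<forall>e'\<in>X. Z e' \<noteq> 0 \<and> KK e' = (D(Suc m := KK e)) k \<longrightarrow> ((rmem s 7)(Suc m := r)) k \<le> reach e') \<and>
        (((rmem s 7)(Suc m := r)) k = r \<or> (\<exists>e'\<in>X. Z e' \<noteq> 0 \<and> KK e' = (D(Suc m := KK e)) k \<and>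
          ((rmem s 7)(Suc m := r)) k = reach e'))"
      proof (cases "k = Suc m")
        case eq: True
        then show ?thesis using XD True by force
      next
        case False
        then show ?thesis using pts k by (simp add: inv_pts_def m_def D_def)
      qed
    qed
    have t': "tourn (gval hitE s') N (nmem s 8)"
    proof (rule tourn_cong [OF t])
      fix u v assume uv: "N \<le> u" "u < 2 * N" "N \<le> v" "v < 2 * N" "0 < nmem s 8 u" "0 < nmem s 8 v"
      obtain q where q: "nmem s 8 u = Suc q" "act X q" "q < n" "nondeg q" using leaf_act [OF lv] uv
          by metis
      obtain q' where q': "nmem s 8 v = Suc q'" "act X q'" "q' < n" "nondeg q'"
          using leaf_act [OF lv] uv by metis
      have "in_cone (spt u) (ept u) \<theta>" if "act X u" "kang (D m) \<le> \<theta>" "\<theta> \<le> kang (KK e)" for u \<theta>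
        using act_in_cone [OF that(1), of "D m" "KK e"] XD min Dm KK_bounds [of e] that by simp
      then have "H q (kang (D m)) < H q' (kang (D m)) \<longleftrightarrow> H q (kang (KK e)) < H q' (kang (KK e))"
        using q q' Dm KK_bounds [of e] True kang_le_iff [of 0 "D m"] kang_le_iff [of "D m" "KK e"]
          kang_le_iff [of "KK e" 4]
        by (intro H_less_const) auto
      then show "gval hitE s (nmem s 8 u) < gval hitE s (nmem s 8 v) \<longleftrightarrow>
        gval hitE s' (nmem s 8 u) < gval hitE s' (nmem s 8 v)"
        using q q' gval_hitE_H [OF env fc] gval_hitE_H [OF env' fc'] Dm KK_bounds [of e]
        by (simp add: m_def D_def)
    qed
    \<comment> \<open>The artificial event \<open>2 * n\<close> has key 0, so the first event taken
      from the queue cannot turn the ray.\<close>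
    have "X \<noteq> {}"
    proof
      assume "X = {}"
      then have "KK e \<le> KK (2 * n)" using min by (simp add: N_def)
      then show False using True Dm by (simp add: KK_def Z_def key_def)
    qed
    then have "nearest (D m) (nmem s 9 m)"
      using root nearest_root [OF env, of "D m" X "nmem s 8"] fc lv t Dm XD True min
      unfolding m_def [symmetric] D_def [symmetric] by force
    then have near': "\<forall>k<Suc m. nearest ((D(Suc m := KK e)) k) (nmem s 9 k)"
      using near by (auto simp: m_def D_def less_Suc_eq)
    have "mid_inv X e s'"
      unfolding mid_inv_def mem using env' dirs' fc' pts' lv t' near' e by simp
    then show ?thesis using wp_mono [OF wp] fr by simp
  qed
qed

lemma mate_bound: "e < N \<Longrightarrow> mate e < N"
  by (simp add: mate_def N_def) presburger

lemma wp_locate: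
  assumes env: "env s" and e: "nmem s 13 0 = e" "e < N"
  shows "wp locate (\<lambda>s'. rmem s' 12 0 = cr e \<and> rmem s' 13 0 = inner (Z e) (Z (mate e)) \<and>
    rmem s' 11 0 = norm (Z e) \<and> frame {14} {11, 12, 13} s s') s"
proof -
  have h: "nmem s 6 e = e div 2" using env e by (simp add: env_def)
  have m: "(e div 2 + e div 2 < e) \<longleftrightarrow> odd e" by presburger
  have z: "rmem s 3 e = Re (Z e)" "rmem s 4 e = Im (Z e)" "rmem s 3 (mate e) = Re (Z (mate e))"
    "rmem s 4 (mate e) = Im (Z (mate e))"
    using env e mate_bound by (simp_all add: env_def)
  have "wp (If (NLess (NAdd (NRead 6 (V 13)) (NRead 6 (V 13))) (V 13))
      (NAssign 14 (NConst 0) (NSub (V 13) (NConst 1))) (NAssign 14 (NConst 0) (NAdd (V 13) (NConst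
          1))))
    (\<lambda>s'. s' = nwrite 14 0 (mate e) s) s"
    using e h m by (auto simp: mate_def)
  then show ?thesis
    unfolding locate_def wp.simps(4) [of "If _ _ _"]
    by (rule wp_mono)
      (use z e in \<open>auto simp: crossE_def cr_def cross_def inner_complex_def norm_Z frame_def\<close>)
qed

lemma wp_update_pt:
  assumes "rmem s 12 0 = cr e" "rmem s 13 0 = inner (Z e) (Z (mate e))" "rmem s 11 0 = norm (Z e)"
  shows "wp update_pt (\<lambda>s'. rmem s' 7 = (if Z e \<noteq> 0 then (rmem s 7)(nmem s 15 0 := min (rmem s 7
      (nmem s 15 0)) (reach e))
      else rmem s 7) \<and> frame {} {7, 11} s s') s"
proof -
  have u: "h(i := h i) = h" for h :: "nat \<Rightarrow> real" and i by simp
  show ?thesis using assms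
    by (auto simp: update_pt_def reach_def frame_def min_def u not_less)
qed

lemma wp_update_leaf:
  assumes "env s" "nmem s 13 0 = e" "e < N" "rmem s 12 0 = cr e"
  shows "wp update_leaf (\<lambda>s'. nmem s' 8 = (if cr e = 0 then nmem s 8
      else (nmem s 8)(N + e div 2 := if 0 < cr e then e div 2 + 1 else 0)) \<and>
      nmem s' 11 0 = N + e div 2 \<and> frame {8, 11} {} s s') s"
  using assms by (auto simp: update_leaf_def env_def frame_def)

lemma cr_odd: "cr (2 * q + 1) = - cr (2 * q)"
  by (simp add: cr_def mate_def cross_commute [of "Z (Suc (2 * q))"])

text \<open>Processing in key order decides about the partner event: without a wrap the end comes
  strictly after the start, with a wrap strictly before it. So a start event always activates its
  obstacle and an end event always retires it, and the sign of \<open>cr e\<close> tells which of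
  the two \<open>e\<close> is.\<close>

lemma act_insert:
  assumes X: "\<And>e'. e' \<in> X \<Longrightarrow> KK e' \<le> KK e" "e \<notin> X" "e < N"
  shows "act (insert e X) q = (if q = e div 2 \<and> cr e \<noteq> 0 then 0 < cr e else act X q)"
proof (cases "nondeg q")
  case False
  have "\<not> (q = e div 2 \<and> cr e \<noteq> 0)"
  proof
    assume *: "q = e div 2 \<and> cr e \<noteq> 0"
    have "e < 2 * n"
    proof (rule ccontr)
      assume "\<not> e < 2 * n"
      then show False using * by (simp add: cr_def Z_def)
    qed
    then have q: "q < n" using * by simp
    then have "cr (2 * q) = 0" using False by (simp add: nondeg_def)
    moreover have "e = 2 * q \<or> e = 2 * q + 1" using * by presburger
    then have "cr e = cr (2 * q) \<or> cr e = - cr (2 * q)" using cr_odd by metis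
    ultimately show False using * by auto
  qed
  then show ?thesis using False by (simp add: act_def)
next
  case nd: True
  have se: "{start_event q, end_event q} = {2 * q, 2 * q + 1}" "start_event q \<noteq> end_event q"
    by (auto simp: start_event_def end_event_def)
  have cre: "cr (start_event q) > 0" "cr (end_event q) < 0"
    using nd cr_odd [of q] by (auto simp: start_event_def end_event_def nondeg_def)
  show ?thesis
  proof (cases "q = e div 2")
    case False
    then have "e \<noteq> 2 * q" "e \<noteq> 2 * q + 1" by auto
    then have "start_event q \<noteq> e" "end_event q \<noteq> e" using se by auto
    then show ?thesis using False by (simp add: act_def)
  next
    case True
    then have "e = 2 * q \<or> e = 2 * q + 1" by presburger
    then consider "e = start_event q" | "e = end_event q" using se
        by (metis insertE insertI1 insertI2 singletonD)
    then show ?thesis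
    proof cases
      case 1
      have "end_event q \<notin> X" if "key (spt q) < key (ept q)"
        using X(1) [of "end_event q"] KK_start [OF nd] KK_end [OF nd] 1 that by auto
      then have "key (spt q) < key (ept q) \<longrightarrow> end_event q \<notin> insert e X" using 1 se(2) by auto
      moreover have "start_event q \<in> insert e X" using 1 by simp
      ultimately have "act (insert e X) q" using nd by (simp add: act_def del: insert_iff)
      moreover have "0 < cr e" using 1 cre(1) by simp
      ultimately show ?thesis using True by simp
    next
      case 2
      have "start_event q \<notin> X" if "\<not> key (spt q) < key (ept q)"
        using X(1) [of "start_event q"] KK_start [OF nd] KK_end [OF nd] 2 that key_spt_neq [OF nd]
            by auto
      then have "\<not> key (spt q) < key (ept q) \<longrightarrow> start_event q \<notin> insert e X" using 2 se(2) by auto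
      moreover have "end_event q \<in> insert e X" using 2 by simp
      ultimately have "\<not> act (insert e X) q" by (simp add: act_def del: insert_iff)
      moreover have "cr e < 0" using 2 cre(2) by simp
      ultimately show ?thesis using True by simp
    qed
  qed
qed

lemma inv_dirs_insert: "inv_dirs X m D \<Longrightarrow> D m = KK e \<Longrightarrow> inv_dirs (insert e X) m D"
  by (auto simp: inv_dirs_def)

lemma inv_pts_insert:
  assumes dirs: "inv_dirs X m D" and eq: "D m = KK e" and pts: "inv_pts X m D pt"
  shows "inv_pts (insert e X) m D (if Z e \<noteq> 0 then pt(m := min (pt m) (reach e)) else pt)"
  unfolding inv_pts_def
proof (intro allI impI)
  fix k assume k: "k \<le> m"
  let ?pt = "if Z e \<noteq> 0 then pt(m := min (pt m) (reach e)) else pt"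
  have old: "pt k \<le> r" "\<And>e'. e' \<in> X \<Longrightarrow> Z e' \<noteq> 0 \<Longrightarrow> KK e' = D k \<Longrightarrow> pt k \<le> reach e'"
    "pt k = r \<or> (\<exists>e'\<in>X. Z e' \<noteq> 0 \<and> KK e' = D k \<and> pt k = reach e')"
    using pts k by (auto simp: inv_pts_def)
  have "D k < D m" if "k \<noteq> m" using dirs k that by (simp add: inv_dirs_def)
  then have neq: "KK e \<noteq> D k" if "k \<noteq> m" using that eq by auto
  show "?pt k \<le> r \<and> (\<forall>e'\<in>insert e X. Z e' \<noteq> 0 \<and> KK e' = D k \<longrightarrow> ?pt k \<le> reach e') \<and>
      (?pt k = r \<or> (\<exists>e'\<in>insert e X. Z e' \<noteq> 0 \<and> KK e' = D k \<and> ?pt k = reach e'))"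
  proof (cases "Z e \<noteq> 0 \<and> k = m")
    case False
    then have "?pt k = pt k" by auto
    then show ?thesis using old neq False by auto
  next
    case True
    then have "?pt k = min (pt m) (reach e)" by simp
    then show ?thesis using old True eq by (auto simp: min_def) (meson linear order_trans)+
  qed
qed

lemma runs_sweep_body:
  assumes inv: "sweep_inv X s" and pos: "0 < nmem s 7 1" and L: "2 * N \<le> 2 ^ Suc L"
  shows "runs sweep_body s (main_cost L) (\<lambda>s'. \<exists>e. e < N \<and> e \<notin> X \<and> sweep_inv (insert e X) s')"
proof -
  note sweep_inv_def [simp]
  \<comment> \<open>\<open>P1\<close> to \<open>P6\<close> are the assertions between consecutive
    components of \<open>sweep_body\<close>, its first two components being taken together.\<close>
  define P1 where "P1 e s' \<longleftrightarrow> e < N \<and> e \<notin> X \<and> (\<forall>e'<N. e' \<notin> X \<longrightarrow> KK e \<le> KK e') \<and> nmem s' 13 0 = e \<and>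
      events (insert e X) (nmem s' 7) \<and> tourn (gval keyE s) N (nmem s' 7) \<and>
          frame {7, 11, 13} {} s s'" for e s'
  define P2 where "P2 e s' \<longleftrightarrow> mid_inv X e s' \<and> events (insert e X) (nmem s' 7) \<and>
      tourn (gval keyE s') N (nmem s' 7)" for e s'
  have adv: "wp advance (P2 e) s1" if P1: "P1 e s1" for e s1
  proof -
    have fr: "frame {7, 11, 13} {} s s1" using P1 by (simp add: P1_def)
    then have mem: "nmem s1 15 = nmem s 15" "nmem s1 8 = nmem s 8" "nmem s1 9 = nmem s 9"
        "rmem s1 = rmem s"
      by (auto simp: frame_def)
    have g: "gval hitE s1 = gval hitE s" "gval keyE s1 = gval keyE s"
      by (auto simp: fun_eq_iff gval_hitE gval_keyE mem)
    have env: "env s1" by (rule env_frame [OF fr]) (use inv in auto)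
    have sub: "X \<subseteq> {..<N}" using inv by (simp add: events_def)
    have "wp advance (\<lambda>s'. mid_inv X e s' \<and> frame {15} {6, 7, 8, 9, 10} s1 s') s1"
      by (rule wp_advance) (use inv P1 env sub in \<open>auto simp: mem g P1_def faces_def\<close>)
    then show ?thesis
    proof (rule wp_mono)
      fix s' assume *: "mid_inv X e s' \<and> frame {15} {6, 7, 8, 9, 10} s1 s'"
      then have "nmem s' 7 = nmem s1 7" "gval keyE s' = gval keyE s1"
        by (auto simp: frame_def fun_eq_iff gval_keyE)
      then show "P2 e s'" using * P1 g by (simp add: P2_def P1_def)
    qed
  qed
  define P3 where "P3 e s' \<longleftrightarrow> P2 e s' \<and> rmem s' 12 0 = cr e \<and>
    rmem s' 13 0 = inner (Z e) (Z (mate e)) \<and> rmem s' 11 0 = norm (Z e)" for e s'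
  have P2_frame: "P2 e s2" if "P2 e s1" "frame {14} {11, 12, 13} s1 s2" for e s1 s2
  proof -
    have mem: "nmem s2 15 = nmem s1 15" "nmem s2 8 = nmem s1 8" "nmem s2 9 = nmem s1 9"
        "nmem s2 7 = nmem s1 7"
      "nmem s2 13 = nmem s1 13" "rmem s2 3 = rmem s1 3" "rmem s2 4 = rmem s1 4"
          "rmem s2 5 = rmem s1 5"
      "rmem s2 6 = rmem s1 6" "rmem s2 7 = rmem s1 7" "rmem s2 8 = rmem s1 8"
          "rmem s2 9 = rmem s1 9"
      using that(2) by (auto simp: frame_def)
    have g: "gval hitE s2 = gval hitE s1" "gval keyE s2 = gval keyE s1"
      by (auto simp: fun_eq_iff gval_hitE gval_keyE mem)
    have "env s2" by (rule env_frame [OF that(2)]) (use that(1) in \<open>auto simp: P2_def mid_inv_def\<close>)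
    then show ?thesis using that(1) by (simp add: P2_def mid_inv_def mem g faces_def)
  qed
  have loc: "wp locate (P3 e) s1" if "P2 e s1" for e s1
  proof -
    have "env s1" "nmem s1 13 0 = e" "e < N" using that by (auto simp: P2_def mid_inv_def)
    from wp_locate [OF this] show ?thesis
      by (rule wp_mono) (use P2_frame [OF that] in \<open>auto simp: P3_def\<close>)
  qed
  define P4 where "P4 e s' \<longleftrightarrow> env s' \<and> e < N \<and> e \<notin> X \<and> nmem s' 13 0 = e \<and> rmem s' 12 0 = cr e \<and>
    events (insert e X) (nmem s' 7) \<and> tourn (gval keyE s') N (nmem s' 7) \<and>
    inv_dirs (insert e X) (nmem s' 15 0) (rmem s' 6) \<and> faces s' (rmem s' 6 (nmem s' 15 0)) \<and>
    inv_pts (insert e X) (nmem s' 15 0) (rmem s' 6) (rmem s' 7) \<and>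
    leaves X (nmem s' 8) \<and> tourn (gval hitE s') N (nmem s' 8) \<and>
    (\<forall>k<nmem s' 15 0. nearest (rmem s' 6 k) (nmem s' 9 k)) \<and> (\<forall>e'\<in>X. KK e' \<le> KK e)" for e s'
  have upt: "wp update_pt (P4 e) s1" if P3: "P3 e s1" for e s1
  proof -
    have mid: "mid_inv X e s1" using P3 by (simp add: P3_def P2_def)
    have "wp update_pt (\<lambda>s'. rmem s' 7 = (if Z e \<noteq> 0 then (rmem s1 7)(nmem s1 15 0 := min (rmem s1 7
        (nmem s1 15 0)) (reach e))
      else rmem s1 7) \<and> frame {} {7, 11} s1 s') s1"
      using P3 by (intro wp_update_pt) (auto simp: P3_def)
    then show ?thesis
    proof (rule wp_mono)
      fix s2 assume s2: "rmem s2 7 = (if Z e \<noteq> 0 then (rmem s1 7)(nmem s1 15 0 := min (rmem s1 7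
          (nmem s1 15 0)) (reach e))
        else rmem s1 7) \<and> frame {} {7, 11} s1 s2"
      have mem: "nmem s2 = nmem s1" "rmem s2 3 = rmem s1 3" "rmem s2 4 = rmem s1 4"
          "rmem s2 5 = rmem s1 5"
        "rmem s2 6 = rmem s1 6" "rmem s2 8 = rmem s1 8" "rmem s2 9 = rmem s1 9"
            "rmem s2 12 = rmem s1 12"
        using s2 by (auto simp: frame_def fun_eq_iff)
      have g: "gval hitE s2 = gval hitE s1" "gval keyE s2 = gval keyE s1"
        by (auto simp: fun_eq_iff gval_hitE gval_keyE mem)
      have "env s2" by (rule env_frame [of "{}" "{7, 11}" s1]) (use s2 mid in \<open>auto simp:
          mid_inv_def\<close>)
      moreover have "\<forall>e'\<in>X. KK e' \<le> KK e" using mid inv_dirs_le by (metis mid_inv_def)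
      moreover have "inv_pts (insert e X) (nmem s2 15 0) (rmem s2 6) (rmem s2 7)"
        using inv_pts_insert [of X "nmem s1 15 0" "rmem s1 6" e "rmem s1 7"] mid s2
        by (simp add: mem mid_inv_def)
      moreover have "inv_dirs (insert e X) (nmem s2 15 0) (rmem s2 6)"
        using inv_dirs_insert [of X "nmem s1 15 0" "rmem s1 6" e] mid by (simp add: mem mid_inv_def)
      moreover have fc: "faces s2 \<kappa> \<longleftrightarrow> faces s1 \<kappa>" for \<kappa> by (simp add: faces_def mem)
      ultimately show "P4 e s2" using P3 unfolding P4_def P3_def P2_def mid_inv_def mem g fc
          by blast
    qed
  qed
  define P5 where "P5 e s' \<longleftrightarrow> env s' \<and> e < N \<and> e \<notin> X \<and>
    events (insert e X) (nmem s' 7) \<and> tourn (gval keyE s') N (nmem s' 7) \<and>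
    inv_dirs (insert e X) (nmem s' 15 0) (rmem s' 6) \<and> faces s' (rmem s' 6 (nmem s' 15 0)) \<and>
    inv_pts (insert e X) (nmem s' 15 0) (rmem s' 6) (rmem s' 7) \<and>
    leaves (insert e X) (nmem s' 8) \<and> nmem s' 11 0 = N + e div 2 \<and>
    (\<forall>u. 1 \<le> u \<and> u < N \<and> u \<noteq> nmem s' 11 0 div 2 \<longrightarrow>
      nmem s' 8 u = winner (gval hitE s') (nmem s' 8 (2 * u)) (nmem s' 8 (2 * u + 1))) \<and>
    (\<forall>k<nmem s' 15 0. nearest (rmem s' 6 k) (nmem s' 9 k))" for e s'
  have ulf: "wp update_leaf (P5 e) s1" if P4: "P4 e s1" for e s1
  proof -
    have eX: "e < N" "e \<notin> X" "\<And>e'. e' \<in> X \<Longrightarrow> KK e' \<le> KK e" using P4 by (auto simp: P4_def)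
    have "wp update_leaf (\<lambda>s'. nmem s' 8 = (if cr e = 0 then nmem s1 8
      else (nmem s1 8)(N + e div 2 := if 0 < cr e then e div 2 + 1 else 0)) \<and>
      nmem s' 11 0 = N + e div 2 \<and> frame {8, 11} {} s1 s') s1"
      using P4 by (intro wp_update_leaf) (auto simp: P4_def)
    then show ?thesis
    proof (rule wp_mono)
      fix s2 assume s2: "nmem s2 8 = (if cr e = 0 then nmem s1 8
        else (nmem s1 8)(N + e div 2 := if 0 < cr e then e div 2 + 1 else 0)) \<and>
        nmem s2 11 0 = N + e div 2 \<and> frame {8, 11} {} s1 s2"
      have mem: "rmem s2 = rmem s1" "nmem s2 15 = nmem s1 15" "nmem s2 9 = nmem s1 9"
          "nmem s2 7 = nmem s1 7"
        using s2 by (auto simp: frame_def fun_eq_iff)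
      have g: "gval hitE s2 = gval hitE s1" "gval keyE s2 = gval keyE s1"
        by (auto simp: fun_eq_iff gval_hitE gval_keyE mem)
      have "env s2" by (rule env_frame [of "{8, 11}" "{}" s1]) (use s2 P4 in \<open>auto simp: P4_def\<close>)
      moreover have "leaves (insert e X) (nmem s2 8)"
      proof -
        have "leaves X (nmem s1 8)" using P4 by (simp add: P4_def)
        moreover have "act (insert e X) q = (if q = e div 2 \<and> cr e \<noteq> 0 then 0 < cr e else act X q)"
            for q
          by (rule act_insert) (use eX in auto)
        moreover note conjunct1 [OF s2]
        ultimately show ?thesis unfolding leaves_def by auto
      qed
      moreover have "nmem s2 8 u = winner (gval hitE s2) (nmem s2 8 (2 * u)) (nmem s2 8 (2 * u +
          1))"
        if u: "1 \<le> u \<and> u < N \<and> u \<noteq> nmem s2 11 0 div 2" for u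
      proof -
        have "2 * u \<noteq> N + e div 2" "2 * u + 1 \<noteq> N + e div 2" "u \<noteq> N + e div 2" using u s2 by auto
        then have "nmem s2 8 u = nmem s1 8 u" "nmem s2 8 (2 * u) = nmem s1 8 (2 * u)"
          "nmem s2 8 (2 * u + 1) = nmem s1 8 (2 * u + 1)" using s2 by simp_all
        then show ?thesis using P4 u unfolding P4_def tourn_def g by simp
      qed
      moreover have fc: "faces s2 \<kappa> \<longleftrightarrow> faces s1 \<kappa>" for \<kappa> by (simp add: faces_def mem)
      moreover have "nmem s2 11 0 = N + e div 2" using s2 by blast
      ultimately show "P5 e s2" using P4 unfolding P5_def P4_def mem g fc by blast
    qed
  qed
  define P6 where "P6 e s' \<longleftrightarrow> env s' \<and> e < N \<and> e \<notin> X \<and>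
    events (insert e X) (nmem s' 7) \<and> tourn (gval keyE s') N (nmem s' 7) \<and>
    inv_dirs (insert e X) (nmem s' 15 0) (rmem s' 6) \<and> faces s' (rmem s' 6 (nmem s' 15 0)) \<and>
    inv_pts (insert e X) (nmem s' 15 0) (rmem s' 6) (rmem s' 7) \<and>
    leaves (insert e X) (nmem s' 8) \<and> tourn (gval hitE s') N (nmem s' 8) \<and>
    (\<forall>k<nmem s' 15 0. nearest (rmem s' 6 k) (nmem s' 9 k))" for e s'
  have pth: "runs (path 8 hitE) s1 (Suc L * (20 + cmax (node 8 hitE))) (P6 e)" if P5: "P5 e s1"
      for e s1
  proof -
    have "runs (path 8 hitE) s1 (Suc L * (20 + cmax (node 8 hitE)))
      (\<lambda>s'. tourn (gval hitE s1) N (nmem s' 8) \<and> (\<forall>u\<ge>N. nmem s' 8 u = nmem s1 8 u) \<and>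
          frame {8, 11} {} s1 s')"
      by (rule runs_path [OF indep_hitE]) (use P5 L in \<open>auto simp: P5_def env_def N_def\<close>)
    then show ?thesis
    proof (rule runs_mono)
      fix s2 assume s2: "tourn (gval hitE s1) N (nmem s2 8) \<and> (\<forall>u\<ge>N. nmem s2 8 u = nmem s1 8 u) \<and>
          frame {8, 11} {} s1 s2"
      have mem: "rmem s2 = rmem s1" "nmem s2 15 = nmem s1 15" "nmem s2 9 = nmem s1 9"
          "nmem s2 7 = nmem s1 7"
        using s2 by (auto simp: frame_def fun_eq_iff)
      have g: "gval hitE s2 = gval hitE s1" "gval keyE s2 = gval keyE s1"
        by (auto simp: fun_eq_iff gval_hitE gval_keyE mem)
      have "env s2" by (rule env_frame [of "{8, 11}" "{}" s1]) (use s2 P5 in \<open>auto simp: P5_def\<close>)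
      moreover have "leaves (insert e X) (nmem s2 8)" using s2 P5 by (simp add: P5_def leaves_def)
      moreover have fc: "faces s2 \<kappa> \<longleftrightarrow> faces s1 \<kappa>" for \<kappa> by (simp add: faces_def mem)
      ultimately show "P6 e s2" using P5 s2 unfolding P6_def P5_def mem g fc by blast
    qed simp
  qed
  have fin: "wp (NAssign 9 (V 15) (NRead 8 (NConst 1))) (\<lambda>s'. \<exists>e. e < N \<and> e \<notin> X \<and>
      sweep_inv (insert e X) s') s1"
    if P6: "P6 e s1" for e s1
  proof -
    let ?s = "nwrite 9 (nmem s1 15 0) (nmem s1 8 1) s1"
    have fr: "frame {9} {} s1 ?s" by (auto simp: frame_def)
    have "env ?s" by (rule env_frame [OF fr]) (use P6 in \<open>auto simp: P6_def\<close>)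
    moreover have g: "gval hitE ?s = gval hitE s1" "gval keyE ?s = gval keyE s1"
      by (auto simp: fun_eq_iff gval_hitE gval_keyE)
    ultimately have "sweep_inv (insert e X) ?s" using P6 unfolding P6_def by (simp add: faces_def)
    then have "\<exists>e. e < N \<and> e \<notin> X \<and> sweep_inv (insert e X) ?s" using P6 unfolding P6_def by blast
    then show ?thesis by simp
  qed
  let ?rest = "Seq advance (Seq locate (Seq update_pt (Seq update_leaf (Seq (path 8 hitE)
      (NAssign 9 (V 15) (NRead 8 (NConst 1)))))))"
  let ?Q = "\<lambda>s'. \<exists>e. e < N \<and> e \<notin> X \<and> sweep_inv (insert e X) s'"
  have rest: "runs ?rest s1
    (cmax advance + (cmax locate + (cmax update_pt + (cmax update_leaf + (Suc L * (20 + cmax (node 8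
        hitE)) +
      cmax (NAssign 9 (V 15) (NRead 8 (NConst 1)))))))) ?Q" if "P1 e s1" for e s1
    using that
    by (intro runs_Seq [OF runs_wp [OF adv]] runs_Seq [OF runs_wp [OF loc]] runs_Seq [OF runs_wp [OF
        upt]]
        runs_Seq [OF runs_wp [OF ulf]] runs_Seq [OF pth] runs_wp [OF fin])
  have pop: "runs (Seq pop_event (path 7 keyE)) s (cmax pop_event + Suc L * (20 + cmax (node 7
      keyE))) (\<lambda>s'. \<exists>e. P1 e s')"
    using runs_pop_event [OF inv pos L] unfolding P1_def .
  have "runs (Seq (Seq pop_event (path 7 keyE)) ?rest) s (main_cost L) ?Q"
    unfolding main_cost_def add.assoc
    by (rule runs_Seq [OF pop, unfolded add.assoc]) (use rest in blast)
  then show ?thesis unfolding sweep_body_def by (rule runs_Seq_assoc)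
qed

lemma remaining_events:
  assumes "sweep_inv X s"
  shows "{e. e < N \<and> nmem s 7 (N + e) \<noteq> 0} = {..<N} - X" "X \<subseteq> {..<N}"
  using assms by (auto simp: sweep_inv_def events_def)

lemma runs_sweep:
  assumes inv: "sweep_inv {} s" and L: "2 * N \<le> 2 ^ Suc L"
  shows "runs sweep s (Suc N * (10 + main_cost L)) (sweep_inv {..<N})"
proof -
  \<comment> \<open>The measure has to be a function of the state, so the number of remaining events
    is read off the leaves of the queue rather than from \<open>X\<close>.\<close>
  define \<mu> where "\<mu> s = card {e. e < N \<and> nmem s 7 (N + e) \<noteq> 0}" for s :: state
  let ?b = "NLess (NConst 0) (NRead 7 (NConst 1))"
  have "runs (While ?b sweep_body) s (Suc (\<mu> s) * (1 + bcost ?b + main_cost L))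
    (\<lambda>s'. (\<exists>X. sweep_inv X s') \<and> \<not> bval ?b s')"
  proof (rule runs_While)
    show "\<exists>X. sweep_inv X s" using inv by blast
    fix s1 assume "\<exists>X. sweep_inv X s1" and pos: "bval ?b s1"
    then obtain X where X: "sweep_inv X s1" by blast
    have "runs sweep_body s1 (main_cost L) (\<lambda>s'. \<exists>e. e < N \<and> e \<notin> X \<and> sweep_inv (insert e X) s')"
      by (rule runs_sweep_body [OF X _ L]) (use pos in simp)
    then show "runs sweep_body s1 (main_cost L) (\<lambda>s'. (\<exists>X. sweep_inv X s') \<and> \<mu> s' < \<mu> s1)"
    proof (rule runs_mono)
      fix s2 assume "\<exists>e. e < N \<and> e \<notin> X \<and> sweep_inv (insert e X) s2"
      then obtain e where e: "e < N" "e \<notin> X" "sweep_inv (insert e X) s2" by blast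
      have "{..<N} - insert e X \<subset> {..<N} - X" using e by auto
      then have "\<mu> s2 < \<mu> s1"
        unfolding \<mu>_def remaining_events [OF X] remaining_events [OF e(3)]
            by (intro psubset_card_mono) auto
      then show "(\<exists>X. sweep_inv X s2) \<and> \<mu> s2 < \<mu> s1" using e by blast
    qed simp
  qed
  moreover have "\<mu> s \<le> N" unfolding \<mu>_def remaining_events [OF inv] by simp
  then have "Suc (\<mu> s) * (1 + bcost ?b + main_cost L) \<le> Suc N * (10 + main_cost L)"
    by (intro mult_le_mono) simp_all
  ultimately show ?thesis
    unfolding sweep_def
  proof (rule runs_mono)
    fix s' assume "(\<exists>X. sweep_inv X s') \<and> \<not> bval ?b s'"
    then obtain X where X: "sweep_inv X s'" and 0: "nmem s' 7 1 = 0" by auto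
    have t: "tourn (gval keyE s') N (nmem s' 7)" and ev: "events X (nmem s' 7)"
      using X by (auto simp: sweep_inv_def)
    have "e \<in> X" if "e < N" for e
      using tourn_root_least [OF t, of "N + e"] 0 ev that
          by (force simp: events_def split: if_splits)
    then have "X = {..<N}" using remaining_events(2) [OF X] by auto
    then show "sweep_inv {..<N} s'" using X by simp
  qed
qed

end

section \<open>Output\<close>

text \<open>Nodes get consecutive addresses, so both links are known at once. The predecessor of
  node 0 and the successor of the last node are provisional until \<open>output_close\<close> joins
  the ends.\<close>

definition emit :: "nat \<Rightarrow> rexp \<Rightarrow> com" where
  "emit t a = Seq (RAssign 1 (V 16) (RAdd (RRead 0 (NConst 0)) (RMul a (W 8))))
    (Seq (RAssign 2 (V 16) (RAdd (RRead 0 (NConst 1)) (RMul a (W 9))))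
    (Seq (NAssign 4 (V 16) (NConst t)) (Seq (NAssign 3 (V 16) (NSub (V 16) (NConst 1)))
    (Seq (NAssign 2 (V 16) (NAdd (V 16) (NConst 1))) (NAssign 16 (NConst 0) (NAdd (V 16) (NConst
        1)))))))"

definition face_ray :: com where
  "face_ray = Seq (RAssign 10 (NConst 0) (RRead 6 (V 17))) direction"

text \<open>Register 18 remembers the entry of the preceding sector, so real registers 14 and 15
  receive \<open>fm k\<close> and \<open>f k (\<Theta> k)\<close>, both measured along the ray now
  faced.\<close>

definition side_values :: com where
  "side_values = Seq
    (If (NLess (NConst 0) (V 18)) (RAssign 14 (NConst 0) (hitE (V 18)))
      (RAssign 14 (NConst 0) (RRead 0 (NConst 2))))
    (If (NLess (NConst 0) (NRead 9 (V 17))) (RAssign 15 (NConst 0) (hitE (NRead 9 (V 17))))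
      (RAssign 15 (NConst 0) (RRead 0 (NConst 2))))"

definition least_value :: com where
  "least_value = Seq (RAssign 16 (NConst 0) (W 14))
    (Seq (If (RLess (W 15) (W 16)) (RAssign 16 (NConst 0) (W 15)) Skip)
      (If (RLess (RRead 7 (V 17)) (W 16)) (RAssign 16 (NConst 0) (RRead 7 (V 17))) Skip))"

definition measure_ray :: com where
  "measure_ray = Seq face_ray (Seq side_values least_value)"

text \<open>The mean of two pseudo-angles need not bisect the arc, but it lies strictly inside it by
  monotonicity of \<open>kang\<close>, which is all that an appendix point requires.\<close>

definition emit_appendix :: com where
  "emit_appendix = If (NLess (NConst 0) (NRead 9 (V 17))) Skip
    (Seq (RAssign 10 (NConst 0) (RDiv (RAdd (RRead 6 (V 17)) (RRead 6 (NAdd (V 17) (NConst 1))))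
        (RConst 2)))
    (Seq direction (emit 1 (RRead 0 (NConst 2)))))"

definition output_body :: com where
  "output_body = Seq measure_ray
    (Seq (If (RLess (W 16) (W 14)) (emit 0 (W 14)) Skip)
    (Seq (If (RLess (W 16) (W 15)) (emit 0 (W 16)) Skip)
    (Seq (emit 0 (W 15))
    (Seq emit_appendix
    (Seq (NAssign 18 (NConst 0) (NRead 9 (V 17))) (NAssign 17 (NConst 0) (NAdd (V 17) (NConst
        1))))))))"

text \<open>The key 4 after the last ray is a sentinel for the full turn. Register 18 starts with
  the last sector, which precedes ray 0.\<close>

definition output_init :: com where
  "output_init = Seq (RAssign 6 (NAdd (V 15) (NConst 1)) (RConst 4)) (NAssign 18 (NConst 0) (NRead 9
      (V 15)))"

definition output_close :: com where
  "output_close = Seq (NAssign 3 (NConst 0) (NSub (V 16) (NConst 1))) (NAssign 2 (NSub (V 16)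
      (NConst 1)) (NConst 0))"

definition write_boundary :: com where
  "write_boundary = Seq output_init (Seq (While (BNot (NLess (V 15) (V 17))) output_body)
      output_close)"

definition listed :: "(bool \<times> complex) list \<Rightarrow> state \<Rightarrow> bool" where
  "listed xs s \<longleftrightarrow> nmem s 16 0 = length xs \<and> (\<forall>i<length xs. rmem s 1 i = Re (snd (xs ! i)) \<and>
     rmem s 2 i = Im (snd (xs ! i)) \<and> nmem s 4 i = of_bool (fst (xs ! i)) \<and> nmem s 3 i = i - 1 \<and>
     nmem s 2 i = Suc i)"

lemma listed_frame: "frame A B s s' \<Longrightarrow> A \<inter> {2, 3, 4, 16} = {} \<Longrightarrow> B \<inter> {1, 2} = {} \<Longrightarrow>
    listed xs s \<Longrightarrow> listed xs s'"
  by (auto simp: listed_def frame_def)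

text \<open>\<open>a\<close> is evaluated once more after the first coordinate has been written,
  hence the requirement that writes to bank 1 do not affect it.\<close>

lemma wp_emit:
  assumes "listed xs s" "\<And>i v. rval a (rwrite 1 i v s) = rval a s"
    and "p = Complex (rmem s 0 0) (rmem s 0 (Suc 0))" "cis \<theta> = Complex (rmem s 8 0) (rmem s 9 0)"
  shows "wp (emit (of_bool t) a) (\<lambda>s'. listed (xs @ [(t, pol p (rval a s) \<theta>)]) s' \<and>
    frame {2, 3, 4, 16} {1, 2} s s') s"
proof -
  have "Re (pol p (rval a s) \<theta>) = rmem s 0 0 + rval a s * rmem s 8 0"
    "Im (pol p (rval a s) \<theta>) = rmem s 0 (Suc 0) + rval a s * rmem s 9 0"
    using assms(3,4) by (simp_all add: pol_def complex_eq_iff)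
  then show ?thesis using assms(1,2)
    by (auto simp: emit_def listed_def frame_def nth_append less_Suc_eq)
qed

lemma rval_hitE: "rval (hitE e) s = gval hitE s (nval e s)"
  by (simp add: gval_def hitE_def crossE_def Let_def)

lemma holds_dll_listed:
  assumes "listed xs s" "xs \<noteq> []" "nmem s 1 0 = 0"
  shows "wp output_close (\<lambda>s'. holds_dll s' xs) s"
proof -
  define l where "l = length xs"
  have l: "0 < l" "nmem s 16 0 = l" using assms by (auto simp: l_def listed_def)
  let ?s = "nwrite 2 (l - 1) 0 (nwrite 3 0 (l - 1) s)"
  have "holds_dll ?s xs"
    unfolding holds_dll_def
  proof (intro conjI exI [of _ "[0..<l]"] allI impI)
    fix i assume "i < length xs"
    then have i: "i < l" by (simp add: l_def)
    have nth: "[0..<l] ! j = j" if "j < l" for j using that by simp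
    have Si: "Suc i mod l < l" using l by simp
    have *: "rmem s 1 i = Re (snd (xs ! i))" "rmem s 2 i = Im (snd (xs ! i))"
      "nmem s 4 i = of_bool (fst (xs ! i))" "nmem s 2 i = Suc i"
      using assms(1) i by (auto simp: listed_def l_def)
    show "nmem ?s 2 ([0..<l] ! i) = [0..<l] ! (Suc i mod length xs)"
      unfolding l_def [symmetric] nth [OF i] nth [OF Si] using * i by (auto simp: mod_Suc)
    show "nmem ?s 3 ([0..<l] ! (Suc i mod length xs)) = [0..<l] ! i"
      unfolding l_def [symmetric] nth [OF i] nth [OF Si] using assms(1) i
      by (cases "Suc i = l") (auto simp: listed_def l_def)
    show "nmem ?s 4 ([0..<l] ! i) = of_bool (fst (xs ! i))" using * nth [OF i] by simp
    show "Complex (rmem ?s 1 ([0..<l] ! i)) (rmem ?s 2 ([0..<l] ! i)) = snd (xs ! i)"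
      using * nth [OF i] by simp
  qed (use assms l in \<open>auto simp: l_def\<close>)
  then show ?thesis using l by (simp add: output_close_def)
qed

section \<open>Correctness of the output\<close>

locale swept = obst +
  fixes m :: nat and D :: "nat \<Rightarrow> real" and C :: "nat \<Rightarrow> nat" and pt :: "nat \<Rightarrow> real"
  assumes dirs: "inv_dirs {..<N} m D" and pts: "inv_pts {..<N} m D pt"
    and near: "\<And>k. k \<le> m \<Longrightarrow> nearest (D k) (C k)"
begin

definition D' :: "nat \<Rightarrow> real" where
  "D' k = (if k = Suc m then 4 else D k)"

lemma D'_mono: "i < j \<Longrightarrow> j \<le> Suc m \<Longrightarrow> D' i < D' j"
  using dirs inv_dirs_bounds [OF dirs, of i] by (auto simp: D'_def inv_dirs_def le_Suc_eq)

lemma D'_bounds: "k \<le> Suc m \<Longrightarrow> 0 \<le> D' k" "k \<le> Suc m \<Longrightarrow> D' k \<le> 4"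
  using inv_dirs_bounds [OF dirs, of k] by (auto simp: D'_def)

text \<open>The keys of the rays are pairwise distinct and each is the key of an event. This bounds
  the rounds of the output loop.\<close>

lemma m_less_N: "m < N"
proof -
  have "inj_on D {..m}"
    using dirs unfolding inv_dirs_def inj_on_def by (metis atMost_iff less_irrefl linorder_neqE_nat)
  then have "Suc m = card (D ` {..m})" by (simp add: card_image)
  also have "D ` {..m} \<subseteq> KK ` {..<N}" using dirs by (auto simp: inv_dirs_def)
  then have "card (D ` {..m}) \<le> card (KK ` {..<N})" by (intro card_mono) auto
  also have "\<dots> \<le> N" using card_image_le [of "{..<N}" KK] by simp
  finally show ?thesis by simp
qed

lemma D_event: "e < N \<Longrightarrow> \<exists>k\<le>m. D k = KK e"
  using dirs by (auto simp: inv_dirs_def)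

lemma KK_eq_iff: "k \<le> m \<Longrightarrow> e < 2 * n \<Longrightarrow> KK e = D k \<longleftrightarrow> Arg2pi (Z e) = kang (D' k)"
  using kang_le_iff [of "key (Z e)" "D k"] kang_le_iff [of "D k" "key (Z e)"] key_bounds [of "Z e"]
    D'_bounds [of k] by (auto simp: KK_event kang_key D'_def order_eq_iff)

lemma Z_event: "Z e \<noteq> 0 \<Longrightarrow> e < 2 * n"
  by (simp add: Z_def split: if_splits)

sublocale sectors p r cs "Suc m" "\<lambda>k. kang (D' k)" C pt "\<lambda>k. kang ((D' k + D' (Suc k)) / 2)"
proof
  \<comment> \<open>The artificial events have different keys, so there are two rays even if there
    are no obstacles.\<close>
  have "KK (2 * n) = 0" "KK (2 * n + 1) = 2" by (simp_all add: KK_def Z_def key_def)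
  moreover obtain k k' where "k \<le> m" "D k = KK (2 * n)" "k' \<le> m" "D k' = KK (2 * n + 1)"
    using D_event [of "2 * n"] D_event [of "2 * n + 1"] by (auto simp: N_def)
  ultimately show "2 \<le> Suc m" by (cases m) auto
  show "kang (D' 0) = 0" using dirs by (simp add: D'_def inv_dirs_def)
  show "kang (D' (Suc m)) = 2 * pi" by (simp add: D'_def)
  show "kang (D' i) < kang (D' j)" if "i < j" "j \<le> Suc m" for i j
    using that D'_mono [of i j] D'_bounds [of i] D'_bounds [of j] by (intro kang_strict_mono) auto
  fix k assume k: "k < Suc m"
  then show "kang (D' k) < kang ((D' k + D' (Suc k)) / 2) \<and>
      kang ((D' k + D' (Suc k)) / 2) < kang (D' (Suc k))"
    using D'_mono [of k "Suc k"] D'_bounds [of k] D'_bounds [of "Suc k"]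
    by (intro conjI kang_strict_mono) auto
  have kD: "D' k = D k" "k \<le> m" using k by (auto simp: D'_def)
  show "\<not> cover (kang (D' k)) q" if "C k = 0" for q
    using near [OF kD(2)] that by (simp add: nearest_def kD)
  show "cover (kang (D' k)) q \<and> (\<forall>q'. cover (kang (D' k)) q' \<longrightarrow>
      H q (kang (D' k)) \<le> H q' (kang (D' k)))"
    if "C k = Suc q" for q
    using near [OF kD(2)] that by (simp add: nearest_def kD)
  show "pt k \<le> r" using pts kD by (simp add: inv_pts_def)
  show "pt k \<le> reach e" if "e < 2 * n" "Z e \<noteq> 0" "Arg2pi (Z e) = kang (D' k)" for e
    using pts kD that KK_eq_iff [OF kD(2) that(1)] by (auto simp: inv_pts_def N_def)
  show "pt k = r \<or> (\<exists>e<2 * n. Z e \<noteq> 0 \<and> Arg2pi (Z e) = kang (D' k) \<and> pt k = reach e)"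
    using pts kD KK_eq_iff [OF kD(2)] Z_event unfolding inv_pts_def by blast
next
  fix e assume "e < 2 * n"
  then obtain k where "k \<le> m" "D k = KK e" using D_event [of e] by (auto simp: N_def)
  then show "\<exists>k<Suc m. kang (D' k) = Arg2pi (Z e)"
    using \<open>e < 2 * n\<close> by (intro exI [of _ k]) (auto simp: D'_def KK_event kang_key)
qed

definition out :: "nat \<Rightarrow> (bool \<times> complex) list" where
  "out k = entries (map (\<lambda>l. (from_pt l, appendix l)) (concat (map labels [0..<k])))"

lemma out_0: "out 0 = []"
  by (simp add: out_def entries_def)

lemma out_Suc:
  "out (Suc k) = out k @ (if \<rho> k < fm k then [(False, pol p (fm k) (kang (D' k)))] else []) @
     (if \<rho> k < f k (kang (D' k)) then [(False, pol p (\<rho> k) (kang (D' k)))] else []) @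
     [(False, pol p (f k (kang (D' k))) (kang (D' k)))] @
     (if C k = 0 then [(True, pol p r (kang ((D' k + D' (Suc k)) / 2)))] else [])"
  by (simp add: out_def entries_def labels_def from_pt_def appendix_def)

definition ctx :: "state \<Rightarrow> bool" where
  "ctx s \<longleftrightarrow> env s \<and> nmem s 15 0 = m \<and> nmem s 9 = C \<and> (\<forall>k\<le>Suc m. rmem s 6 k = D' k) \<and> rmem s 7 = pt"

lemma ctx_frame:
  assumes "ctx s" "frame A B s s'" "A \<inter> {0, 5, 6, 9, 15} = {}" "B \<inter> {0, 3, 4, 5, 6, 7} = {}"
  shows "ctx s'"
proof -
  have "env s'" using env_frame [OF assms(2)] assms(1,3,4) by (auto simp: ctx_def)
  moreover have "nmem s' 15 = nmem s 15" "nmem s' 9 = nmem s 9" "rmem s' 6 = rmem s 6"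
      "rmem s' 7 = rmem s 7"
    using assms by (auto simp: frame_def)
  ultimately show ?thesis using assms(1) by (simp add: ctx_def)
qed

definition out_inv :: "state \<Rightarrow> bool" where
  "out_inv s \<longleftrightarrow> ctx s \<and> nmem s 17 0 \<le> Suc m \<and>
     nmem s 18 0 = (if nmem s 17 0 = 0 then C m else C (nmem s 17 0 - 1)) \<and>
         listed (out (nmem s 17 0)) s"

lemma hit_value:
  assumes "env s" "faces s (D k)" "k \<le> m" "j \<le> m" "0 < C j"
  shows "gval hitE s (C j) = H (C j - 1) (kang (D k))"
proof -
  obtain q where q: "C j = Suc q" using assms(5) by (cases "C j") auto
  then have "q < n" using near [OF assms(4)] by (simp add: nearest_def cover_def nondeg_def)
  then show ?thesis using gval_hitE_H [OF assms(1,2)] q D'_bounds [of k] assms(3)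
      by (simp add: D'_def)
qed

lemma wp_measure_ray:
  assumes inv: "out_inv s" and k: "nmem s 17 0 = k" "k \<le> m"
  shows "wp measure_ray (\<lambda>s'. faces s' (D' k) \<and> rmem s' 14 0 = fm k \<and>
      rmem s' 15 0 = f k (kang (D' k)) \<and>
    rmem s' 16 0 = \<rho> k \<and> frame {} {8, 9, 10, 14, 15, 16} s s') s" (is "wp _ ?Q _")
proof -
  have env: "env s" and mem: "nmem s 9 = C" "rmem s 6 k = D' k" "rmem s 7 = pt" "rmem s 0 2 = r"
    using inv k by (auto simp: out_inv_def ctx_def env_def)
  define j where "j = (if k = 0 then m else k - 1)"
  have j: "j \<le> m" "nmem s 18 0 = C j" using inv k by (auto simp: out_inv_def j_def)
  have fm: "fm k = (if C j = 0 then r else H (C j - 1) (kang (D' k)))"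
  proof (cases "k = 0")
    case True
    \<comment> \<open>\<open>fm 0\<close> is defined at the angle \<open>2 * pi\<close>, whereas the
      machine measures along the ray of angle 0; \<open>H\<close> depends on the direction
      only.\<close>
    then have "cis (2 * pi) = cis (kang (D' k))" using Th0 by simp
    then show ?thesis using True H_cis [of "2 * pi" "kang (D' k)"] by (simp add: fm_def f_def j_def)
  qed (simp add: fm_def f_def j_def)
  define s1 where "s1 = rwrite 9 0 (Im (kdir (D' k))) (rwrite 8 0 (Re (kdir (D' k))) (rwrite 10 0
      (D' k) s))"
  have Dk: "D' k = D k" using k by (simp add: D'_def)
  have fc1: "faces s1 (D' k)" by (simp add: faces_def s1_def)
  have hv: "gval hitE s' (C i) = H (C i - 1) (kang (D' k))"
    if "frame {} {14} s1 s'" "i \<le> m" "0 < C i" for i s'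
  proof -
    have "frame {} {8, 9, 10, 14} s s'" using that(1) by (auto simp: frame_def s1_def)
    from env_frame [OF this env] have "env s'" by auto
    moreover have "faces s' (D k)" using fc1 that(1) by (simp add: faces_def frame_def Dk)
    ultimately show ?thesis using hit_value [of s' k i] that k Dk by simp
  qed
  have fr1: "frame {} {14} s1 s1" "\<And>v. frame {} {14} s1 (rwrite 14 0 v s1)"
      by (auto simp: frame_def)
  have n1: "nmem s1 = nmem s" "rmem s1 0 = rmem s 0" "rmem s1 7 = rmem s 7" by (auto simp: s1_def)
  have "wp side_values (\<lambda>s'. s' = rwrite 15 0 (f k (kang (D' k))) (rwrite 14 0 (fm k) s1)) s1"
    using hv [OF fr1(1), of j] hv [OF fr1(2), of k] j k mem
    by (simp add: side_values_def rval_hitE n1 fm f_def)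
  then have tail: "wp side_values (wp least_value ?Q) s1"
    by (rule wp_mono) (use mem k in \<open>auto simp: least_value_def faces_def frame_def s1_def \<rho>_def
        min_def\<close>)
  have "wp face_ray (\<lambda>s'. s' = s1) s"
    using mem k by (simp add: face_ray_def wp_direction s1_def)
  then have "wp face_ray (wp (Seq side_values least_value) ?Q) s"
    by (rule wp_mono) (simp add: tail)
  then show ?thesis by (simp add: measure_ray_def)
qed

definition drawing :: "nat \<Rightarrow> (bool \<times> complex) list \<Rightarrow> state \<Rightarrow> bool" where
  "drawing k xs s \<longleftrightarrow> ctx s \<and> nmem s 17 0 = k \<and> faces s (D' k) \<and> rmem s 14 0 = fm k \<and>
     rmem s 15 0 = f k (kang (D' k)) \<and> rmem s 16 0 = \<rho> k \<and> listed xs s"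

lemma ctx_center: "ctx s \<Longrightarrow> p = Complex (rmem s 0 0) (rmem s 0 (Suc 0))"
  by (simp add: ctx_def env_def)

lemma wp_emit_vertex:
  assumes "drawing k xs s" "k \<le> m" "i \<in> {14, 15, 16}"
  shows "wp (emit 0 (W i)) (drawing k (xs @ [(False, pol p (rmem s i 0) (kang (D' k)))])) s"
proof -
  have "cis (kang (D' k)) = Complex (rmem s 8 0) (rmem s 9 0)"
    using assms(1,2) cis_kang [of "D' k"] D'_bounds [of k] by (simp add: drawing_def faces_def)
  then have "wp (emit (of_bool False) (W i)) (\<lambda>s'. listed (xs @ [(False, pol p (rval (W i) s) (kang
      (D' k)))]) s' \<and>
    frame {2, 3, 4, 16} {1, 2} s s') s"
    using assms ctx_center by (intro wp_emit) (auto simp: drawing_def)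
  then have "wp (emit 0 (W i)) (\<lambda>s'. listed (xs @ [(False, pol p (rmem s i 0) (kang (D' k)))]) s' \<and>
    frame {2, 3, 4, 16} {1, 2} s s') s" by simp
  then show ?thesis
  proof (rule wp_mono)
    fix s' assume *: "listed (xs @ [(False, pol p (rmem s i 0) (kang (D' k)))]) s' \<and>
        frame {2, 3, 4, 16} {1, 2} s s'"
    have "ctx s'" by (rule ctx_frame [of s "{2, 3, 4, 16}" "{1, 2}"]) (use * assms in \<open>auto simp:
        drawing_def\<close>)
    moreover have "nmem s' 17 = nmem s 17" "rmem s' 8 = rmem s 8" "rmem s' 9 = rmem s 9"
      "rmem s' 14 = rmem s 14" "rmem s' 15 = rmem s 15" "rmem s' 16 = rmem s 16"
      using * by (auto simp: frame_def)
    ultimately show "drawing k (xs @ [(False, pol p (rmem s i 0) (kang (D' k)))]) s'"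
      using * assms(1) by (simp add: drawing_def faces_def)
  qed
qed

lemma wp_emit_appendix:
  assumes "drawing k xs s" "k \<le> m"
  shows "wp emit_appendix (\<lambda>s'. ctx s' \<and> nmem s' 17 0 = k \<and>
    listed (xs @ (if C k = 0 then [(True, pol p r (kang ((D' k + D' (Suc k)) / 2)))] else [])) s')
        s"
proof (cases "C k = 0")
  case False
  then show ?thesis using assms by (auto simp: emit_appendix_def drawing_def ctx_def)
next
  case True
  define \<kappa> where "\<kappa> = (D' k + D' (Suc k)) / 2"
  define s1 where "s1 = rwrite 9 0 (Im (kdir \<kappa>)) (rwrite 8 0 (Re (kdir \<kappa>)) (rwrite 10 0 \<kappa> s))"
  have mem: "nmem s 9 = C" "rmem s 6 k = D' k" "rmem s 6 (Suc k) = D' (Suc k)" "nmem s 17 0 = k"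
      "rmem s 0 2 = r"
    using assms by (auto simp: drawing_def ctx_def env_def)
  have fr: "frame {} {8, 9, 10} s s1" by (auto simp: frame_def s1_def)
  have ctx1: "ctx s1" by (rule ctx_frame [OF _ fr]) (use assms in \<open>auto simp: drawing_def\<close>)
  have "cis (kang \<kappa>) = Complex (rmem s1 8 0) (rmem s1 9 0)"
    using cis_kang [of \<kappa>] D'_bounds [of k] D'_bounds [of "Suc k"] assms(2)
        by (simp add: s1_def \<kappa>_def)
  moreover have "listed xs s1" by (rule listed_frame [OF fr]) (use assms in \<open>auto simp:
      drawing_def\<close>)
  ultimately have "wp (emit (of_bool True) (RRead 0 (NConst 2)))
    (\<lambda>s'. listed (xs @ [(True, pol p (rval (RRead 0 (NConst 2)) s1) (kang \<kappa>))]) s' \<and>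
      frame {2, 3, 4, 16} {1, 2} s1 s') s1"
    using ctx_center [OF ctx1] by (intro wp_emit) auto
  then have "wp (emit (of_bool True) (RRead 0 (NConst 2))) (\<lambda>s'. ctx s' \<and> nmem s' 17 0 = k \<and>
    listed (xs @ [(True, pol p r (kang \<kappa>))]) s') s1"
  proof (rule wp_mono)
    fix s' assume *: "listed (xs @ [(True, pol p (rval (RRead 0 (NConst 2)) s1) (kang \<kappa>))]) s' \<and>
      frame {2, 3, 4, 16} {1, 2} s1 s'"
    have "ctx s'" by (rule ctx_frame [OF ctx1, of "{2, 3, 4, 16}" "{1, 2}"]) (use * in auto)
    moreover have "nmem s' 17 0 = k" using * mem by (simp add: frame_def s1_def)
    moreover have "rmem s1 0 2 = r" using mem by (simp add: s1_def)
    ultimately show "ctx s' \<and> nmem s' 17 0 = k \<and> listed (xs @ [(True, pol p r (kang \<kappa>))]) s'"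
      using * by simp
  qed
  then show ?thesis using True mem
    by (simp add: emit_appendix_def wp_direction s1_def \<kappa>_def)
qed

lemma wp_output_body:
  assumes inv: "out_inv s" and le: "nmem s 17 0 \<le> m"
  shows "wp output_body (\<lambda>s'. out_inv s' \<and> Suc m - nmem s' 17 0 < Suc m - nmem s 17 0) s"
proof -
  define k where "k = nmem s 17 0"
  have k: "k \<le> m" using le by (simp add: k_def)
  define xs1 where "xs1 = out k @ (if \<rho> k < fm k then [(False, pol p (fm k) (kang (D' k)))] else
      [])"
  define xs2 where "xs2 = xs1 @ (if \<rho> k < f k (kang (D' k)) then [(False, pol p (\<rho> k) (kang (D'
      k)))] else [])"
  define xs3 where "xs3 = xs2 @ [(False, pol p (f k (kang (D' k))) (kang (D' k)))]"
  have xs4: "xs3 @ (if C k = 0 then [(True, pol p r (kang ((D' k + D' (Suc k)) / 2)))] else []) =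
      out (Suc k)"
    by (simp add: out_Suc xs3_def xs2_def xs1_def)
  have 0: "wp measure_ray (drawing k (out k)) s"
  proof (rule wp_mono [OF wp_measure_ray [OF inv k_def [symmetric] k]])
    fix s' assume *: "faces s' (D' k) \<and> rmem s' 14 0 = fm k \<and> rmem s' 15 0 = f k (kang (D' k)) \<and>
      rmem s' 16 0 = \<rho> k \<and> frame {} {8, 9, 10, 14, 15, 16} s s'"
    have "ctx s'" by (rule ctx_frame [of s "{}" "{8, 9, 10, 14, 15, 16}"]) (use * inv in \<open>auto simp:
        out_inv_def\<close>)
    moreover have "listed (out k) s'"
      by (rule listed_frame [of "{}" "{8, 9, 10, 14, 15, 16}" s]) (use * inv in \<open>auto simp:
          out_inv_def k_def\<close>)
    moreover have "nmem s' 17 0 = k" using * by (simp add: frame_def k_def)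
    ultimately show "drawing k (out k) s'" using * by (simp add: drawing_def)
  qed
  have 1: "wp (If (RLess (W 16) (W 14)) (emit 0 (W 14)) Skip) (drawing k xs1) s'"
      if "drawing k (out k) s'" for s'
    using wp_emit_vertex [OF that k, of 14] that by (simp add: xs1_def drawing_def)
  have 2: "wp (If (RLess (W 16) (W 15)) (emit 0 (W 16)) Skip) (drawing k xs2) s'"
      if "drawing k xs1 s'" for s'
    using wp_emit_vertex [OF that k, of 16] that by (simp add: xs2_def drawing_def)
  have 3: "wp (emit 0 (W 15)) (drawing k xs3) s'" if "drawing k xs2 s'" for s'
    using wp_emit_vertex [OF that k, of 15] that by (simp add: xs3_def drawing_def)
  have 4: "wp emit_appendix (wp (Seq (NAssign 18 (NConst 0) (NRead 9 (V 17))) (NAssign 17 (NConst 0)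
      (NAdd (V 17) (NConst 1))))
      (\<lambda>s'. out_inv s' \<and> Suc m - nmem s' 17 0 < Suc m - nmem s 17 0)) s'" if "drawing k xs3
          s'" for s'
  proof (rule wp_mono [OF wp_emit_appendix [OF that k, unfolded xs4]])
    fix s2 assume *: "ctx s2 \<and> nmem s2 17 0 = k \<and> listed (out (Suc k)) s2"
    let ?s = "nwrite 17 0 (Suc k) (nwrite 18 0 (C k) s2)"
    have fr: "frame {17, 18} {} s2 ?s" by (auto simp: frame_def)
    have "ctx ?s" by (rule ctx_frame [OF _ fr]) (use * in auto)
    moreover have "listed (out (Suc k)) ?s" by (rule listed_frame [OF fr]) (use * in auto)
    ultimately have "out_inv ?s" using k by (simp add: out_inv_def)
    then show "wp (Seq (NAssign 18 (NConst 0) (NRead 9 (V 17))) (NAssign 17 (NConst 0) (NAdd (V 17)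
        (NConst 1))))
      (\<lambda>s'. out_inv s' \<and> Suc m - nmem s' 17 0 < Suc m - nmem s 17 0) s2"
      using * k by (simp add: ctx_def k_def [symmetric])
  qed
  show ?thesis
    unfolding output_body_def wp.simps(4) [of measure_ray] wp.simps(4) [of "If _ _ _"]
      wp.simps(4) [of "emit _ _"] wp.simps(4) [of emit_appendix]
    by (rule wp_mono [OF 0], rule wp_mono [OF 1], assumption, rule wp_mono [OF 2], assumption,
        rule wp_mono [OF 3], assumption, rule 4)
qed

lemma out_nonempty: "out (Suc m) \<noteq> []"
  by (simp add: out_Suc)

lemma runs_write_boundary:
  assumes env: "env s" and mem: "nmem s 15 0 = m" "nmem s 9 = C" "rmem s 6 = D" "rmem s 7 = pt"
    and zero: "nmem s 16 0 = 0" "nmem s 17 0 = 0" "nmem s 1 0 = 0"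
  shows "runs write_boundary s (cmax output_init + (Suc N * (20 + cmax output_body) + cmax
      output_close))
    (\<lambda>s'. holds_dll s' (entries fan_edges))"
proof -
  let ?b = "BNot (NLess (V 15) (V 17))"
  let ?s = "nwrite 18 0 (C m) (rwrite 6 (Suc m) 4 s)"
  have fr: "frame {18} {6} s ?s" by (auto simp: frame_def)
  have "ctx ?s"
    using env_frame [OF fr env] mem by (auto simp: ctx_def D'_def)
  then have "out_inv ?s" using zero by (simp add: out_inv_def out_0 listed_def)
  then have "wp output_init (\<lambda>s'. out_inv s' \<and> nmem s' 17 0 = 0 \<and> nmem s' 1 0 = 0) s"
    using mem zero by (simp add: output_init_def)
  then have init: "runs output_init s (cmax output_init) (\<lambda>s'. out_inv s' \<and> nmem s' 17 0 = 0 \<and>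
      nmem s' 1 0 = 0)"
    by (rule runs_wp)
  have loop: "runs (While ?b output_body) s1 (Suc N * (20 + cmax output_body))
      (\<lambda>s'. out_inv s' \<and> nmem s' 17 0 = Suc m \<and> nmem s' 1 0 = 0)"
    if "out_inv s1 \<and> nmem s1 17 0 = 0 \<and> nmem s1 1 0 = 0" for s1
  proof -
    have "bval ?b s' \<longleftrightarrow> nmem s' 17 0 \<le> m" if "out_inv s'" for s'
      using that by (auto simp: out_inv_def ctx_def)
    then have "runs (While ?b output_body) s1 (Suc (Suc m - nmem s1 17 0) * (1 + bcost ?b + cmax
        output_body))
        (\<lambda>s'. out_inv s' \<and> \<not> bval ?b s')"
      using wp_output_body that by (intro runs_While runs_wp) auto
    from runs_frame [OF this] show ?thesis
    proof (rule runs_mono)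
      show "Suc (Suc m - nmem s1 17 0) * (1 + bcost ?b + cmax output_body) \<le> Suc N * (20 + cmax
          output_body)"
        using m_less_N by (intro mult_le_mono) simp_all
      fix s' assume *: "(out_inv s' \<and> \<not> bval ?b s') \<and>
        frame (nbanks (While ?b output_body)) (rbanks (While ?b output_body)) s1 s'"
      have "1 \<notin> nbanks (While ?b output_body)"
        by (simp add: output_body_def measure_ray_def face_ray_def side_values_def
            least_value_def direction_def emit_def emit_appendix_def)
      then have "nmem s' 1 = nmem s1 1" using * by (simp add: frame_def)
      moreover have "nmem s' 17 0 = Suc m" using * by (auto simp: out_inv_def ctx_def)
      ultimately show "out_inv s' \<and> nmem s' 17 0 = Suc m \<and> nmem s' 1 0 = 0" using * that by simp
    qed
  qed
  have close: "runs output_close s1 (cmax output_close) (\<lambda>s'. holds_dll s' (entries fan_edges))"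
    if "out_inv s1 \<and> nmem s1 17 0 = Suc m \<and> nmem s1 1 0 = 0" for s1
  proof -
    have "out (Suc m) = entries fan_edges" by (simp add: out_def fan_edges_def)
    moreover have "listed (out (nmem s1 17 0)) s1" using that unfolding out_inv_def by blast
    then have "listed (out (Suc m)) s1" using that by simp
    ultimately show ?thesis using holds_dll_listed [of "out (Suc m)" s1] that out_nonempty
      by (intro runs_wp) simp
  qed
  show ?thesis unfolding write_boundary_def
    by (rule runs_Seq [OF init], rule runs_Seq [OF loop], assumption, rule close)
qed

end

definition visibility_program :: com where
  "visibility_program = Seq init (Seq load (Seq wraps (Seq build (Seq sweep write_boundary))))"

definition time_bound :: "nat \<Rightarrow> nat \<Rightarrow> nat" where
  "time_bound N L = cmax init + (Suc N * (10 + cmax load_body) + (Suc N * (10 + cmax wrap_body) +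
     (Suc N * (20 + cmax build_body) + (Suc N * (10 + main_cost L) +
     (cmax output_init + (Suc N * (20 + cmax output_body) + cmax output_close))))))"

context obst
begin

lemma runs_init:
  "runs init (input_state p r cs) (cmax init) (\<lambda>s. load_inv s \<and> (\<forall>b. b \<notin> {0, 5} \<longrightarrow>
      nmem s b = (\<lambda>_. 0)) \<and>
     rmem s 6 = (\<lambda>_. 0) \<and> rmem s 7 0 = r \<and> rmem s 8 0 = 1 \<and> rmem s 9 0 = 0)"
proof (rule runs_wp)
  let ?i = "input_state p r cs"
  let ?s = "rwrite 8 0 1 (rwrite 7 0 r (rwrite 5 (2 * n + 1) 2 (nwrite 5 0 N ?i)))"
  have z: "\<And>b i. b \<noteq> 0 \<Longrightarrow> nmem ?i b i = 0" "\<And>b i. b \<noteq> 0 \<Longrightarrow> rmem ?i b i = 0"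
    by (simp_all add: input_state_def)
  have "load_inv ?s" using z input_params by (simp add: load_inv_def N_def KK_def)
  then show "wp init (\<lambda>s. load_inv s \<and> (\<forall>b. b \<notin> {0, 5} \<longrightarrow> nmem s b = (\<lambda>_. 0)) \<and>
     rmem s 6 = (\<lambda>_. 0) \<and> rmem s 7 0 = r \<and> rmem s 8 0 = 1 \<and> rmem s 9 0 = 0) ?i"
    using z input_params by (auto simp: init_def N_def mult_2 fun_eq_iff)
qed

text \<open>The last ray is followed by no turn that would have established \<open>nearest\<close>
  for it. Since all events are processed, \<open>nearest_root\<close> applies to the final root
  instead.\<close>

lemma swept_final:
  assumes "sweep_inv {..<N} s"
  shows "swept p r cs (nmem s 15 0) (rmem s 6) (nmem s 9) (rmem s 7)"
proof
  have inv: "inv_dirs {..<N} (nmem s 15 0) (rmem s 6)" using assms by (simp add: sweep_inv_def)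
  then show "inv_dirs {..<N} (nmem s 15 0) (rmem s 6)" .
  show "inv_pts {..<N} (nmem s 15 0) (rmem s 6) (rmem s 7)" using assms by (simp add: sweep_inv_def)
  fix k assume k: "k \<le> nmem s 15 0"
  show "nearest (rmem s 6 k) (nmem s 9 k)"
  proof (cases "k < nmem s 15 0")
    case True
    then show ?thesis using assms by (simp add: sweep_inv_def)
  next
    case False
    then have eq: "k = nmem s 15 0" using k by simp
    have "0 \<in> {..<N}" by (simp add: N_def)
    then have "{..<N} \<noteq> {}" by blast
    then have "nmem s 9 k = nmem s 8 1" using assms eq by (simp add: sweep_inv_def)
    moreover have "nearest (rmem s 6 k) (nmem s 8 1)"
    proof (rule nearest_root)
      show "\<And>e. e < N \<Longrightarrow> e \<in> {..<N} \<longleftrightarrow> KK e \<le> rmem s 6 k" using inv_dirs_le [OF inv] eq by simp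
    qed (use assms eq inv_dirs_bounds [OF inv, of k] in \<open>auto simp: sweep_inv_def\<close>)
    ultimately show ?thesis by simp
  qed
qed

theorem runs_visibility_program:
  assumes L: "2 * N \<le> 2 ^ Suc L"
  shows "runs visibility_program (input_state p r cs) (time_bound N L)
    (\<lambda>s. \<exists>es. represents_boundary p r es (circ_vis_region cs p r) \<and> holds_dll s (entries es))"
proof -
  define P0 where "P0 s \<longleftrightarrow> load_inv s \<and> (\<forall>b. b \<notin> {0, 5} \<longrightarrow> nmem s b = (\<lambda>_. 0)) \<and>
     rmem s 6 = (\<lambda>_. 0) \<and> rmem s 7 0 = r \<and> rmem s 8 0 = 1 \<and> rmem s 9 0 = 0" for s
  \<comment> \<open>The common part of the assertions between loading and sweep: the loaded data,
    the banks that have to be still zero later on, and the first ray.\<close>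
  define base where "base s \<longleftrightarrow> env s \<and> (\<forall>b\<in>{1, 9, 15, 16, 17}. nmem s b = (\<lambda>_. 0)) \<and>
     rmem s 6 = (\<lambda>_. 0) \<and> rmem s 7 0 = r \<and> rmem s 8 0 = 1 \<and> rmem s 9 0 = 0" for s
  define P1 where "P1 s \<longleftrightarrow> base s \<and> (\<forall>e<N. nmem s 7 (N + e) = e + 1) \<and>
      (\<forall>b\<in>{8, 12}. nmem s b = (\<lambda>_. 0))" for s
  define P2 where "P2 s \<longleftrightarrow> base s \<and> (\<forall>e<N. nmem s 7 (N + e) = e + 1) \<and>
     (\<forall>q. nmem s 8 (N + q) = (if wrapping q then q + 1 else 0))" for s
  define P3 where "P3 s \<longleftrightarrow> sweep_inv {} s \<and> (\<forall>b\<in>{1, 16, 17}. nmem s b = (\<lambda>_. 0))" for s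
  define P4 where "P4 s \<longleftrightarrow> sweep_inv {..<N} s \<and> (\<forall>b\<in>{1, 16, 17}. nmem s b = (\<lambda>_. 0))" for s
  have base_frame: "base s'" if "base s" "frame A {} s s'" "A \<subseteq> {7, 8, 11, 12}" for A s s'
  proof -
    have "env s'" by (rule env_frame [OF that(2)]) (use that in \<open>auto simp: base_def\<close>)
    moreover have "\<forall>b\<in>{1, 9, 15, 16, 17}. nmem s' b = nmem s b" "rmem s' = rmem s"
      using that(2,3) by (auto simp: frame_def)
    ultimately show ?thesis using that(1) by (simp add: base_def)
  qed
  have 0: "runs init (input_state p r cs) (cmax init) P0" using runs_init unfolding P0_def .
  have 1: "runs load s (Suc N * (10 + cmax load_body)) P1" if "P0 s" for s
  proof -
    have "load_inv s" using that by (simp add: P0_def)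
    from runs_load [OF this] show ?thesis
      by (rule runs_mono) (use that in \<open>simp_all add: P0_def P1_def base_def frame_def\<close>)
  qed
  have 2: "runs wraps s (Suc N * (10 + cmax wrap_body)) P2" if P1: "P1 s" for s
  proof -
    have "runs wraps s (Suc n * (10 + cmax wrap_body))
      (\<lambda>s'. (\<forall>q. nmem s' 8 (N + q) = (if wrapping q then q + 1 else 0)) \<and> frame {8, 12} {} s s')"
      using P1 by (intro runs_wraps) (auto simp: P1_def base_def)
    then show ?thesis
    proof (rule runs_mono)
      show "Suc n * (10 + cmax wrap_body) \<le> Suc N * (10 + cmax wrap_body)"
          by (intro mult_le_mono) (auto simp: N_def)
      fix s' assume *: "(\<forall>q. nmem s' 8 (N + q) = (if wrapping q then q + 1 else 0)) \<and>
          frame {8, 12} {} s s'"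
      have "base s'" by (rule base_frame [of s "{8, 12}"]) (use * P1 in \<open>auto simp: P1_def\<close>)
      moreover have "nmem s' 7 = nmem s 7" using * by (simp add: frame_def)
      ultimately show "P2 s'" using * P1 by (simp add: P2_def P1_def)
    qed
  qed
  have 3: "runs build s (Suc N * (20 + cmax build_body)) P3" if P2: "P2 s" for s
  proof -
    have "nmem s 5 0 = N" using P2 by (simp add: P2_def base_def env_def)
    from runs_build [OF this] show ?thesis
    proof (rule runs_mono)
      fix s' assume *: "tourn (gval keyE s) N (nmem s' 7) \<and> tourn (gval hitE s) N (nmem s' 8) \<and>
        (\<forall>u\<ge>N. nmem s' 7 u = nmem s 7 u \<and> nmem s' 8 u = nmem s 8 u) \<and> frame {7, 8, 11} {} s s'"
      have b: "base s'" by (rule base_frame [of s "{7, 8, 11}"]) (use * P2 in \<open>auto simp: P2_def\<close>)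
      have "rmem s' = rmem s" using * by (auto simp: frame_def)
      then have g: "gval keyE s' = gval keyE s" "gval hitE s' = gval hitE s"
        by (auto simp: fun_eq_iff gval_keyE gval_hitE)
      have "inv_dirs {} 0 (\<lambda>_. 0)"
        using KK_bounds by (auto simp: inv_dirs_def N_def KK_def Z_def key_def intro!: exI [of _
            "2 * n"])
      moreover have "inv_pts {} 0 (\<lambda>_. 0) (rmem s' 7)" using b by (simp add: inv_pts_def base_def)
      moreover have "faces s' 0" using b by (simp add: faces_def base_def kdir_def)
      moreover have "leaves {} (nmem s' 8)" "events {} (nmem s' 7)"
        using * P2 by (auto simp: leaves_def events_def act_empty P2_def)
      ultimately have "sweep_inv {} s'" using * b g by (simp add: sweep_inv_def base_def)
      then show "P3 s'" using b by (simp add: P3_def base_def)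
    qed simp
  qed
  have 4: "runs sweep s (Suc N * (10 + main_cost L)) P4" if P3: "P3 s" for s
  proof -
    have "sweep_inv {} s" using P3 by (simp add: P3_def)
    from runs_frame [OF runs_sweep [OF this L]] show ?thesis
    proof (rule runs_mono)
      fix s' assume *: "sweep_inv {..<N} s' \<and> frame (nbanks sweep) (rbanks sweep) s s'"
      have "{1, 16, 17} \<inter> nbanks sweep = {}"
        by (simp add: sweep_def sweep_body_def pop_event_def path_def node_def advance_def
            direction_def
            locate_def update_pt_def update_leaf_def Let_def)
      then have "\<forall>b\<in>{1, 16, 17}. nmem s' b = nmem s b" using * unfolding frame_def by blast
      then show "P4 s'" using * P3 by (simp add: P4_def P3_def)
    qed simp
  qed
  have 5: "runs write_boundary s (cmax output_init + (Suc N * (20 + cmax output_body) + cmax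
      output_close))
      (\<lambda>s. \<exists>es. represents_boundary p r es (circ_vis_region cs p r) \<and>
          holds_dll s (entries es))" if P4: "P4 s" for s
  proof -
    interpret swept p r cs "nmem s 15 0" "rmem s 6" "nmem s 9" "rmem s 7"
      using swept_final P4 by (simp add: P4_def)
    have "runs write_boundary s (cmax output_init + (Suc N * (20 + cmax output_body) + cmax
        output_close))
      (\<lambda>s'. holds_dll s' (entries fan_edges))"
      by (rule runs_write_boundary) (use P4 in \<open>auto simp: P4_def sweep_inv_def\<close>)
    then show ?thesis by (rule runs_mono) (use represents_boundary_fan_edges in auto)
  qed
  show ?thesis
    unfolding visibility_program_def time_bound_def
    by (rule runs_Seq [OF 0], rule runs_Seq [OF 1], assumption, rule runs_Seq [OF 2], assumption,
        rule runs_Seq [OF 3], assumption, rule runs_Seq [OF 4], assumption, rule 5)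
qed

end

section \<open>Running time\<close>

lemma main_cost_mono: "L \<le> L' \<Longrightarrow> main_cost L \<le> main_cost L'"
  unfolding main_cost_def by (intro add_mono mult_le_mono) auto

lemma time_bound_mono: "N \<le> N' \<Longrightarrow> L \<le> L' \<Longrightarrow> time_bound N L \<le> time_bound N' L'"
  unfolding time_bound_def using main_cost_mono by (intro add_mono mult_le_mono) auto

lemma main_cost_linear: "\<exists>c. \<forall>L. main_cost L \<le> c * Suc L"
proof -
  \<comment> \<open>\<open>main_cost\<close> is affine in \<open>Suc L\<close> with non-negative
    coefficients, so its value at \<open>Suc L = 1\<close> serves as the factor.\<close>
  define c where "c = main_cost 0"
  have "main_cost L \<le> c * Suc L" for L
    unfolding c_def main_cost_def by (simp add: algebra_simps)
  then show ?thesis by blast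
qed

lemma time_bound_linear: "\<exists>c. \<forall>N L. time_bound N L \<le> c * (Suc N * Suc L)"
proof -
  obtain c where c: "\<And>L. main_cost L \<le> c * Suc L" using main_cost_linear by blast
  \<comment> \<open>Apart from the term with \<open>main_cost L\<close>, the bound is affine in
    \<open>Suc N\<close>, and \<open>time_bound 0 0\<close> dominates the sum of its
    coefficients.\<close>
  define d where "d = time_bound 0 0 + c"
  have "time_bound N L \<le> d * (Suc N * Suc L)" for N L
  proof -
    have "Suc N * main_cost L \<le> Suc N * (c * Suc L)" using c by (intro mult_le_mono) auto
    then have "time_bound N L \<le> (time_bound 0 0) * Suc N + c * (Suc N * Suc L)"
      unfolding time_bound_def by (simp add: algebra_simps)
    also have "\<dots> \<le> time_bound 0 0 * (Suc N * Suc L) + c * (Suc N * Suc L)"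
      by (intro add_mono mult_le_mono) auto
    finally show ?thesis by (simp add: d_def add_mult_distrib)
  qed
  then show ?thesis by blast
qed

text \<open>The nodes of the trees have addresses below \<open>2 * N = 4 * n + 4\<close>.\<close>

definition tree_height :: "nat \<Rightarrow> nat" where
  "tree_height n = nat \<lceil>log 2 (4 * real n + 4)\<rceil>"

lemma tree_height_mono: "m \<le> n \<Longrightarrow> tree_height m \<le> tree_height n"
  unfolding tree_height_def by (intro nat_mono ceiling_mono) simp

lemma tree_height_sufficient: "2 * (2 * n + 2) \<le> 2 ^ Suc (tree_height n)"
proof -
  have "0 \<le> log 2 (4 * real n + 4)" by simp
  then have "log 2 (4 * real n + 4) \<le> real (tree_height n)" unfolding tree_height_def by linarith
  then have "4 * real n + 4 \<le> 2 powr real (tree_height n)" by (simp add: log_le_iff)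
  also have "\<dots> = real (2 ^ tree_height n)" by (simp add: powr_realpow)
  finally have "real (4 * n + 4) \<le> real (2 ^ tree_height n)" by simp
  then have "4 * n + 4 \<le> 2 ^ tree_height n" unfolding of_nat_le_iff .
  then show ?thesis by simp
qed

lemma time_bound_bigo:
  "(\<lambda>n. real (time_bound (2 * n + 2) (tree_height n))) \<in> O(\<lambda>n. real n * ln (real n))"
proof -
  obtain c where c: "\<And>N L. time_bound N L \<le> c * (Suc N * Suc L)" using time_bound_linear by blast
  have "real (time_bound (2 * n + 2) (tree_height n)) \<le>
      real c * ((2 * real n + 3) * (log 2 (4 * real n + 4) + 2))" for n
  proof -
    have "0 \<le> log 2 (4 * real n + 4)" by simp
    then have "real (tree_height n) \<le> log 2 (4 * real n + 4) + 1" unfolding tree_height_def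
        by linarith
    then have "real (Suc (2 * n + 2)) * real (Suc (tree_height n)) \<le>
        (2 * real n + 3) * (log 2 (4 * real n + 4) + 2)" by (intro mult_mono) auto
    then have "real c * (real (Suc (2 * n + 2)) * real (Suc (tree_height n))) \<le>
        real c * ((2 * real n + 3) * (log 2 (4 * real n + 4) + 2))" by (intro mult_left_mono) auto
    moreover have "real (time_bound (2 * n + 2) (tree_height n)) \<le>
        real (c * (Suc (2 * n + 2) * Suc (tree_height n)))" using c of_nat_le_iff by blast
    ultimately show ?thesis by (simp only: of_nat_mult)
  qed
  moreover have "0 \<le> (2 * real n + 3) * (log 2 (4 * real n + 4) + 2)" for n
    by (intro mult_nonneg_nonneg add_nonneg_nonneg) auto
  ultimately have "(\<lambda>n. real (time_bound (2 * n + 2) (tree_height n))) \<in>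
      O(\<lambda>n. (2 * real n + 3) * (log 2 (4 * real n + 4) + 2))"
    by (intro bigoI [of _ "real c"]) (simp add: abs_of_nonneg)
  also have "(\<lambda>n. (2 * real n + 3) * (log 2 (4 * real n + 4) + 2)) \<in> O(\<lambda>n. real n * ln (real n))"
    by real_asymp
  finally show ?thesis .
qed

theorem theorem3:
  shows "\<exists>(prog :: com) (T :: nat \<Rightarrow> nat).
    (\<lambda>n. real (T n)) \<in> O(\<lambda>n. real n * ln (real n)) \<and>
    (\<forall>(p :: complex) (r :: real) (obs :: obstacle list) (cs :: obstacle list).
       r > 0 \<and> candidate_obstacles p r obs cs \<longrightarrow>
       (\<exists>t s es. exec prog (input_state p r cs) t s \<and> t \<le> T (length obs) \<and>
          represents_boundary p r es (circ_vis_region obs p r) \<and>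
          holds_dll s (entries es)))"
proof (intro exI [of _ visibility_program] exI [of _ "\<lambda>n. time_bound (2 * n + 2) (tree_height n)"]
    conjI allI impI)
  fix p :: complex and r :: real and obs cs :: "obstacle list"
  assume asm: "r > 0 \<and> candidate_obstacles p r obs cs"
  interpret obst p r cs
    using asm by unfold_locales (auto simp: candidate_obstacles_def)
  have "2 * N \<le> 2 ^ Suc (tree_height (length cs))" using tree_height_sufficient by (simp add: N_def)
  from runs_visibility_program [OF this] obtain t s es where run:
    "exec visibility_program (input_state p r cs) t s" "t \<le> time_bound N (tree_height (length cs))"
    "represents_boundary p r es (circ_vis_region cs p r)" "holds_dll s (entries es)"
    unfolding runs_def by blast
  \<comment> \<open>The program sees the candidates only; monotonicity turns its bound into one in
    the number of original obstacles.\<close>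
  have "length cs \<le> length obs" using asm by (simp add: candidate_obstacles_def)
  then have "time_bound N (tree_height (length cs)) \<le> time_bound (2 * length obs + 2) (tree_height
      (length obs))"
    by (intro time_bound_mono tree_height_mono) (auto simp: N_def)
  moreover have "circ_vis_region obs p r = circ_vis_region cs p r"
    using asm circ_vis_region_candidates by blast
  ultimately show "\<exists>t s es. exec visibility_program (input_state p r cs) t s \<and>
      t \<le> time_bound (2 * length obs + 2) (tree_height (length obs)) \<and>
      represents_boundary p r es (circ_vis_region obs p r) \<and> holds_dll s (entries es)"
    using run by (metis order_trans)
qed (rule time_bound_bigo)

end
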